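(* Put $c_1=-\frac{74}{972}+\frac{4}{243}\sqrt{10}$ and $c_2=-\frac{74}{972}-\frac{4}{243}\sqrt{10}$. In the pencil of surfaces $S_{IO}+\lambda q^6=0$ in $\mathbb{P}_3(\mathbb{C})$, the surfaces with the following values of $\lambda$ contain the following $IO$-orbits of nodes, where the table gives the orbit length, and the isomorphism type and order of the fix group (stabilizer) of a node in $IO/\{\pm1\}$: \[ \begin{array}{l|c|c|c|c} \lambda&0&c_1&-\frac18&c_2\\ \hline \text{orbit length}&120&240&360&240\\ \text{fix group mod }\pm1&A_4&D_3&\mathbb{Z}_2\times\mathbb{Z}_2&D_3\\ \text{order}&12&6&4&6 \end{array} \]
   Context: Identify $\mathbb{R}^4$ with the quaternions via $(x_0,x_1,x_2,x_3)\leftrightarrow x_0+x_1 i+x_2 j+x_3 k$. A pair $(g_1,g_2)$ of unit quaternions acts on $\mathbb{R}^4$ by $p\mapsto g_1\,p\,g_2^{-1}$; this gives the double covering $SU(2)\times SU(2)\to SO(4)$. Put $\tau=\frac12(1+\sqrt5)$, $\tilde S=\frac12(1+i-j+k)$, $\tilde U=\frac12(\tau+(\tau-1)j+k)$, $\tilde R_4=\frac{1+i}{\sqrt2}$; $\tilde O=\langle i,\tilde R_4,\tilde S\rangle$ (binary octahedral), $\tilde I=\langle i,\tilde S,\tilde U\rangle$ (binary icosahedral). $IO\subset SO(4)$ (order 2880) is the image of $\tilde I\times\tilde O$; it acts on $\mathbb{P}_3(\mathbb{C})$ through $IO/\{\pm1\}$. $q=x_0^2+x_1^2+x_2^2+x_3^2$.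 The space $\mathbb{C}[x_0,x_1,x_2,x_3]^{IO}_{12}$ of $IO$-invariant homogeneous polynomials of degree 12 is two-dimensional, and $S_{IO}$ is the unique element of it satisfying $S_{IO}(x_0,0,x_2,0)=2x_0^2x_2^2(x_0^2-x_2^2)^2(x_0^2+x_2^2)^2$; thus $q^6$ and $S_{IO}$ generate this space. A node is an ordinary double point. $D_3$ is the dihedral group of order 6 and $A_4$ the alternating group on four letters. *)

theory Defs
  imports
    "HOL-Analysis.Analysis"
    "HOL-Algebra.Generated_Groups"
    "HOL-Algebra.Group_Action"
    "HOL-Algebra.Sym_Groups"
    "HOL-Algebra.Elementary_Groups"
begin

section \<open>Quaternions and the group IO\<close>

text \<open>The coordinates \<open>x\<^sub>0, x\<^sub>1, x\<^sub>2, x\<^sub>3\<close> are indexed by the elements \<open>0, 1, 2, 3\<close> of the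
  numeral type \<open>4\<close> (in which \<open>4 = 0\<close>). The vector \<open>x :: real^4\<close> is the quaternion
  \<open>x\<^sub>0 + x\<^sub>1 i + x\<^sub>2 j + x\<^sub>3 k\<close>.\<close>

definition vec4 :: "'a \<Rightarrow> 'a \<Rightarrow> 'a \<Rightarrow> 'a \<Rightarrow> 'a ^ 4" where
  "vec4 a b c d = (\<chi> i. if i = 0 then a else if i = 1 then b else if i = 2 then c else d)"

definition qmult :: "real ^ 4 \<Rightarrow> real ^ 4 \<Rightarrow> real ^ 4" where
  "qmult x y = vec4
     (x$0 * y$0 - x$1 * y$1 - x$2 * y$2 - x$3 * y$3)
     (x$0 * y$1 + x$1 * y$0 + x$2 * y$3 - x$3 * y$2)
     (x$0 * y$2 - x$1 * y$3 + x$2 * y$0 + x$3 * y$1)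
     (x$0 * y$3 + x$1 * y$2 - x$2 * y$1 + x$3 * y$0)"

definition SU2 :: "(real ^ 4) monoid" where
  "SU2 = \<lparr>carrier = {g. norm g = 1}, monoid.mult = qmult, one = vec4 1 0 0 0\<rparr>"

definition tau :: real where
  "tau = (1 + sqrt 5) / 2"

definition quat_i :: "real ^ 4" where
  "quat_i = vec4 0 1 0 0"

definition quat_S :: "real ^ 4" where
  "quat_S = vec4 (1/2) (1/2) (-1/2) (1/2)"

definition quat_U :: "real ^ 4" where
  "quat_U = vec4 (tau/2) 0 ((tau - 1)/2) (1/2)"

definition quat_R4 :: "real ^ 4" where
  "quat_R4 = vec4 (1 / sqrt 2) (1 / sqrt 2) 0 0"

definition binary_octahedral :: "(real ^ 4) set" where
  "binary_octahedral = generate SU2 {quat_i, quat_R4, quat_S}"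

definition binary_icosahedral :: "(real ^ 4) set" where
  "binary_icosahedral = generate SU2 {quat_i, quat_S, quat_U}"

definition SO4 :: "(real ^ 4 ^ 4) monoid" where
  "SO4 = \<lparr>carrier = {A. orthogonal_matrix A \<and> det A = 1}, monoid.mult = (**), one = mat 1\<rparr>"

definition double_cover :: "real ^ 4 \<Rightarrow> real ^ 4 \<Rightarrow> real ^ 4 ^ 4" where
  "double_cover g1 g2 = matrix (\<lambda>p. qmult (qmult g1 p) (inv\<^bsub>SU2\<^esub> g2))"

definition IO :: "(real ^ 4 ^ 4) monoid" where
  "IO = SO4\<lparr>carrier := {double_cover g1 g2 | g1 g2. g1 \<in> binary_icosahedral \<and> g2 \<in> binary_octahedral}\<rparr>"

definition PIO :: "(real ^ 4 ^ 4) set monoid" where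
  "PIO = IO Mod {mat 1, - mat 1}"


section \<open>The action on complex projective 3-space\<close>

definition P3 :: "(complex ^ 4) set set" where
  "P3 = {vec.span {v} | v. v \<noteq> 0}"

definition complex_act :: "real ^ 4 ^ 4 \<Rightarrow> complex ^ 4 \<Rightarrow> complex ^ 4" where
  "complex_act A x = map_matrix complex_of_real A *v x"

text \<open>An element of \<^const>\<open>PIO\<close> is a coset \<open>{A, -A}\<close>. Both representatives map a line through the
  origin onto the same line, which is therefore the union below. The restriction to \<^const>\<open>P3\<close>
  is what \<^locale>\<open>group_action\<close> requires.\<close>

definition PIO_act :: "(real ^ 4 ^ 4) set \<Rightarrow> (complex ^ 4) set \<Rightarrow> (complex ^ 4) set" where
  "PIO_act C = (\<lambda>p\<in>P3. \<Union>A\<in>C. complex_act A ` p)"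


section \<open>Invariant polynomials and the pencil\<close>

text \<open>Since the complex field is infinite, polynomials in four variables are identified with the
  functions on \<open>complex^4\<close> they induce.\<close>

definition exponents :: "nat \<Rightarrow> (4 \<Rightarrow> nat) set" where
  "exponents d = {e. (\<Sum>i\<in>UNIV. e i) = d}"

lemma finite_exponents: "finite (exponents d)"
proof (rule finite_subset)
  show "exponents d \<subseteq> PiE UNIV (\<lambda>_. {..d})"
    by (auto simp: exponents_def intro: member_le_sum)
  show "finite (PiE (UNIV :: 4 set) (\<lambda>_. {..d}))"
    by (intro finite_PiE) auto
qed

definition homogeneous_polys :: "nat \<Rightarrow> (complex ^ 4 \<Rightarrow> complex) set" where
  "homogeneous_polys d =
     {P. \<exists>a :: (4 \<Rightarrow> nat) \<Rightarrow> complex. \<forall>x. P x = (\<Sum>e\<in>exponents d. a e * (\<Prod>i\<in>UNIV. x $ i ^ e i))}"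

definition IO_invariants :: "nat \<Rightarrow> (complex ^ 4 \<Rightarrow> complex) set" where
  "IO_invariants d = {P \<in> homogeneous_polys d. \<forall>A\<in>carrier IO. \<forall>x. P (complex_act A x) = P x}"

definition q :: "complex ^ 4 \<Rightarrow> complex" where
  "q x = (x$0)^2 + (x$1)^2 + (x$2)^2 + (x$3)^2"

definition S_IO :: "complex ^ 4 \<Rightarrow> complex" where
  "S_IO = (THE P. P \<in> IO_invariants 12 \<and>
     (\<forall>x0 x2. P (vec4 x0 0 x2 0) = 2 * x0^2 * x2^2 * (x0^2 - x2^2)^2 * (x0^2 + x2^2)^2))"

definition pencil :: "complex \<Rightarrow> complex ^ 4 \<Rightarrow> complex" where
  "pencil l x = S_IO x + l * q x ^ 6"


section \<open>Nodes\<close>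

definition partial_deriv :: "'n::finite \<Rightarrow> (complex ^ 'n \<Rightarrow> complex) \<Rightarrow> complex ^ 'n \<Rightarrow> complex" where
  "partial_deriv i f a = deriv (\<lambda>t. f (a + t *s axis i 1)) 0"

definition hessian :: "(complex ^ 'n::finite \<Rightarrow> complex) \<Rightarrow> complex ^ 'n \<Rightarrow> complex ^ 'n ^ 'n" where
  "hessian f a = (\<chi> i j. partial_deriv i (partial_deriv j f) a)"

definition ordinary_double_point :: "(complex ^ 'n::finite \<Rightarrow> complex) \<Rightarrow> complex ^ 'n \<Rightarrow> bool" where
  "ordinary_double_point f a \<longleftrightarrow>
     f a = 0 \<and> (\<forall>i. partial_deriv i f a = 0) \<and> det (hessian f a) \<noteq> 0"

text \<open>The standard affine charts \<open>x\<^sub>k = 1\<close> of projective space. The affine coordinates are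
  \<open>y\<^sub>1, y\<^sub>2, y\<^sub>3\<close>, the indices being the elements of the numeral type \<open>3\<close> (where \<open>3 = 0\<close>).\<close>

definition chart :: "4 \<Rightarrow> complex ^ 3 \<Rightarrow> complex ^ 4" where
  "chart k y =
     (if k = 0 then vec4 1 (y$1) (y$2) (y$3)
      else if k = 1 then vec4 (y$1) 1 (y$2) (y$3)
      else if k = 2 then vec4 (y$1) (y$2) 1 (y$3)
      else vec4 (y$1) (y$2) (y$3) 1)"

text \<open>\<open>p\<close> is a node of the surface \<open>F = 0\<close>, for homogeneous \<open>F\<close>: in an affine chart containing
  \<open>p\<close>, the dehomogenized equation has an ordinary double point at \<open>p\<close>. The notion does not depend
  on the chart.\<close>

definition is_node :: "(complex ^ 4 \<Rightarrow> complex) \<Rightarrow> (complex ^ 4) set \<Rightarrow> bool" where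
  "is_node F p \<longleftrightarrow> p \<in> P3 \<and>
     (\<exists>k y. chart k y \<in> p \<and> ordinary_double_point (\<lambda>z. F (chart k z)) y)"


section \<open>Orbits of nodes and their fix groups\<close>

text \<open>Dihedral group of order \<open>2n\<close> (for \<open>n > 0\<close>): the pair \<open>(a, s)\<close> is the rotation \<open>r\<^sup>a\<close> if
  \<open>s\<close> is false and the reflection \<open>r\<^sup>a f\<close> otherwise, where \<open>f r f = r\<^sup>-\<^sup>1\<close>.\<close>

definition dihedral_group :: "nat \<Rightarrow> (int \<times> bool) monoid" where
  "dihedral_group n = \<lparr>carrier = {0..<int n} \<times> UNIV,
     monoid.mult = (\<lambda>(a, s) (b, t). ((if s then a - b else a + b) mod int n, s \<noteq> t)),
     one = (0, False)\<rparr>"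

definition fix_group :: "(complex ^ 4) set \<Rightarrow> (real ^ 4 ^ 4) set monoid" where
  "fix_group p = PIO\<lparr>carrier := stabilizer PIO PIO_act p\<rparr>"

definition has_node_orbit ::
  "(complex ^ 4 \<Rightarrow> complex) \<Rightarrow> nat \<Rightarrow> ('a, 'b) monoid_scheme \<Rightarrow> nat \<Rightarrow> bool" where
  "has_node_orbit F len H ord \<longleftrightarrow>
     (\<exists>\<Omega>\<in>orbits PIO P3 PIO_act. card \<Omega> = len \<and>
        (\<forall>p\<in>\<Omega>. is_node F p \<and> fix_group p \<cong> H \<and> order (fix_group p) = ord))"

end

theory Submission
  imports Defs
begin


text \<open>
  A point \<open>p\<close> of \<open>real^4\<close> is fixed, up to scalars, by the pairs \<open>(g, h)\<close> with \<open>g = p h p\<^sup>-\<^sup>1\<close> up to sign, so its fix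
  group is the intersection of the octahedral group, rotated by \<open>p\<close>, with the icosahedral group. This is the
  tetrahedral group for \<open>p = 1\<close>, a Klein four group for the rotation by \<open>45\<close> degrees about a common
  two-fold axis, and \<open>D\<^sub>3\<close> for the two rotations about a common three-fold axis that also align
  two-fold axes. The orbit lengths follow from the order \<open>1440\<close> of \<open>IO\<close> modulo \<open>\<plusminus>1\<close>.

  Summing the product of the six linear forms belonging to the five-fold axes of the icosahedron over the frame
  \<open>x i x\<^sup>*, x j x\<^sup>*, x k x\<^sup>*\<close> gives the invariant \<open>S\<close> up to a constant. It is unique, since averaging over sign changes
  and even permutations leaves fifteen coefficients, and these vanish for an invariant that is zero on
  the images of the plane \<open>x\<^sub>1 = x\<^sub>3 = 0\<close>.

  Each fix group above has no fixed tangent direction, so the gradient vanishes as soon as the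
  value does, and it decomposes the tangent space so far that the Hessian is known from two or three second
  derivatives along rotations.
\<close>

text \<open>Two obstacles shape the proof. \<open>S_IO\<close> is given only by a definite
  description, so nothing can be evaluated before an explicit invariant is exhibited and shown to be
  the only candidate. And a form of degree twelve in four variables is too large to expand, so the
  evaluations at the nodes pass through the sextic \<open>ico_form\<close> in three variables. This
  works because every direction at p other than p itself comes from an imaginary quaternion z as z
  p: the line p + t z p = (1 + t z) p rotates the frame of p up to scale, so that a second
  derivative becomes a t^2 coefficient of \<open>ico_form\<close> along a rotation. The fix group
  acts on these directions by conjugating z, which is how its representation enters. The parameter
  lambda belonging to a point p is -S(p) / q(p)^6; c1 and c2 are exchanged by changing the sign of
  sqrt 2, hence the common parameter \<open>r\<close>. Group elements are handled as pairs of unit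
  quaternions, so that most identities hold only up to sign.\<close>

section \<open>Coordinates of vectors of length four\<close>

lemma forall_index4: "(\<forall>i::4. P i) \<longleftrightarrow> P 0 \<and> P 1 \<and> P 2 \<and> P 3"
proof -
  have "(4::4) = 0" by simp
  then show ?thesis by (metis exhaust_4)
qed

lemma UNIV_index4: "UNIV = {0, 1, 2, 3::4}"
  using forall_index4[of "\<lambda>i. i \<in> {0, 1, 2, 3}"] by auto

lemma sum_index4: "sum f (UNIV::4 set) = f 0 + f 1 + f 2 + f 3"
  unfolding UNIV_index4 by (simp add: add.assoc)

lemma prod_index4: "prod f (UNIV::4 set) = f 0 * f 1 * f 2 * f 3"
  unfolding UNIV_index4 by (simp add: mult.assoc)

lemma vec4_nth [simp]:
  "vec4 a b c d $ 0 = a" "vec4 a b c d $ 1 = b" "vec4 a b c d $ 2 = c" "vec4 a b c d $ 3 = d"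
  by (simp_all add: vec4_def)

lemma vec4_collapse [simp]: "vec4 (x $ 0) (x $ 1) (x $ 2) (x $ 3) = x"
  by (simp add: vec_eq_iff forall_index4)

lemma vec_eq_iff4: "x = y \<longleftrightarrow> x $ 0 = y $ 0 \<and> x $ 1 = y $ 1 \<and> x $ 2 = y $ 2 \<and> x $ 3 = y $ 3"
  for x y :: "'a ^ 4"
  by (simp add: vec_eq_iff forall_index4)

lemma vec4_inject [simp]: "vec4 a b c d = vec4 a' b' c' d' \<longleftrightarrow> a = a' \<and> b = b' \<and> c = c' \<and> d = d'"
  by (simp add: vec_eq_iff4)

lemma vec4_exhaust: obtains a b c d where "x = vec4 a b c d"
  using vec4_collapse[of x] by metis

lemma vec4_arith [simp]:
  "vec4 a b c d + vec4 a' b' c' d' = vec4 (a + a') (b + b') (c + c') (d + d' :: 'a :: comm_ring_1)"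
  "- vec4 a b c d = vec4 (- a) (- b) (- c) (- d)"
  "r *s vec4 a b c d = vec4 (r * a) (r * b) (r * c) (r * d)"
  by (simp_all add: vec_eq_iff4)

section \<open>Quaternions over a commutative ring\<close>

text \<open>Defined over any commutative ring so that one algebra serves both the real unit
  quaternions and the complexified quaternions on which the group acts.\<close>

definition hmul :: "'a::comm_ring_1 ^ 4 \<Rightarrow> 'a ^ 4 \<Rightarrow> 'a ^ 4" (infixl "\<star>" 70) where
  "x \<star> y = vec4
     (x$0 * y$0 - x$1 * y$1 - x$2 * y$2 - x$3 * y$3)
     (x$0 * y$1 + x$1 * y$0 + x$2 * y$3 - x$3 * y$2)
     (x$0 * y$2 - x$1 * y$3 + x$2 * y$0 + x$3 * y$1)
     (x$0 * y$3 + x$1 * y$2 - x$2 * y$1 + x$3 * y$0)"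

text \<open>Over the complex numbers the coefficients are not conjugated. The map stays complex
  linear, and \<open>hnorm\<close> becomes the quadratic form \<open>q\<close>, which has nonzero
  null vectors.\<close>

definition hcnj :: "'a::comm_ring_1 ^ 4 \<Rightarrow> 'a ^ 4" where
  "hcnj x = vec4 (x$0) (- x$1) (- x$2) (- x$3)"

definition hnorm :: "'a::comm_ring_1 ^ 4 \<Rightarrow> 'a" where
  "hnorm x = (x$0)^2 + (x$1)^2 + (x$2)^2 + (x$3)^2"

abbreviation hone :: "'a::comm_ring_1 ^ 4" where "hone \<equiv> vec4 1 0 0 0"

lemma hmul_vec4 [simp]: "vec4 a b c d \<star> vec4 a' b' c' d' = vec4
     (a * a' - b * b' - c * c' - d * d')
     (a * b' + b * a' + c * d' - d * c')
     (a * c' - b * d' + c * a' + d * b')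
     (a * d' + b * c' - c * b' + d * a')"
  by (simp add: hmul_def)

lemma hcnj_vec4 [simp]: "hcnj (vec4 a b c d) = vec4 a (- b) (- c) (- d)"
  by (simp add: hcnj_def)

lemma hnorm_vec4 [simp]: "hnorm (vec4 a b c d) = a^2 + b^2 + c^2 + d^2"
  by (simp add: hnorm_def)

lemma hmul_assoc: "x \<star> y \<star> z = x \<star> (y \<star> z)"
  by (simp add: hmul_def algebra_simps)

lemma hmul_one [simp]: "hone \<star> x = x" "x \<star> hone = x"
  by (simp_all add: hmul_def)

lemma hmul_linear:
  "(x + y) \<star> z = x \<star> z + y \<star> z" "x \<star> (y + z) = x \<star> y + x \<star> z"
  "(r *s x) \<star> z = r *s (x \<star> z)" "x \<star> (r *s z) = r *s (x \<star> z)"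
  "(- x) \<star> z = - (x \<star> z)" "x \<star> (- z) = - (x \<star> z)"
  by (simp_all add: vec_eq_iff4 hmul_def algebra_simps)

lemma hcnj_hmul: "hcnj (x \<star> y) = hcnj y \<star> hcnj x"
  by (simp add: hmul_def hcnj_def algebra_simps)

lemma hcnj_hcnj [simp]: "hcnj (hcnj x) = x"
  by (simp add: hcnj_def)

lemma hcnj_linear: "hcnj (x + y) = hcnj x + hcnj y" "hcnj (r *s x) = r *s hcnj x" "hcnj (- x) = - hcnj x"
  by (simp_all add: vec_eq_iff4 hcnj_def)

lemma hmul_hcnj: "x \<star> hcnj x = hnorm x *s hone" "hcnj x \<star> x = hnorm x *s hone"
  by (simp_all add: vec_eq_iff4 hmul_def hcnj_def hnorm_def algebra_simps power2_eq_square)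

lemma hnorm_hmul: "hnorm (x \<star> y) = hnorm x * hnorm y"
  by (simp add: hmul_def hnorm_def algebra_simps power2_eq_square)

lemma hnorm_hcnj [simp]: "hnorm (hcnj x) = hnorm x"
  by (simp add: hcnj_def hnorm_def)

lemma hnorm_uminus [simp]: "hnorm (- x) = hnorm x"
  by (simp add: hnorm_def)

lemma hmul_hcnj_cancel:
  assumes "hnorm g = 1"
  shows "g \<star> (hcnj g \<star> x) = x" "hcnj g \<star> (g \<star> x) = x" "x \<star> g \<star> hcnj g = x" "x \<star> hcnj g \<star> g = x"
  by (simp_all add: assms hmul_assoc hmul_hcnj flip: hmul_assoc[of g] hmul_assoc[of "hcnj g"])

lemma q_eq_hnorm: "q = hnorm"
  by (simp add: fun_eq_iff q_def hnorm_def)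

lemma qmult_eq_hmul: "qmult = hmul"
  by (simp add: fun_eq_iff qmult_def hmul_def)

lemma hnorm_real: "hnorm x = (norm x)\<^sup>2"
  unfolding power2_norm_eq_inner inner_vec_def
  by (simp add: hnorm_def sum_index4 power2_eq_square)

lemma norm_eq_1_iff: "norm x = 1 \<longleftrightarrow> hnorm x = 1" for x :: "real ^ 4"
  by (simp add: hnorm_real power2_eq_1_iff) (metis norm_ge_zero not_one_le_zero neg_0_le_iff_le)

section \<open>The unit quaternions and their action\<close>

lemma carrier_SU2: "carrier SU2 = {g. hnorm g = 1}"
  by (simp add: SU2_def norm_eq_1_iff)

lemma mult_SU2 [simp]: "monoid.mult SU2 = hmul"
  by (simp add: SU2_def qmult_eq_hmul)

lemma one_SU2 [simp]: "\<one>\<^bsub>SU2\<^esub> = hone"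
  by (simp add: SU2_def)

lemma group_SU2: "group SU2"
proof (rule groupI)
  fix x assume "x \<in> carrier SU2"
  then show "\<exists>y\<in>carrier SU2. y \<otimes>\<^bsub>SU2\<^esub> x = \<one>\<^bsub>SU2\<^esub>"
    by (intro bexI[of _ "hcnj x"]) (auto simp: carrier_SU2 hmul_hcnj)
qed (auto simp: carrier_SU2 hnorm_hmul hmul_assoc)

lemma inv_SU2: "hnorm g = 1 \<Longrightarrow> inv\<^bsub>SU2\<^esub> g = hcnj g"
  by (rule group.inv_equality[OF group_SU2]) (auto simp: carrier_SU2 hmul_hcnj)

definition cvec :: "real ^ 4 \<Rightarrow> complex ^ 4" where
  "cvec x = (\<chi> i. complex_of_real (x $ i))"

lemma cvec_nth [simp]: "cvec x $ i = complex_of_real (x $ i)"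
  by (simp add: cvec_def)

lemma cvec_vec4: "cvec (vec4 a b c d) = vec4 (of_real a) (of_real b) (of_real c) (of_real d)"
  by (simp add: vec_eq_iff4)

lemma cvec_hom:
  "cvec (x \<star> y) = cvec x \<star> cvec y" "cvec (hcnj x) = hcnj (cvec x)" "cvec (- x) = - cvec x"
  "cvec hone = hone" "hnorm (cvec x) = of_real (hnorm x)"
  by (simp_all add: vec_eq_iff4 hmul_def hcnj_def hnorm_def)

lemma cvec_inject [simp]: "cvec x = cvec y \<longleftrightarrow> x = y"
  by (simp add: vec_eq_iff4)

lemma double_cover_nth:
  assumes "hnorm h = 1"
  shows "double_cover g h $ i $ j = (g \<star> axis j 1 \<star> hcnj h) $ i"
  by (simp add: double_cover_def qmult_eq_hmul inv_SU2 assms matrix_def)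

lemma axis_vec4: "axis 0 r = vec4 r 0 0 0" "axis 1 r = vec4 0 r 0 0" "axis 2 r = vec4 0 0 r 0"
  "axis 3 r = vec4 0 0 0 r"
  by (simp_all add: vec_eq_iff4 axis_def)

lemma double_cover_mult_vec:
  assumes "hnorm h = 1"
  shows "double_cover g h *v x = g \<star> x \<star> hcnj h"
  by (simp add: vec_eq_iff4 matrix_vector_mult_def sum_index4 double_cover_nth assms axis_vec4)
    (simp add: hmul_def hcnj_def algebra_simps)

lemma complex_act_double_cover:
  assumes "hnorm h = 1"
  shows "complex_act (double_cover g h) x = cvec g \<star> x \<star> hcnj (cvec h)"
  by (simp add: complex_act_def vec_eq_iff4 matrix_vector_mult_def sum_index4 map_matrix_def double_cover_nth assms axis_vec4)
    (simp add: hmul_def hcnj_def algebra_simps)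

lemma double_cover_mult:
  assumes "hnorm h = 1" "hnorm h' = 1"
  shows "double_cover g h ** double_cover g' h' = double_cover (g \<star> g') (h \<star> h')"
proof (rule matrix_eq[THEN iffD2], intro allI)
  fix x
  have "(double_cover g h ** double_cover g' h') *v x = double_cover g h *v (double_cover g' h' *v x)"
    by (simp add: matrix_vector_mul_assoc)
  then show "(double_cover g h ** double_cover g' h') *v x = double_cover (g \<star> g') (h \<star> h') *v x"
    by (simp add: double_cover_mult_vec assms hnorm_hmul hmul_assoc hcnj_hmul)
qed

lemma double_cover_one: "double_cover hone hone = mat 1"
  by (rule matrix_eq[THEN iffD2]) (simp add: double_cover_mult_vec)

lemma uminus_matrix_vector_mult: "(- A) *v x = - (A *v x)" for A :: "'a::comm_ring_1 ^ 'n ^ 'm"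
  by (simp add: matrix_vector_mult_def vec_eq_iff sum_negf)

lemma double_cover_uminus:
  assumes "hnorm h = 1"
  shows "double_cover (- g) h = - double_cover g h" "double_cover g (- h) = - double_cover g h"
  by (rule matrix_eq[THEN iffD2], simp add: double_cover_mult_vec uminus_matrix_vector_mult assms hmul_linear hcnj_linear)+

text \<open>Applying the map to 1 gives g = h; then g commutes with i and j and is therefore
  real.\<close>

lemma double_cover_eq_one:
  assumes "hnorm g = 1" "hnorm h = 1" "double_cover g h = mat 1"
  shows "g = h \<and> (g = hone \<or> g = - hone)"
proof -
  have *: "g \<star> x \<star> hcnj h = x" for x
    using double_cover_mult_vec[OF assms(2), of g x] assms(3) by simp
  have comm: "g \<star> x = x \<star> h" for x
    using *[of x] hmul_hcnj_cancel(4)[OF assms(2), of "g \<star> x"] by simp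
  have gh: "g = h" using comm[of hone] by simp
  obtain a b c d where g: "g = vec4 a b c d" by (rule vec4_exhaust)
  have "c = 0" "d = 0" "b = 0"
    using comm[of "vec4 0 1 0 0"] comm[of "vec4 0 0 1 0"] unfolding gh[symmetric] g by simp_all
  moreover from this have "a = 1 \<or> a = - 1" using assms(1) g by (simp add: power2_eq_1_iff)
  ultimately show ?thesis using gh g by auto
qed

section \<open>The binary polyhedral groups\<close>

text \<open>Left multiplication by a generator injects the finite set X into itself, hence permutes
  it, so inverses of generators preserve X too. Applying any generated element to the identity then
  lands in X.\<close>

lemma (in group) generate_subset_finite:
  assumes "finite X" "X \<subseteq> carrier G" "\<one> \<in> X" "H \<subseteq> carrier G"
    and closed: "\<And>h x. h \<in> H \<Longrightarrow> x \<in> X \<Longrightarrow> h \<otimes> x \<in> X"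
  shows "generate G H \<subseteq> X"
proof -
  have inv_closed: "inv h \<otimes> x \<in> X" if "h \<in> H" and x: "x \<in> X" for h x
  proof -
    have "h \<in> carrier G" using that assms by auto
    then have "inj_on (\<lambda>x. h \<otimes> x) X"
      using assms(2) by (intro inj_onI) (auto simp: subset_iff)
    then have "(\<lambda>x. h \<otimes> x) ` X = X"
      using closed that by (intro endo_inj_surj assms(1)) auto
    then obtain y where "y \<in> X" "x = h \<otimes> y" using x by blast
    then show ?thesis using \<open>h \<in> carrier G\<close> assms(2) by (auto simp flip: m_assoc)
  qed
  have "g \<in> carrier G \<and> (\<forall>x\<in>X. g \<otimes> x \<in> X)" if "g \<in> generate G H" for g
    using that
  proof induction
    case one
    then show ?case using assms(2) by (auto simp: subset_iff)
  next
    case (incl h)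
    then show ?case using assms(4) closed by auto
  next
    case (inv h)
    then show ?case using assms(4) inv_closed by auto
  next
    case (eng h1 h2)
    then show ?case using assms(2) by (auto simp: m_assoc subset_iff)
  qed
  then show ?thesis using assms(3) r_one by (metis subsetI)
qed

section \<open>The binary tetrahedral group\<close>

text \<open>These 24 quaternions form the binary tetrahedral group, a common subgroup of both
  polyhedral groups. Each of the two is described below by a few of its cosets.\<close>

definition hurwitz_units :: "(real ^ 4) set" where
  "hurwitz_units = {vec4 a b c d | a b c d.
    a \<in> {1/2, -1/2} \<and> b \<in> {1/2, -1/2} \<and> c \<in> {1/2, -1/2} \<and> d \<in> {1/2, -1/2} \<or>
    a \<in> {1, -1} \<and> b = 0 \<and> c = 0 \<and> d = 0 \<or> a = 0 \<and> b \<in> {1, -1} \<and> c = 0 \<and> d = 0 \<or>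
    a = 0 \<and> b = 0 \<and> c \<in> {1, -1} \<and> d = 0 \<or> a = 0 \<and> b = 0 \<and> c = 0 \<and> d \<in> {1, -1}}"

lemma vec4_in_hurwitz_units:
  "vec4 a b c d \<in> hurwitz_units \<longleftrightarrow>
    a \<in> {1/2, -1/2} \<and> b \<in> {1/2, -1/2} \<and> c \<in> {1/2, -1/2} \<and> d \<in> {1/2, -1/2} \<or>
    a \<in> {1, -1} \<and> b = 0 \<and> c = 0 \<and> d = 0 \<or> a = 0 \<and> b \<in> {1, -1} \<and> c = 0 \<and> d = 0 \<or>
    a = 0 \<and> b = 0 \<and> c \<in> {1, -1} \<and> d = 0 \<or> a = 0 \<and> b = 0 \<and> c = 0 \<and> d \<in> {1, -1}"
  unfolding hurwitz_units_def mem_Collect_eq vec4_inject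
  by (intro iffI; (elim exE conjE)?; (intro exI conjI)?; (rule refl)?; hypsubst?; assumption)

lemma hurwitz_units_eq: "hurwitz_units = (\<lambda>(a, b, c, d). vec4 a b c d) `
    ({1/2, -1/2} \<times> {1/2, -1/2} \<times> {1/2, -1/2} \<times> {1/2, -1/2}
      \<union> ({1, -1} \<times> {0} \<times> {0} \<times> {0} \<union> ({0} \<times> {1, -1} \<times> {0} \<times> {0}
      \<union> ({0} \<times> {0} \<times> {1, -1} \<times> {0} \<union> {0} \<times> {0} \<times> {0} \<times> {1, -1}))))" (is "_ = ?f ` ?A")
proof (rule Set.set_eqI)
  fix x :: "real ^ 4"
  obtain a b c d where x: "x = vec4 a b c d" by (rule vec4_exhaust)
  have "inj ?f" by (rule injI) (simp add: split_beta prod_eq_iff)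
  then have "?f (a, b, c, d) \<in> ?f ` ?A \<longleftrightarrow> (a, b, c, d) \<in> ?A"
    by (rule inj_image_mem_iff)
  also have "\<dots> \<longleftrightarrow> x \<in> hurwitz_units"
    unfolding x vec4_in_hurwitz_units by (simp only: Un_iff mem_Sigma_iff insert_iff empty_iff simp_thms)
  finally show "x \<in> hurwitz_units \<longleftrightarrow> x \<in> ?f ` ?A" by (simp add: x)
qed

lemma finite_hurwitz_units: "finite hurwitz_units"
  by (simp add: hurwitz_units_eq)

lemma card_hurwitz_units: "card hurwitz_units = 24"
proof -
  have inj: "inj (\<lambda>(a, b, c, d). vec4 a b c d)" by (rule injI) (simp add: split_beta prod_eq_iff)
  show ?thesis
    unfolding hurwitz_units_eq card_image[OF inj_on_subset[OF inj subset_UNIV]]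
    by (subst card_Un_disjoint, simp, simp, fastforce)+ (simp add: card_cartesian_product)
qed

lemma hnorm_hurwitz_units: "x \<in> hurwitz_units \<Longrightarrow> hnorm x = 1"
proof (cases x rule: vec4_exhaust)
  case (1 a b c d)
  assume "x \<in> hurwitz_units"
  then show ?thesis
    unfolding 1 vec4_in_hurwitz_units insert_iff empty_iff
    by (elim disjE conjE FalseE; hypsubst; simp add: power2_eq_square)
qed

lemma subgroup_SU2_closed:
  assumes "subgroup H SU2" "x \<in> H" "y \<in> H"
  shows "x \<star> y \<in> H" "hcnj x \<in> H"
  using subgroup.m_closed[OF assms] subgroup.m_inv_closed[OF assms(1,2)] subgroup.mem_carrier[OF assms(1,2)]
  by (simp_all add: inv_SU2 carrier_SU2)

lemma hurwitz_units_subset: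
  assumes H: "subgroup H SU2" and "quat_i \<in> H" "quat_S \<in> H"
  shows "hurwitz_units \<subseteq> H"
proof -
  note m = subgroup_SU2_closed[OF H]
  have i: "vec4 0 1 0 0 \<in> H" and S: "vec4 (1/2) (1/2) (-1/2) (1/2) \<in> H"
    using assms by (simp_all add: quat_i_def quat_S_def)
  have n: "vec4 (-1) 0 0 0 \<in> H" using m(1)[OF i i] by simp
  \<comment> \<open>This is S i S^-1: conjugation by S permutes i, j, k up to sign.\<close>
  have k: "vec4 0 0 0 1 \<in> H" using m(1)[OF m(1)[OF S i] m(2)[OF S S]] by simp
  have j: "vec4 0 0 1 0 \<in> H" using m(1)[OF k i] by simp
  have neg: "- x \<in> H" if "x \<in> H" for x using m(1)[OF n that] by (cases x rule: vec4_exhaust) simp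
  have Q: "{vec4 1 0 0 0, vec4 0 1 0 0, vec4 0 0 1 0, vec4 0 0 0 1} \<subseteq> H"
    using i j k neg[OF n] by simp
  have S2: "vec4 (-1/2) (1/2) (-1/2) (1/2) \<in> H" using m(1)[OF S S] by simp
  \<comment> \<open>One member of each pair x, -x of half-integral units: the products of S and S^2
    with 1, i, j, k, up to sign.\<close>
  have pos: "{vec4 (1/2) (1/2) (-1/2) (1/2), vec4 (-1/2) (1/2) (-1/2) (-1/2), vec4 (1/2) (1/2) (1/2) (-1/2),
      vec4 (-1/2) (1/2) (1/2) (1/2), vec4 (-1/2) (1/2) (-1/2) (1/2), vec4 (-1/2) (-1/2) (-1/2) (-1/2),
      vec4 (1/2) (1/2) (-1/2) (-1/2), vec4 (-1/2) (1/2) (1/2) (-1/2)} \<subseteq> H"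
    using S S2 m(1)[OF i S] m(1)[OF j S] m(1)[OF k S] m(1)[OF i S2] m(1)[OF j S2] m(1)[OF k S2]
      neg[OF m(1)[OF i S]] neg[OF m(1)[OF j S]] neg[OF m(1)[OF k S]] neg[OF m(1)[OF i S2]] neg[OF m(1)[OF j S2]] neg[OF m(1)[OF k S2]]
    by simp
  have "uminus ` {vec4 1 0 0 0, vec4 0 1 0 0, vec4 0 0 1 0, vec4 0 0 0 1} \<subseteq> H"
    using Q neg by blast
  moreover have "uminus ` {vec4 (1/2) (1/2) (-1/2) (1/2), vec4 (-1/2) (1/2) (-1/2) (-1/2), vec4 (1/2) (1/2) (1/2) (-1/2),
      vec4 (-1/2) (1/2) (1/2) (1/2), vec4 (-1/2) (1/2) (-1/2) (1/2), vec4 (-1/2) (-1/2) (-1/2) (-1/2),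
      vec4 (1/2) (1/2) (-1/2) (-1/2), vec4 (-1/2) (1/2) (1/2) (-1/2)} \<subseteq> H"
    using pos neg by blast
  ultimately have all: "vec4 a b c d \<in> H" if "vec4 a b c d \<in> hurwitz_units" for a b c d
    using that Q pos unfolding vec4_in_hurwitz_units insert_iff empty_iff
    by (elim disjE conjE FalseE; hypsubst; simp)
  show ?thesis
  proof
    fix x assume "x \<in> hurwitz_units"
    then show "x \<in> H" using all by (cases x rule: vec4_exhaust) simp
  qed
qed

lemma carrier_generators: "{quat_i, quat_R4, quat_S, quat_U} \<subseteq> carrier SU2"
  by (simp add: carrier_SU2 quat_i_def quat_R4_def quat_S_def quat_U_def tau_def power2_eq_square field_simps)

lemma generate_i_S: "generate SU2 {quat_i, quat_S} = hurwitz_units"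
proof
  show "generate SU2 {quat_i, quat_S} \<subseteq> hurwitz_units"
  proof (rule group.generate_subset_finite[OF group_SU2 finite_hurwitz_units])
    fix h x assume h: "h \<in> {quat_i, quat_S}" and x: "x \<in> hurwitz_units"
    obtain a b c d where abcd: "x = vec4 a b c d" by (rule vec4_exhaust)
    have "quat_i \<star> x \<in> hurwitz_units"
      using x unfolding abcd quat_i_def vec4_in_hurwitz_units hmul_vec4 insert_iff empty_iff
      by (elim disjE conjE FalseE; hypsubst; simp)
    moreover have "quat_S \<star> x \<in> hurwitz_units"
      using x unfolding abcd quat_S_def vec4_in_hurwitz_units hmul_vec4 insert_iff empty_iff
      by (elim disjE conjE FalseE; hypsubst; simp)
    ultimately show "h \<otimes>\<^bsub>SU2\<^esub> x \<in> hurwitz_units" using h by auto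
  next
    show "hurwitz_units \<subseteq> carrier SU2" by (auto simp: carrier_SU2 hnorm_hurwitz_units)
    show "\<one>\<^bsub>SU2\<^esub> \<in> hurwitz_units" by (simp add: vec4_in_hurwitz_units)
    show "{quat_i, quat_S} \<subseteq> carrier SU2" using carrier_generators by simp
  qed
  show "hurwitz_units \<subseteq> generate SU2 {quat_i, quat_S}"
    using carrier_generators
    by (intro hurwitz_units_subset group.generate_is_subgroup[OF group_SU2])
      (auto intro: generate.incl)
qed

lemma subgroup_hurwitz_units: "subgroup hurwitz_units SU2"
  using group.generate_is_subgroup[OF group_SU2, of "{quat_i, quat_S}"] carrier_generators
  by (auto simp: generate_i_S)

lemma hurwitz_units_closed:
  "x \<in> hurwitz_units \<Longrightarrow> y \<in> hurwitz_units \<Longrightarrow> x \<star> y \<in> hurwitz_units"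
  "x \<in> hurwitz_units \<Longrightarrow> hcnj x \<in> hurwitz_units"
  using subgroup_SU2_closed[OF subgroup_hurwitz_units] by auto

lemma hone_in_hurwitz_units: "hone \<in> hurwitz_units"
  by (simp add: vec4_in_hurwitz_units)

section \<open>The two binary groups as unions of cosets of the Hurwitz units\<close>

lemma tau_mult: "tau * tau = tau + 1"
  by (simp add: tau_def field_simps)

lemma tau_mult_left: "tau * (tau * x) = tau * x + x"
  using tau_mult by (metis (no_types) distrib_right mult.assoc mult_1)

lemma tau_bounds: "1.618 < tau" "tau < 1.6181"
proof -
  have "2.236 < sqrt 5" by (rule real_less_rsqrt) (simp add: power2_eq_square)
  moreover have "sqrt 5 < 2.2361" by (rule real_less_lsqrt) (simp_all add: power2_eq_square)
  ultimately show "1.618 < tau" "tau < 1.6181" by (simp_all add: tau_def)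
qed

text \<open>The powers of \<open>quat_U\<close> with exponents 0 to 4, reduced by tau^2 = tau + 1;
  the fifth power is -1. A five-fold rotation runs through the five cosets of the tetrahedral
  subgroup.\<close>

definition icosahedral_reps :: "(real ^ 4) set" where
  "icosahedral_reps = {hone, quat_U, vec4 ((tau - 1)/2) 0 (1/2) (tau/2),
     vec4 ((1 - tau)/2) 0 (1/2) (tau/2), vec4 (- tau/2) 0 ((tau - 1)/2) (1/2)}"

lemma hnorm_icosahedral_reps: "u \<in> icosahedral_reps \<Longrightarrow> hnorm u = 1"
  by (auto simp: icosahedral_reps_def quat_U_def power2_eq_square field_simps tau_mult)

text \<open>A coset table: since each generator sends a coset of the Hurwitz units to another of the
  five, the union of the five is closed under the generators and contains the generated
  group.\<close>

lemma icosahedral_reps_mult: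
  assumes "h \<in> {quat_i, quat_S, quat_U}" "u \<in> icosahedral_reps"
  shows "\<exists>u'\<in>icosahedral_reps. \<exists>t\<in>hurwitz_units. h \<star> u = u' \<star> t"
proof -
  let ?u2 = "vec4 ((tau - 1)/2) 0 (1/2) (tau/2)" and ?u3 = "vec4 ((1 - tau)/2) 0 (1/2) (tau/2)"
    and ?u4 = "vec4 (- tau/2) 0 ((tau - 1)/2) (1/2)"
  have eqs: "quat_i \<star> hone = hone \<star> vec4 0 1 0 0" "quat_i \<star> quat_U = ?u4 \<star> vec4 0 (-1) 0 0"
    "quat_i \<star> ?u2 = ?u3 \<star> vec4 0 (-1) 0 0" "quat_i \<star> ?u3 = ?u2 \<star> vec4 0 (-1) 0 0"
    "quat_i \<star> ?u4 = quat_U \<star> vec4 0 (-1) 0 0"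
    "quat_S \<star> hone = hone \<star> vec4 (1/2) (1/2) (-1/2) (1/2)" "quat_S \<star> quat_U = quat_U \<star> vec4 (1/2) (-1/2) (-1/2) (1/2)"
    "quat_S \<star> ?u2 = ?u3 \<star> vec4 (1/2) (-1/2) (1/2) (-1/2)" "quat_S \<star> ?u3 = ?u4 \<star> vec4 (1/2) (1/2) (1/2) (-1/2)"
    "quat_S \<star> ?u4 = ?u2 \<star> vec4 0 0 1 0"
    "quat_U \<star> hone = quat_U \<star> hone" "quat_U \<star> quat_U = ?u2 \<star> hone"
    "quat_U \<star> ?u2 = ?u3 \<star> hone" "quat_U \<star> ?u3 = ?u4 \<star> hone"
    "quat_U \<star> ?u4 = hone \<star> vec4 (-1) 0 0 0"
    by (simp_all add: quat_i_def quat_S_def quat_U_def field_simps tau_mult)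
  have mem: "{hone, vec4 (-1) 0 0 0, vec4 0 1 0 0, vec4 0 (-1) 0 0, vec4 0 0 1 0,
      vec4 (1/2) (1/2) (-1/2) (1/2), vec4 (1/2) (-1/2) (-1/2) (1/2), vec4 (1/2) (-1/2) (1/2) (-1/2),
      vec4 (1/2) (1/2) (1/2) (-1/2)} \<subseteq> hurwitz_units"
    by (simp add: vec4_in_hurwitz_units)
  have *: "\<exists>u'\<in>icosahedral_reps. \<exists>t\<in>hurwitz_units. h \<star> u = u' \<star> t"
    if "h \<star> u = u' \<star> t" "u' \<in> icosahedral_reps" "t \<in> hurwitz_units" for h u u' t
    using that by blast
  have "h = quat_i \<or> h = quat_S \<or> h = quat_U"
    "u = hone \<or> u = quat_U \<or> u = ?u2 \<or> u = ?u3 \<or> u = ?u4"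
    using assms by (auto simp: icosahedral_reps_def)
  then show ?thesis
    by - (elim disjE; hypsubst; rule eqs[THEN *]; use mem in \<open>simp add: icosahedral_reps_def\<close>)
qed

lemma subgroup_binary_icosahedral: "subgroup binary_icosahedral SU2"
  unfolding binary_icosahedral_def
  using carrier_generators by (intro group.generate_is_subgroup[OF group_SU2]) auto

lemma subgroup_binary_octahedral: "subgroup binary_octahedral SU2"
  unfolding binary_octahedral_def
  using carrier_generators by (intro group.generate_is_subgroup[OF group_SU2]) auto

lemma generators_in:
  "quat_i \<in> binary_icosahedral" "quat_S \<in> binary_icosahedral" "quat_U \<in> binary_icosahedral"
  "quat_i \<in> binary_octahedral" "quat_S \<in> binary_octahedral" "quat_R4 \<in> binary_octahedral"
  by (auto simp: binary_icosahedral_def binary_octahedral_def intro: generate.incl)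

lemma binary_icosahedral_eq: "binary_icosahedral = (\<Union>u\<in>icosahedral_reps. (\<star>) u ` hurwitz_units)"
proof
  show "binary_icosahedral \<subseteq> (\<Union>u\<in>icosahedral_reps. (\<star>) u ` hurwitz_units)"
    unfolding binary_icosahedral_def
  proof (rule group.generate_subset_finite[OF group_SU2])
    show "finite (\<Union>u\<in>icosahedral_reps. (\<star>) u ` hurwitz_units)"
      by (simp add: icosahedral_reps_def finite_hurwitz_units)
    show "\<one>\<^bsub>SU2\<^esub> \<in> (\<Union>u\<in>icosahedral_reps. (\<star>) u ` hurwitz_units)"
      using hone_in_hurwitz_units by (auto simp: icosahedral_reps_def image_iff)
  next
    fix h x assume h: "h \<in> {quat_i, quat_S, quat_U}" and "x \<in> (\<Union>u\<in>icosahedral_reps. (\<star>) u ` hurwitz_units)"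
    then obtain u y where x: "u \<in> icosahedral_reps" "y \<in> hurwitz_units" "x = u \<star> y" by auto
    obtain u' t where u': "u' \<in> icosahedral_reps" "t \<in> hurwitz_units" "h \<star> u = u' \<star> t"
      using icosahedral_reps_mult[OF h x(1)] by blast
    have "h \<star> x = u' \<star> (t \<star> y)" using u'(3) x(3) by (metis hmul_assoc)
    then show "h \<otimes>\<^bsub>SU2\<^esub> x \<in> (\<Union>u\<in>icosahedral_reps. (\<star>) u ` hurwitz_units)"
      using u' hurwitz_units_closed(1)[OF u'(2) x(2)] by auto
  qed (use carrier_generators in \<open>auto simp: carrier_SU2 hnorm_hmul hnorm_icosahedral_reps hnorm_hurwitz_units\<close>)
  have m: "x \<star> y \<in> binary_icosahedral" if "x \<in> binary_icosahedral" "y \<in> binary_icosahedral" for x y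
    using subgroup_SU2_closed(1)[OF subgroup_binary_icosahedral that] .
  have "hurwitz_units \<subseteq> binary_icosahedral"
    by (intro hurwitz_units_subset subgroup_binary_icosahedral generators_in)
  moreover have "icosahedral_reps \<subseteq> binary_icosahedral"
  proof -
    let ?u2 = "vec4 ((tau - 1)/2) 0 (1/2) (tau/2)" and ?u3 = "vec4 ((1 - tau)/2) 0 (1/2) (tau/2)"
      and ?u4 = "vec4 (- tau/2) 0 ((tau - 1)/2) (1/2)"
    have eqs: "quat_U \<star> quat_U = ?u2" "quat_U \<star> ?u2 = ?u3" "quat_U \<star> ?u3 = ?u4"
      by (simp_all add: quat_U_def field_simps tau_mult)
    note U = generators_in(3)
    have U2: "?u2 \<in> binary_icosahedral" using m[OF U U] unfolding eqs .
    have U3: "?u3 \<in> binary_icosahedral" using m[OF U U2] unfolding eqs .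
    have "?u4 \<in> binary_icosahedral" using m[OF U U3] unfolding eqs .
    then show ?thesis
      using U U2 U3 subgroup.one_closed[OF subgroup_binary_icosahedral]
      by (simp add: icosahedral_reps_def)
  qed
  ultimately show "(\<Union>u\<in>icosahedral_reps. (\<star>) u ` hurwitz_units) \<subseteq> binary_icosahedral"
    using m by blast
qed

text \<open>Two cosets suffice because i and S can be moved past \<open>quat_R4\<close> at the cost
  of another Hurwitz unit, while \<open>quat_R4\<close> squared is i.\<close>

lemma binary_octahedral_eq: "binary_octahedral = hurwitz_units \<union> (\<star>) quat_R4 ` hurwitz_units"
proof
  let ?X = "hurwitz_units \<union> (\<star>) quat_R4 ` hurwitz_units"
  have gen: "quat_i \<in> hurwitz_units" "quat_S \<in> hurwitz_units"
    by (simp_all add: vec4_in_hurwitz_units quat_i_def quat_S_def)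
  have eqs: "quat_i \<star> quat_R4 = quat_R4 \<star> vec4 0 1 0 0"
    "quat_S \<star> quat_R4 = quat_R4 \<star> vec4 (1/2) (1/2) (1/2) (1/2)"
    "quat_R4 \<star> quat_R4 = vec4 0 1 0 0"
    by (simp_all add: quat_i_def quat_S_def quat_R4_def field_simps)
  have mem: "vec4 0 1 0 0 \<in> hurwitz_units" "vec4 (1/2) (1/2) (1/2) (1/2) \<in> hurwitz_units"
    by (simp_all add: vec4_in_hurwitz_units)
  show "binary_octahedral \<subseteq> ?X"
    unfolding binary_octahedral_def
  proof (rule group.generate_subset_finite[OF group_SU2])
    fix h x assume h: "h \<in> {quat_i, quat_R4, quat_S}" and "x \<in> ?X"
    then consider "x \<in> hurwitz_units" | y where "y \<in> hurwitz_units" "x = quat_R4 \<star> y" by blast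
    then show "h \<otimes>\<^bsub>SU2\<^esub> x \<in> ?X"
    proof cases
      case 1
      then show ?thesis using h gen hurwitz_units_closed(1) by auto
    next
      case 2
      have "h \<star> x = (h \<star> quat_R4) \<star> y" by (simp add: 2 hmul_assoc)
      moreover have "\<dots> \<in> ?X"
        using h
      proof (elim insertE emptyE)
        assume "h = quat_i"
        then have "h \<star> quat_R4 \<star> y = quat_R4 \<star> (vec4 0 1 0 0 \<star> y)" by (simp add: eqs hmul_assoc)
        then show ?thesis using mem 2 hurwitz_units_closed(1) by auto
      next
        assume "h = quat_S"
        then have "h \<star> quat_R4 \<star> y = quat_R4 \<star> (vec4 (1/2) (1/2) (1/2) (1/2) \<star> y)" by (simp add: eqs hmul_assoc)
        then show ?thesis using mem 2 hurwitz_units_closed(1) by auto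
      next
        assume "h = quat_R4"
        then have "h \<star> quat_R4 \<star> y = vec4 0 1 0 0 \<star> y" by (simp add: eqs)
        then show ?thesis using mem 2 hurwitz_units_closed(1) by auto
      qed
      ultimately show ?thesis by simp
    qed
  next
    show "?X \<subseteq> carrier SU2"
      using carrier_generators by (auto simp: carrier_SU2 hnorm_hmul hnorm_hurwitz_units)
  qed (use carrier_generators in \<open>auto simp: finite_hurwitz_units hone_in_hurwitz_units\<close>)
  show "?X \<subseteq> binary_octahedral"
    using hurwitz_units_subset[OF subgroup_binary_octahedral generators_in(4,5)]
      subgroup_SU2_closed(1)[OF subgroup_binary_octahedral generators_in(6)] by blast
qed

lemma hnorm_binary [simp]:
  "g \<in> binary_icosahedral \<Longrightarrow> hnorm g = 1" "g \<in> binary_octahedral \<Longrightarrow> hnorm g = 1"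
  using subgroup.subset[OF subgroup_binary_icosahedral] subgroup.subset[OF subgroup_binary_octahedral]
  by (auto simp: carrier_SU2)

lemma hurwitz_units_subset_binary:
  "hurwitz_units \<subseteq> binary_icosahedral" "hurwitz_units \<subseteq> binary_octahedral"
  by (intro hurwitz_units_subset subgroup_binary_icosahedral subgroup_binary_octahedral generators_in)+

lemma card_cosets_hurwitz_units:
  assumes "finite R" "\<And>u. u \<in> R \<Longrightarrow> hnorm u = 1"
    and "\<And>u v. u \<in> R \<Longrightarrow> v \<in> R \<Longrightarrow> hcnj u \<star> v \<in> hurwitz_units \<Longrightarrow> u = v"
  shows "card (\<Union>u\<in>R. (\<star>) u ` hurwitz_units) = 24 * card R"
proof -
  have inj: "inj_on (\<lambda>(u, t). u \<star> t) (R \<times> hurwitz_units)"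
  proof (intro inj_onI, clarify)
    fix u t v s assume *: "u \<in> R" "t \<in> hurwitz_units" "v \<in> R" "s \<in> hurwitz_units" "u \<star> t = v \<star> s"
    have "hcnj u \<star> v = hcnj u \<star> (v \<star> s) \<star> hcnj s"
      using * by (simp add: hmul_assoc hmul_hcnj hnorm_hurwitz_units)
    also have "\<dots> = t \<star> hcnj s"
      using * by (simp flip: *(5)) (simp add: hmul_hcnj_cancel assms(2))
    finally have "u = v"
      using * assms(3)[of u v] hurwitz_units_closed by simp
    then show "u = v \<and> t = s"
      using *(5) hmul_hcnj_cancel(2)[OF assms(2)[OF *(3)]] by metis
  qed
  have "(\<Union>u\<in>R. (\<star>) u ` hurwitz_units) = (\<lambda>(u, t). u \<star> t) ` (R \<times> hurwitz_units)"
    by auto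
  then show ?thesis
    using card_image[OF inj] by (simp add: card_cartesian_product card_hurwitz_units)
qed

lemma hurwitz_units_nth:
  assumes "x \<in> hurwitz_units" shows "x $ n \<in> {0, 1/2, -1/2, 1, -1}"
proof -
  obtain a b c d where x: "x = vec4 a b c d" by (rule vec4_exhaust)
  have "\<forall>n. x $ n \<in> {0, 1/2, -1/2, 1, -1}"
    using assms unfolding x vec4_in_hurwitz_units forall_index4 vec4_nth by blast
  then show ?thesis by blast
qed

lemma card_binary_icosahedral: "card binary_icosahedral = 120"
proof -
  have "card icosahedral_reps = 5"
    using tau_bounds by (simp add: icosahedral_reps_def quat_U_def)
  moreover have "card (\<Union>u\<in>icosahedral_reps. (\<star>) u ` hurwitz_units) = 24 * card icosahedral_reps"
  proof (rule card_cosets_hurwitz_units)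
    fix u v assume uv: "u \<in> icosahedral_reps" "v \<in> icosahedral_reps" "hcnj u \<star> v \<in> hurwitz_units"
    \<comment> \<open>The scalar part separates the cosets. For distinct representatives the
      quotient is, up to sign, a power of U with scalar part plus or minus tau/2 or (tau - 1)/2,
      which no Hurwitz unit has.\<close>
    have "(hcnj u \<star> v) $ 0 \<in> {0, 1/2, -1/2, 1, -1}" by (rule hurwitz_units_nth[OF uv(3)])
    then show "u = v"
      using uv(1,2) tau_bounds unfolding icosahedral_reps_def quat_U_def
      by - (elim insertE emptyE; simp add: field_simps tau_mult)
  qed (simp_all add: hnorm_icosahedral_reps, simp add: icosahedral_reps_def)
  ultimately show ?thesis by (simp add: binary_icosahedral_eq)
qed

lemma card_binary_octahedral: "card binary_octahedral = 48"
proof -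
  have "card {hone, quat_R4} = 2"
    by (simp add: quat_R4_def)
  moreover have "card (\<Union>u\<in>{hone, quat_R4}. (\<star>) u ` hurwitz_units) = 24 * card {hone, quat_R4}"
  proof (rule card_cosets_hurwitz_units)
    fix u v assume uv: "u \<in> {hone, quat_R4}" "v \<in> {hone, quat_R4}" "hcnj u \<star> v \<in> hurwitz_units"
    have "(hcnj u \<star> v) $ 0 \<in> {0, 1/2, -1/2, 1, -1}" by (rule hurwitz_units_nth[OF uv(3)])
    \<comment> \<open>The scalar part in question is 1/sqrt 2; comparing squares keeps the test
      rational.\<close>
    moreover have "x\<^sup>2 \<noteq> 1/2" if "x \<in> {0, 1/2, -1/2, 1, -1}" for x :: real
      using that by (elim insertE emptyE; hypsubst; simp add: power2_eq_square)
    ultimately have "((hcnj u \<star> v) $ 0)\<^sup>2 \<noteq> 1/2" by blast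
    moreover have "((hcnj hone \<star> quat_R4) $ 0)\<^sup>2 = 1/2" "((hcnj quat_R4 \<star> hone) $ 0)\<^sup>2 = 1/2"
      by (simp_all add: quat_R4_def power2_eq_square)
    ultimately show "u = v"
      using uv(1,2) by blast
  qed (use carrier_generators in \<open>auto simp: carrier_SU2\<close>)
  ultimately show ?thesis by (simp add: binary_octahedral_eq)
qed

text \<open>This finite list of coordinates is the means of bounding the fix groups from above: an
  octahedral h is excluded at p when p h p^-1 has a coordinate outside the list.\<close>

lemma binary_icosahedral_nth:
  assumes "x \<in> binary_icosahedral"
  shows "x $ n \<in> {0, 1/2, -1/2, 1, -1, tau/2, -tau/2, (tau - 1)/2, (1 - tau)/2}"
proof -
  obtain u t where ut: "u \<in> icosahedral_reps" "t \<in> hurwitz_units" "x = u \<star> t"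
    using assms by (auto simp: binary_icosahedral_eq)
  obtain a b c d where t: "t = vec4 a b c d" by (rule vec4_exhaust)
  have "\<forall>n. (u \<star> t) $ n \<in> {0, 1/2, -1/2, 1, -1, tau/2, -tau/2, (tau - 1)/2, (1 - tau)/2}"
    using ut(1,2) unfolding t icosahedral_reps_def vec4_in_hurwitz_units quat_U_def forall_index4 insert_iff empty_iff
    by - (elim disjE conjE FalseE; hypsubst; simp add: field_simps)
  then show ?thesis using ut(3) by blast
qed

section \<open>The projective group and its action\<close>

definition pm_coset :: "real ^ 4 \<Rightarrow> real ^ 4 \<Rightarrow> (real ^ 4 ^ 4) set" where
  "pm_coset g h = {double_cover g h, - double_cover g h}"

lemma mult_IO [simp]: "monoid.mult IO = (**)"
  by (simp add: IO_def SO4_def)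

lemma one_IO [simp]: "\<one>\<^bsub>IO\<^esub> = mat 1"
  by (simp add: IO_def SO4_def)

lemma carrier_IO: "carrier IO = {double_cover g h | g h. g \<in> binary_icosahedral \<and> h \<in> binary_octahedral}"
  by (simp add: IO_def)

lemma binary_closed:
  "g \<in> binary_icosahedral \<Longrightarrow> g' \<in> binary_icosahedral \<Longrightarrow> g \<star> g' \<in> binary_icosahedral"
  "g \<in> binary_icosahedral \<Longrightarrow> hcnj g \<in> binary_icosahedral"
  "g \<in> binary_icosahedral \<Longrightarrow> - g \<in> binary_icosahedral"
  "h \<in> binary_octahedral \<Longrightarrow> h' \<in> binary_octahedral \<Longrightarrow> h \<star> h' \<in> binary_octahedral"
  "h \<in> binary_octahedral \<Longrightarrow> hcnj h \<in> binary_octahedral"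
  "h \<in> binary_octahedral \<Longrightarrow> - h \<in> binary_octahedral"
  "hone \<in> binary_icosahedral" "hone \<in> binary_octahedral"
proof -
  have n: "- hone \<in> hurwitz_units" by (simp add: vec4_in_hurwitz_units)
  show c: "g \<in> binary_icosahedral \<Longrightarrow> g' \<in> binary_icosahedral \<Longrightarrow> g \<star> g' \<in> binary_icosahedral"
    "g \<in> binary_icosahedral \<Longrightarrow> hcnj g \<in> binary_icosahedral"
    "h \<in> binary_octahedral \<Longrightarrow> h' \<in> binary_octahedral \<Longrightarrow> h \<star> h' \<in> binary_octahedral"
    "h \<in> binary_octahedral \<Longrightarrow> hcnj h \<in> binary_octahedral" for g g' h h'
    using subgroup_SU2_closed[OF subgroup_binary_icosahedral] subgroup_SU2_closed[OF subgroup_binary_octahedral]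
    by auto
  have "(- hone) \<star> x = - x" for x :: "real ^ 4"
    by (simp only: hmul_linear hmul_one)
  then show "g \<in> binary_icosahedral \<Longrightarrow> - g \<in> binary_icosahedral"
    "h \<in> binary_octahedral \<Longrightarrow> - h \<in> binary_octahedral"
    using c(1)[of "- hone" g] c(3)[of "- hone" h] n hurwitz_units_subset_binary by auto
  show "hone \<in> binary_icosahedral" "hone \<in> binary_octahedral"
    using hone_in_hurwitz_units hurwitz_units_subset_binary by auto
qed

lemma group_IO: "group IO"
proof (rule groupI)
  fix A B assume "A \<in> carrier IO" "B \<in> carrier IO"
  then show "A \<otimes>\<^bsub>IO\<^esub> B \<in> carrier IO"
    by (clarsimp simp: carrier_IO double_cover_mult) (blast intro: binary_closed)
next
  show "\<one>\<^bsub>IO\<^esub> \<in> carrier IO"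
    using binary_closed(7,8) by (auto simp: carrier_IO simp flip: double_cover_one)
next
  fix A assume "A \<in> carrier IO"
  then obtain g h where gh: "A = double_cover g h" "g \<in> binary_icosahedral" "h \<in> binary_octahedral"
    by (auto simp: carrier_IO)
  have "double_cover (hcnj g) (hcnj h) ** A = mat 1"
    using gh by (simp add: double_cover_mult hmul_hcnj double_cover_one)
  then show "\<exists>B\<in>carrier IO. B \<otimes>\<^bsub>IO\<^esub> A = \<one>\<^bsub>IO\<^esub>"
    using gh binary_closed(2,5)
    by (intro bexI[of _ "double_cover (hcnj g) (hcnj h)"]) (auto simp: carrier_IO)
qed (auto simp: matrix_mul_assoc)

lemma double_cover_in_IO:
  "g \<in> binary_icosahedral \<Longrightarrow> h \<in> binary_octahedral \<Longrightarrow> double_cover g h \<in> carrier IO"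
  by (auto simp: carrier_IO)

lemma uminus_mat1_in_IO: "- mat 1 \<in> carrier IO"
  using double_cover_in_IO[OF binary_closed(3)[OF binary_closed(7)] binary_closed(8)]
  by (simp only: double_cover_uminus(1)[OF hnorm_binary(2)[OF binary_closed(8)]] double_cover_one)

lemma matrix_mult_uminus: "(- A) ** B = - (A ** B)" "A ** (- B) = - (A ** B)"
  for A :: "'a::comm_ring_1 ^ 'n ^ 'm" and B :: "'a ^ 'p ^ 'n"
  by (simp_all add: matrix_matrix_mult_def vec_eq_iff sum_negf)

lemma normal_pm_one: "{mat 1, - mat 1} \<lhd> IO"
proof -
  interpret group IO by (rule group_IO)
  have "subgroup {mat 1, - mat 1} IO"
  proof (rule subgroupI)
    fix A assume A: "A \<in> {mat 1, - mat 1 :: real ^ 4 ^ 4}"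
    then have "inv\<^bsub>IO\<^esub> A = A"
      using uminus_mat1_in_IO one_closed by (intro inv_equality) (auto simp: matrix_mult_uminus)
    with A show "inv\<^bsub>IO\<^esub> A \<in> {mat 1, - mat 1}" by simp
  qed (use uminus_mat1_in_IO one_closed in \<open>auto simp: matrix_mult_uminus\<close>)
  then show ?thesis
    by (rule normalI) (auto simp: r_coset_def l_coset_def matrix_mult_uminus)
qed

lemma coset_pm_one: "{mat 1, - mat 1} #>\<^bsub>IO\<^esub> double_cover g h = pm_coset g h"
  by (auto simp: r_coset_def pm_coset_def matrix_mult_uminus)

lemma group_PIO: "group PIO"
  unfolding PIO_def by (rule normal.factorgroup_is_group[OF normal_pm_one])

lemma carrier_PIO: "carrier PIO = {pm_coset g h | g h. g \<in> binary_icosahedral \<and> h \<in> binary_octahedral}"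
proof -
  have "carrier PIO = (\<lambda>A. {mat 1, - mat 1} #>\<^bsub>IO\<^esub> A) ` carrier IO"
    by (auto simp: PIO_def FactGroup_def RCOSETS_def)
  then show ?thesis unfolding carrier_IO by (auto simp flip: coset_pm_one)
qed

lemma pm_coset_in_PIO:
  "g \<in> binary_icosahedral \<Longrightarrow> h \<in> binary_octahedral \<Longrightarrow> pm_coset g h \<in> carrier PIO"
  by (auto simp: carrier_PIO)

lemma mult_PIO:
  assumes "g \<in> binary_icosahedral" "h \<in> binary_octahedral" "g' \<in> binary_icosahedral" "h' \<in> binary_octahedral"
  shows "pm_coset g h \<otimes>\<^bsub>PIO\<^esub> pm_coset g' h' = pm_coset (g \<star> g') (h \<star> h')"
  using normal.rcos_sum[OF normal_pm_one double_cover_in_IO[OF assms(1,2)] double_cover_in_IO[OF assms(3,4)]]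
  by (simp add: PIO_def coset_pm_one double_cover_mult assms)

lemma pm_coset_uminus:
  assumes "hnorm h = 1"
  shows "pm_coset (- g) h = pm_coset g h" "pm_coset g (- h) = pm_coset g h"
  by (auto simp: pm_coset_def double_cover_uminus assms)

text \<open>The double cover forgets only a common sign of g and h, and the passage to cosets frees
  the two signs from each other. Each coset thus comes from four pairs, which yields the order 120 *
  48 / 4 = 1440.\<close>

lemma pm_coset_eq_iff:
  assumes "hnorm g = 1" "hnorm h = 1" "hnorm g' = 1" "hnorm h' = 1"
  shows "pm_coset g h = pm_coset g' h' \<longleftrightarrow> (g = g' \<or> g = - g') \<and> (h = h' \<or> h = - h')"
proof
  have *: "(g = g' \<or> g = - g') \<and> (h = h' \<or> h = - h')"
    if "double_cover g h = double_cover g' h'" "hnorm g' = 1" for g'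
  proof -
    have "double_cover (hcnj g' \<star> g) (hcnj h' \<star> h) = mat 1"
      using that assms double_cover_mult[of "hcnj h'" h "hcnj g'" g]
        double_cover_mult[of "hcnj h'" h' "hcnj g'" g'] by (simp add: hmul_hcnj double_cover_one)
    then have "hcnj g' \<star> g = hcnj h' \<star> h \<and> (hcnj g' \<star> g = hone \<or> hcnj g' \<star> g = - hone)"
      using assms that by (intro double_cover_eq_one) (simp_all add: hnorm_hmul)
    moreover have "g' \<star> (hcnj g' \<star> g) = g" "h' \<star> (hcnj h' \<star> h) = h"
      using assms that by (simp_all add: hmul_hcnj_cancel)
    ultimately show ?thesis by (metis hmul_one(2) hmul_linear(6))
  qed
  assume "pm_coset g h = pm_coset g' h'"
  then have "double_cover g h = double_cover g' h' \<or> double_cover g h = - double_cover g' h'"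
    by (auto simp: pm_coset_def)
  then have "double_cover g h = double_cover g' h' \<or> double_cover g h = double_cover (- g') h'"
    by (simp add: double_cover_uminus assms)
  then show "(g = g' \<or> g = - g') \<and> (h = h' \<or> h = - h')"
    using *[of g'] *[of "- g'"] assms by auto
next
  assume "(g = g' \<or> g = - g') \<and> (h = h' \<or> h = - h')"
  then show "pm_coset g h = pm_coset g' h'"
    using assms by (auto simp: pm_coset_uminus)
qed

lemma uminus_neq: "hnorm g = 1 \<Longrightarrow> g \<noteq> - g" for g :: "real ^ 4"
  by (auto simp: vec_eq_iff4 hnorm_def)

lemma card_fibres:
  assumes "finite A" "\<And>y. y \<in> f ` A \<Longrightarrow> card {x \<in> A. f x = y} = k"
  shows "card A = k * card (f ` A)"
proof -
  have "card A = (\<Sum>y\<in>f ` A. card {x \<in> A. f x = y})"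
    using sum.image_gen[OF assms(1), of "\<lambda>_. 1::nat" f] by simp
  then show ?thesis by (simp add: assms(2))
qed

lemma order_PIO: "order PIO = 1440"
proof -
  let ?A = "binary_icosahedral \<times> binary_octahedral" and ?f = "\<lambda>(g, h). pm_coset g h"
  have "card ?A = 4 * card (?f ` ?A)"
  proof (rule card_fibres)
    fix C assume "C \<in> ?f ` ?A"
    then obtain g h where gh: "g \<in> binary_icosahedral" "h \<in> binary_octahedral" "C = pm_coset g h" by auto
    have "{x \<in> ?A. ?f x = C} = {g, - g} \<times> {h, - h}"
      using gh by (auto simp: pm_coset_eq_iff pm_coset_uminus binary_closed)
    then show "card {x \<in> ?A. ?f x = C} = 4"
      using gh uminus_neq[of g] uminus_neq[of h] by (simp add: card_cartesian_product)
  next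
    show "finite ?A"
      by (rule card_ge_0_finite)
        (simp add: card_cartesian_product card_binary_icosahedral card_binary_octahedral)
  qed
  moreover have "?f ` ?A = carrier PIO"
    by (auto simp: carrier_PIO)
  ultimately show ?thesis
    by (simp add: order_def card_cartesian_product card_binary_icosahedral card_binary_octahedral)
qed

section \<open>The action on vectors and on lines\<close>

definition cact :: "real ^ 4 \<Rightarrow> real ^ 4 \<Rightarrow> complex ^ 4 \<Rightarrow> complex ^ 4" where
  "cact g h x = cvec g \<star> x \<star> hcnj (cvec h)"

lemma cact_linear: "cact g h (x + y) = cact g h x + cact g h y" "cact g h (c *s x) = c *s cact g h x"
  by (simp_all add: cact_def hmul_linear)

lemma cact_uminus: "cact (- g) h x = - cact g h x"
  by (simp add: cact_def cvec_hom hmul_linear)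

lemma cact_cact: "cact g h (cact g' h' x) = cact (g \<star> g') (h \<star> h') x"
  by (simp add: cact_def cvec_hom hcnj_hmul hmul_assoc)

lemma cact_inverse:
  assumes "hnorm g = 1" "hnorm h = 1"
  shows "cact (hcnj g) (hcnj h) (cact g h x) = x" "cact g h (cact (hcnj g) (hcnj h) x) = x"
  using assms by (simp_all add: cact_cact hmul_hcnj) (simp_all add: cact_def cvec_hom)

lemma cact_eq_0_iff:
  assumes "hnorm g = 1" "hnorm h = 1"
  shows "cact g h x = 0 \<longleftrightarrow> x = 0"
  using cact_inverse[OF assms, of x] cact_linear(2)[of g h 0 0] cact_linear(2)[of "hcnj g" "hcnj h" 0 0]
  by auto

lemma span_single: "vec.span {v} = range (\<lambda>c. c *s v)" for v :: "'a::field ^ 'n"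
  by (rule vec.span_singleton)

lemma complex_act_image_span:
  assumes "hnorm h = 1"
  shows "complex_act (double_cover g h) ` vec.span {v} = vec.span {cact g h v}"
  using assms by (simp add: span_single image_image complex_act_double_cover cact_def hmul_linear)

lemma span_uminus: "vec.span {- v} = vec.span {v}" for v :: "'a::field ^ 'n"
proof -
  have "vec.span {- w} \<subseteq> vec.span {w}" for w :: "'a ^ 'n"
    by (intro vec.span_minimal vec.subspace_span) (simp add: vec.span_neg vec.span_base)
  from this[of v] this[of "- v"] show ?thesis by simp
qed

lemma PIO_act_span:
  assumes "hnorm h = 1" "v \<noteq> 0"
  shows "PIO_act (pm_coset g h) (vec.span {v}) = vec.span {cact g h v}"
proof -
  have "vec.span {v} \<in> P3" using assms by (auto simp: P3_def)
  moreover have "complex_act (- double_cover g h) ` vec.span {v} = vec.span {cact g h v}"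
    using complex_act_image_span[OF assms(1), of "- g"] assms(1)
    by (simp add: double_cover_uminus cact_uminus span_uminus)
  ultimately show ?thesis
    by (simp add: PIO_act_def pm_coset_def complex_act_image_span assms)
qed

lemma PIO_act_hom:
  assumes "C \<in> carrier PIO" "D \<in> carrier PIO" "p \<in> P3"
  shows "PIO_act D p \<in> P3" "PIO_act (C \<otimes>\<^bsub>PIO\<^esub> D) p = PIO_act C (PIO_act D p)"
proof -
  obtain g h where gh: "C = pm_coset g h" "g \<in> binary_icosahedral" "h \<in> binary_octahedral"
    using assms by (auto simp: carrier_PIO)
  obtain g' h' where gh': "D = pm_coset g' h'" "g' \<in> binary_icosahedral" "h' \<in> binary_octahedral"
    using assms by (auto simp: carrier_PIO)
  obtain v where v: "p = vec.span {v}" "v \<noteq> 0" using assms by (auto simp: P3_def)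
  have nz: "cact g' h' v \<noteq> 0" using gh' v by (simp add: cact_eq_0_iff)
  then show "PIO_act D p \<in> P3"
    using gh' v by (auto simp: PIO_act_span P3_def)
  show "PIO_act (C \<otimes>\<^bsub>PIO\<^esub> D) p = PIO_act C (PIO_act D p)"
    using gh gh' v nz by (simp add: mult_PIO PIO_act_span hnorm_hmul cact_cact)
qed

lemma PIO_act_one:
  assumes "p \<in> P3"
  shows "PIO_act \<one>\<^bsub>PIO\<^esub> p = p"
proof -
  have "\<one>\<^bsub>PIO\<^esub> = pm_coset hone hone"
    by (simp add: PIO_def pm_coset_def double_cover_one)
  moreover obtain v where "p = vec.span {v}" "v \<noteq> 0" using assms by (auto simp: P3_def)
  ultimately show ?thesis
    by (simp add: PIO_act_span) (simp add: cact_def cvec_hom)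
qed

lemma group_action_PIO: "group_action PIO P3 PIO_act"
proof -
  interpret group PIO by (rule group_PIO)
  have bij: "PIO_act C \<in> Bij P3" if C: "C \<in> carrier PIO" for C
  proof -
    have "bij_betw (PIO_act C) P3 P3"
    proof (rule bij_betwI[where g = "PIO_act (inv\<^bsub>PIO\<^esub> C)"])
      fix p assume p: "p \<in> P3"
      show "PIO_act (inv\<^bsub>PIO\<^esub> C) (PIO_act C p) = p" "PIO_act C (PIO_act (inv\<^bsub>PIO\<^esub> C) p) = p"
        using PIO_act_hom(2)[OF _ _ p] C PIO_act_one[OF p] by (metis inv_closed l_inv r_inv)+
    qed (use C PIO_act_hom(1) in auto)
    then show ?thesis by (simp add: Bij_def PIO_act_def)
  qed
  have "PIO_act (C \<otimes>\<^bsub>PIO\<^esub> D) = compose P3 (PIO_act C) (PIO_act D)"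
    if "C \<in> carrier PIO" "D \<in> carrier PIO" for C D
    using PIO_act_hom(2)[OF that] by (auto simp: fun_eq_iff compose_def PIO_act_def)
  then have "PIO_act \<in> hom PIO (BijGroup P3)"
    using bij by (auto simp: hom_def BijGroup_def)
  then show ?thesis
    by (simp add: group_action_def group_hom_def group_hom_axioms_def group_PIO group_BijGroup)
qed

section \<open>Stabilizers\<close>

lemma (in group_action) stabilizer_conj_iso:
  assumes "g \<in> carrier G" "x \<in> E"
  shows "G\<lparr>carrier := stabilizer G \<phi> x\<rparr> \<cong> G\<lparr>carrier := stabilizer G \<phi> (\<phi> g x)\<rparr>"
proof -
  interpret group G using group_hom group_hom.axioms(1) by auto
  let ?f = "\<lambda>h. g \<otimes> h \<otimes> inv g"
  have st: "g \<otimes> h \<otimes> inv g \<in> stabilizer G \<phi> (\<phi> g x)"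
    if "h \<in> stabilizer G \<phi> x" "g \<in> carrier G" "x \<in> E" for g h x
  proof -
    have h: "h \<in> carrier G" "\<phi> h x = x" using that by (auto simp: stabilizer_def)
    have "\<phi> (g \<otimes> h \<otimes> inv g) (\<phi> g x) = \<phi> (g \<otimes> h \<otimes> inv g \<otimes> g) x"
      using that h composition_rule[of x "g \<otimes> h \<otimes> inv g" g] by simp
    also have "\<dots> = \<phi> (g \<otimes> h) x" using that h by (simp add: m_assoc)
    also have "\<dots> = \<phi> g x" using that h composition_rule[of x g h] by simp
    finally show ?thesis using that h by (simp add: stabilizer_def)
  qed
  have returns: "\<phi> (inv g) (\<phi> g x) = x" using orbit_sym_aux[OF assms refl] .
  have mem: "\<phi> g x \<in> E" using element_image[OF assms refl] .
  have sub: "stabilizer G \<phi> y \<subseteq> carrier G" for y by (auto simp: stabilizer_def)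
  have "bij_betw ?f (stabilizer G \<phi> x) (stabilizer G \<phi> (\<phi> g x))"
  proof (rule bij_betwI[where g = "\<lambda>h. inv g \<otimes> h \<otimes> g"])
    show "?f \<in> stabilizer G \<phi> x \<rightarrow> stabilizer G \<phi> (\<phi> g x)" using st assms by auto
    show "(\<lambda>h. inv g \<otimes> h \<otimes> g) \<in> stabilizer G \<phi> (\<phi> g x) \<rightarrow> stabilizer G \<phi> x"
      using st[of _ "\<phi> g x" "inv g"] assms mem returns by auto
  next
    have c: "g \<otimes> (inv g \<otimes> y) = y" "inv g \<otimes> (g \<otimes> y) = y" if "y \<in> carrier G" for y
      using that assms by (simp_all flip: m_assoc)
    show "inv g \<otimes> ?f h \<otimes> g = h" if "h \<in> stabilizer G \<phi> x" for h
      using that sub[of x] assms c by (auto simp: m_assoc)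
    show "?f (inv g \<otimes> h \<otimes> g) = h" if "h \<in> stabilizer G \<phi> (\<phi> g x)" for h
      using that sub[of "\<phi> g x"] assms c by (auto simp: m_assoc)
  qed
  moreover have "?f (h \<otimes> k) = ?f h \<otimes> ?f k" if "h \<in> carrier G" "k \<in> carrier G" for h k
    using that assms by (simp add: m_assoc) (simp flip: m_assoc)
  ultimately have "?f \<in> iso (G\<lparr>carrier := stabilizer G \<phi> x\<rparr>) (G\<lparr>carrier := stabilizer G \<phi> (\<phi> g x)\<rparr>)"
    using sub by (auto simp: iso_def hom_def bij_betw_def subset_iff)
  then show ?thesis by (auto simp: is_iso_def)
qed

lemma hmul_real [simp]: "x \<star> vec4 r 0 0 0 = r *s x" "vec4 r 0 0 0 \<star> x = r *s x"
  by (simp_all add: vec_eq_iff4 hmul_def mult.commute)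

lemma cact_cvec: "cact g h (cvec p) = cvec (g \<star> p \<star> hcnj h)"
  by (simp add: cact_def cvec_hom)

lemma cvec_eq_0_iff: "cvec p = 0 \<longleftrightarrow> p = 0"
  by (simp add: vec_eq_iff)

lemma hnorm_eq_0_iff: "hnorm p = 0 \<longleftrightarrow> p = 0" for p :: "real ^ 4"
  by (simp add: hnorm_real)

lemma hnorm_scale: "hnorm (c *s x) = c\<^sup>2 * hnorm x"
  by (simp add: hnorm_def algebra_simps power_mult_distrib)

text \<open>The scalar between two real vectors could a priori be complex; comparing
  \<open>hnorm\<close> forces its square to be 1.\<close>

lemma span_cvec_eq_iff:
  assumes "p \<noteq> 0" "hnorm p' = hnorm p"
  shows "vec.span {cvec p'} = vec.span {cvec p} \<longleftrightarrow> p' = p \<or> p' = - p"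
proof
  assume "vec.span {cvec p'} = vec.span {cvec p}"
  then have "cvec p' \<in> vec.span {cvec p}" by (metis insertI1 vec.span_base)
  then obtain c where c: "cvec p' = c *s cvec p" by (auto simp: span_single)
  then have "hnorm (cvec p') = c\<^sup>2 * hnorm (cvec p)" by (simp add: hnorm_scale)
  then have "c\<^sup>2 = 1" using assms by (simp add: cvec_hom hnorm_eq_0_iff)
  then consider "c = 1" | "c = - 1" by (auto simp: power2_eq_1_iff)
  then show "p' = p \<or> p' = - p"
  proof cases
    case 1
    then show ?thesis using c by simp
  next
    case 2
    then have "cvec p' = cvec (- p)" using c by (simp add: vec_eq_iff)
    then show ?thesis by (simp only: cvec_inject) simp
  qed
next
  assume "p' = p \<or> p' = - p"
  then show "vec.span {cvec p'} = vec.span {cvec p}"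
    by (auto simp: cvec_hom span_uminus)
qed

text \<open>Fixing the line means g p = p h or g p = - p h. The second sign is absorbed into g,
  which changes neither the coset nor membership in the icosahedral group.\<close>

lemma stabilizer_real_point:
  assumes "p \<noteq> 0"
  shows "stabilizer PIO PIO_act (vec.span {cvec p}) =
    {pm_coset g h | g h. g \<in> binary_icosahedral \<and> h \<in> binary_octahedral \<and> g \<star> p = p \<star> h}"
    (is "?L = ?R")
proof (intro subset_antisym subsetI)
  have iff: "PIO_act (pm_coset g h) (vec.span {cvec p}) = vec.span {cvec p} \<longleftrightarrow> g \<star> p = p \<star> h \<or> (- g) \<star> p = p \<star> h"
    if "g \<in> binary_icosahedral" "h \<in> binary_octahedral" for g h
  proof -
    have "g \<star> p \<star> hcnj h = x \<longleftrightarrow> g \<star> p = x \<star> h" for x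
      using that hmul_hcnj_cancel(3,4)[of h] by (metis hnorm_binary(2))
    from this[of p] this[of "- p"]
    have "(g \<star> p \<star> hcnj h = p \<or> g \<star> p \<star> hcnj h = - p) \<longleftrightarrow> g \<star> p = p \<star> h \<or> (- g) \<star> p = p \<star> h"
      by (simp add: hmul_linear) (metis minus_minus)
    then show ?thesis
      using that assms
      by (simp add: PIO_act_span cvec_eq_0_iff cact_cvec span_cvec_eq_iff hnorm_hmul)
  qed
  show "C \<in> ?R" if C: "C \<in> ?L" for C
  proof -
    obtain g h where gh: "C = pm_coset g h" "g \<in> binary_icosahedral" "h \<in> binary_octahedral"
      using C by (auto simp: stabilizer_def carrier_PIO)
    then consider "g \<star> p = p \<star> h" | "(- g) \<star> p = p \<star> h"
      using C iff by (auto simp: stabilizer_def)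
    then show ?thesis
    proof cases
      case 1
      then show ?thesis using gh by blast
    next
      case 2
      have "C = pm_coset (- g) h" using gh by (simp add: pm_coset_uminus)
      then show ?thesis using gh 2 binary_closed(3) by blast
    qed
  qed
  show "C \<in> ?L" if "C \<in> ?R" for C
    using that iff by (auto simp: stabilizer_def pm_coset_in_PIO)
qed

text \<open>Since g = p h p^-1 is determined by h, an isomorphism from H is prescribed by its
  octahedral component e alone. The map e lifts H through the quotient by the signs, so
  multiplicativity, injectivity and surjectivity can only be required up to sign.\<close>

lemma fix_group_iso:
  assumes p: "p \<noteq> 0" and "group H"
    and e: "\<And>x. x \<in> carrier H \<Longrightarrow> e x \<in> binary_octahedral"
      "\<And>x. x \<in> carrier H \<Longrightarrow> \<exists>g\<in>binary_icosahedral. g \<star> p = p \<star> e x"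
    and mult: "\<And>x y. x \<in> carrier H \<Longrightarrow> y \<in> carrier H \<Longrightarrow>
      e (x \<otimes>\<^bsub>H\<^esub> y) = e x \<star> e y \<or> e (x \<otimes>\<^bsub>H\<^esub> y) = - (e x \<star> e y)"
    and inj: "\<And>x y. x \<in> carrier H \<Longrightarrow> y \<in> carrier H \<Longrightarrow> e x = e y \<or> e x = - e y \<Longrightarrow> x = y"
    and surj: "\<And>g h. g \<in> binary_icosahedral \<Longrightarrow> h \<in> binary_octahedral \<Longrightarrow> g \<star> p = p \<star> h \<Longrightarrow>
      \<exists>x\<in>carrier H. h = e x \<or> h = - e x"
  shows "fix_group (vec.span {cvec p}) \<cong> H"
proof -
  have n: "hnorm p \<noteq> 0" using p by (simp add: hnorm_eq_0_iff)
  \<comment> \<open>This is p (e x) p^-1, with the inverse of p written as \<open>hcnj p\<close>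
    divided by \<open>hnorm p\<close>.\<close>
  define d where "d x = (1 / hnorm p) *s (p \<star> e x \<star> hcnj p)" for x
  have unique: "g = (1 / hnorm p) *s (p \<star> h \<star> hcnj p)" if "g \<star> p = p \<star> h" for g h
  proof -
    have "p \<star> h \<star> hcnj p = hnorm p *s g"
      by (simp flip: that) (simp add: hmul_assoc hmul_hcnj hmul_linear)
    then show ?thesis using n by simp
  qed
  have d: "d x \<in> binary_icosahedral \<and> d x \<star> p = p \<star> e x" if "x \<in> carrier H" for x
    using e(2)[OF that] unique by (auto simp: d_def)
  define f where "f x = pm_coset (d x) (e x)" for x
  have carrier: "carrier (fix_group (vec.span {cvec p})) =
    {pm_coset g h | g h. g \<in> binary_icosahedral \<and> h \<in> binary_octahedral \<and> g \<star> p = p \<star> h}"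
    by (simp add: fix_group_def stabilizer_real_point[OF p])
  have "f x \<in> carrier (fix_group (vec.span {cvec p}))" if "x \<in> carrier H" for x
    using d[OF that] e(1)[OF that] by (auto simp: carrier f_def)
  moreover have "f (x \<otimes>\<^bsub>H\<^esub> y) = f x \<otimes>\<^bsub>PIO\<^esub> f y" if xy: "x \<in> carrier H" "y \<in> carrier H" for x y
  proof -
    have "x \<otimes>\<^bsub>H\<^esub> y \<in> carrier H"
      using xy \<open>group H\<close> by (simp add: group.is_monoid monoid.m_closed)
    note d' = d[OF this] and e' = e(1)[OF this]
    have eq: "d x \<star> d y \<star> p = p \<star> (e x \<star> e y)"
      using d[OF xy(1)] d[OF xy(2)] by (metis hmul_assoc)
    \<comment> \<open>The formula for d carries the sign of e along, so both components change sign
      together or not at all.\<close>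
    have "d (x \<otimes>\<^bsub>H\<^esub> y) = d x \<star> d y \<and> e (x \<otimes>\<^bsub>H\<^esub> y) = e x \<star> e y \<or>
      d (x \<otimes>\<^bsub>H\<^esub> y) = - (d x \<star> d y) \<and> e (x \<otimes>\<^bsub>H\<^esub> y) = - (e x \<star> e y)"
      using mult[OF xy] unique[OF eq] unique[of "- (d x \<star> d y)" "- (e x \<star> e y)"] eq
      by (auto simp: d_def hmul_linear)
    then show ?thesis
      using d[OF xy(1)] d[OF xy(2)] e(1)[OF xy(1)] e(1)[OF xy(2)]
      by (auto simp: f_def mult_PIO pm_coset_uminus hnorm_hmul)
  qed
  moreover have "inj_on f (carrier H)"
  proof (rule inj_onI)
    fix x y assume "x \<in> carrier H" "y \<in> carrier H" "f x = f y"
    then show "x = y" using d e(1) inj[of x y] by (simp add: f_def pm_coset_eq_iff)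
  qed
  moreover have "C \<in> f ` carrier H" if C: "C \<in> carrier (fix_group (vec.span {cvec p}))" for C
  proof -
    obtain g h where gh: "C = pm_coset g h" "g \<in> binary_icosahedral" "h \<in> binary_octahedral" "g \<star> p = p \<star> h"
      using C by (auto simp: carrier)
    obtain x where x: "x \<in> carrier H" "h = e x \<or> h = - e x" using surj gh by blast
    have "g = d x \<or> g = - d x" using unique[OF gh(4)] x(2) by (auto simp: d_def hmul_linear)
    then have "C = f x"
      using x gh d[OF x(1)] e(1)[OF x(1)] by (auto simp: f_def pm_coset_uminus)
    then show ?thesis using x by blast
  qed
  ultimately have "f \<in> iso H (fix_group (vec.span {cvec p}))"
    unfolding iso_def hom_def bij_betw_def by (auto simp: fix_group_def)
  then show ?thesis
    using group.iso_sym[OF \<open>group H\<close>] by (auto simp: is_iso_def)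
qed

text \<open>The group data are required at one point only: along an orbit the stabilizers are
  conjugate, and the length is 1440 divided by their order.\<close>

lemma has_node_orbitI:
  assumes p: "p \<noteq> 0" and iso: "fix_group (vec.span {cvec p}) \<cong> H" and "group H"
    and len: "order H = n" "len * n = 1440"
    and node: "\<And>g h. g \<in> binary_icosahedral \<Longrightarrow> h \<in> binary_octahedral \<Longrightarrow>
      is_node F (vec.span {cact g h (cvec p)})"
  shows "has_node_orbit F len H n"
proof -
  interpret group_action PIO P3 PIO_act by (rule group_action_PIO)
  let ?x = "vec.span {cvec p}"
  have x: "?x \<in> P3" using p by (auto simp: P3_def cvec_eq_0_iff)
  have ord: "order (fix_group y) = n" if "fix_group y \<cong> H" for y
    using iso_same_card[OF that] len(1) by (simp add: order_def)
  have iso_orbit: "fix_group y \<cong> H" if y: "y \<in> orbit PIO PIO_act ?x" for y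
  proof -
    obtain C where C: "C \<in> carrier PIO" "y = PIO_act C ?x" using y by (auto simp: orbit_def)
    have "y \<in> P3" using element_image[OF C(1) x] C(2) by simp
    then obtain D where "D \<in> carrier PIO" "?x = PIO_act D y"
      using orbit_sym[OF x _ y] by (auto simp: orbit_def)
    then have "fix_group y \<cong> fix_group ?x"
      using stabilizer_conj_iso[OF _ \<open>y \<in> P3\<close>] by (simp add: fix_group_def)
    then show ?thesis using iso iso_trans by blast
  qed
  have node': "is_node F y" if y: "y \<in> orbit PIO PIO_act ?x" for y
    using y node p by (auto simp: orbit_def carrier_PIO PIO_act_span cvec_eq_0_iff)
  have "card (orbit PIO PIO_act ?x) * n = 1440"
    using orbit_stabilizer_theorem[OF x] ord[OF iso] order_PIO unfolding fix_group_def order_def by simp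
  then have "card (orbit PIO PIO_act ?x) = len"
    using len(2) by (metis mult_right_cancel mult_0_right zero_neq_numeral)
  then show ?thesis
    unfolding has_node_orbit_def using iso_orbit node' ord x by (auto simp: orbits_def)
qed

subsection \<open>The tetrahedral fix group\<close>

text \<open>The coordinates plus or minus 1/sqrt 2 are typical of the octahedral elements outside
  the tetrahedral group. Testing the square treats both signs at once.\<close>

lemma binary_icosahedral_nth_sq:
  assumes "x \<in> binary_icosahedral" shows "(x $ n)\<^sup>2 \<noteq> 1/2"
proof -
  have "y\<^sup>2 \<noteq> 1/2" if "y \<in> {0, 1/2, -1/2, 1, -1, tau/2, -tau/2, (tau - 1)/2, (1 - tau)/2}" for y
    using that tau_bounds
    by - (elim insertE emptyE; hypsubst; simp add: power2_eq_square field_simps tau_mult)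
  then show ?thesis using binary_icosahedral_nth[OF assms, of n] by blast
qed

lemma quat_R4_mult: "quat_R4 \<star> vec4 a b c d = (1 / sqrt 2) *s vec4 (a - b) (a + b) (c - d) (c + d)"
  by (simp add: quat_R4_def field_simps)

lemma binary_octahedral_cases:
  assumes "h \<in> binary_octahedral"
  obtains a b c d where "h = vec4 a b c d" "vec4 a b c d \<in> hurwitz_units"
  | a b c d where "h = (1 / sqrt 2) *s vec4 (a - b) (a + b) (c - d) (c + d)" "vec4 a b c d \<in> hurwitz_units"
proof -
  have "h \<in> hurwitz_units \<or> (\<exists>t\<in>hurwitz_units. h = quat_R4 \<star> t)"
    using assms by (auto simp: binary_octahedral_eq)
  then show thesis
  proof (elim disjE bexE)
    assume "h \<in> hurwitz_units"
    then show thesis using that(1) by (cases h rule: vec4_exhaust) auto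
  next
    fix t assume "t \<in> hurwitz_units" "h = quat_R4 \<star> t"
    then show thesis using that(2) by (cases t rule: vec4_exhaust) (auto simp: quat_R4_mult)
  qed
qed

text \<open>Every element of the coset of \<open>quat_R4\<close> has a coordinate plus or minus
  1/sqrt 2, because for a Hurwitz unit one of a - b, a + b, c - d is 1 or -1. This is the fix group
  computation at p = 1.\<close>

lemma octahedral_icosahedral_hurwitz:
  assumes "h \<in> binary_octahedral" "h \<in> binary_icosahedral"
  shows "h \<in> hurwitz_units"
  using assms(1)
proof (cases rule: binary_octahedral_cases)
  case (2 a b c d)
  have "((a - b) / sqrt 2)\<^sup>2 \<noteq> 1/2" "((a + b) / sqrt 2)\<^sup>2 \<noteq> 1/2"
    "((c - d) / sqrt 2)\<^sup>2 \<noteq> 1/2"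
    using binary_icosahedral_nth_sq[OF assms(2), of 0] binary_icosahedral_nth_sq[OF assms(2), of 1]
      binary_icosahedral_nth_sq[OF assms(2), of 2]
    by (simp_all add: 2)
  then have "(a - b) * (a - b) \<noteq> 1" "(a + b) * (a + b) \<noteq> 1" "(c - d) * (c - d) \<noteq> 1"
    by (simp_all add: power_divide power2_eq_square)
  then have False
    using 2(2) unfolding vec4_in_hurwitz_units insert_iff empty_iff
    by - (elim disjE conjE FalseE; hypsubst; simp)
  then show ?thesis ..
qed auto

text \<open>The four vertices of the regular tetrahedron that the Hurwitz units permute by conjugation.\<close>

definition tetrahedron_vertex :: "nat \<Rightarrow> real ^ 4" where
  "tetrahedron_vertex k = (if k = 1 then vec4 0 1 1 1 else if k = 2 then vec4 0 1 (-1) (-1)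
     else if k = 3 then vec4 0 (-1) 1 (-1) else vec4 0 (-1) (-1) 1)"

text \<open>Conjugation by g moves vertex k to vertex \<open>\<pi> k\<close>, multiplied out so that
  no inverse of g appears and the sign of g drops out.\<close>

definition permutes_vertices :: "real ^ 4 \<Rightarrow> (nat \<Rightarrow> nat) \<Rightarrow> bool" where
  "permutes_vertices g \<pi> \<longleftrightarrow>
    (\<forall>k\<in>{1..4}. g \<star> tetrahedron_vertex k = tetrahedron_vertex (\<pi> k) \<star> g)"

lemma atLeast1AtMost4: "{1..4} = {1, 2, 3, 4::nat}" "{Suc 0..4} = {1, 2, 3, 4}"
  by auto

lemma tetrahedron_vertex_inj:
  "i \<in> {1..4} \<Longrightarrow> k \<in> {1..4} \<Longrightarrow> tetrahedron_vertex i = tetrahedron_vertex k \<Longrightarrow> i = k"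
  by (auto simp: tetrahedron_vertex_def atLeast1AtMost4 split: if_splits)

lemma hmul_right_cancel: "hnorm g \<noteq> 0 \<Longrightarrow> x \<star> g = y \<star> g \<Longrightarrow> x = y" for g :: "real ^ 4"
proof -
  assume g: "hnorm g \<noteq> 0" and eq: "x \<star> g = y \<star> g"
  have "hnorm g *s x = hnorm g *s y"
    using arg_cong[OF eq, of "\<lambda>z. z \<star> hcnj g"] by (simp add: hmul_assoc hmul_hcnj hmul_linear)
  then show "x = y" using g by simp
qed

lemma permutes_vertices_uminus: "permutes_vertices (- g) \<pi> \<longleftrightarrow> permutes_vertices g \<pi>"
  by (simp add: permutes_vertices_def hmul_linear)

lemma alt_group_permutes: "\<pi> \<in> carrier (alt_group n) \<Longrightarrow> \<pi> permutes {1..n}"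
  by (simp add: alt_group_carrier)

lemma permutes_vertices_mult:
  assumes "permutes_vertices g \<pi>" "permutes_vertices h \<rho>" "\<rho> permutes {1..4}"
  shows "permutes_vertices (g \<star> h) (\<pi> \<circ> \<rho>)"
  unfolding permutes_vertices_def
proof
  fix k :: nat assume k: "k \<in> {1..4}"
  then have "\<rho> k \<in> {1..4}" using permutes_in_image[OF assms(3)] by blast
  with k assms(1,2) show "g \<star> h \<star> tetrahedron_vertex k = tetrahedron_vertex ((\<pi> \<circ> \<rho>) k) \<star> (g \<star> h)"
    unfolding permutes_vertices_def by (metis comp_apply hmul_assoc)
qed

lemma permutes_vertices_inverse:
  assumes "permutes_vertices g \<pi>" "hnorm g = 1" "\<pi> permutes {1..4}"
  shows "permutes_vertices (hcnj g) (inv_into UNIV \<pi>)"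
  unfolding permutes_vertices_def
proof
  fix k :: nat assume k: "k \<in> {1..4}"
  let ?l = "inv_into UNIV \<pi> k"
  have l: "?l \<in> {1..4}" "\<pi> ?l = k"
    using k permutes_in_image[OF permutes_inv[OF assms(3)]] permutes_inverses(1)[OF assms(3)] by auto
  then have "g \<star> tetrahedron_vertex ?l = tetrahedron_vertex k \<star> g"
    using assms(1) unfolding permutes_vertices_def by metis
  then have "hcnj g \<star> (g \<star> tetrahedron_vertex ?l) \<star> hcnj g = hcnj g \<star> (tetrahedron_vertex k \<star> g) \<star> hcnj g"
    by simp
  then show "hcnj g \<star> tetrahedron_vertex k = tetrahedron_vertex ?l \<star> hcnj g"
    using hmul_hcnj_cancel[OF assms(2)] by (simp add: hmul_assoc)
qed

lemma permutes_vertices_unique: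
  assumes "permutes_vertices g \<pi>" "permutes_vertices g \<rho>" "hnorm g = 1" "\<pi> permutes {1..4}" "\<rho> permutes {1..4}"
  shows "\<pi> = \<rho>"
proof
  fix k
  show "\<pi> k = \<rho> k"
  proof (cases "k \<in> {1..4}")
    case True
    then have "tetrahedron_vertex (\<pi> k) \<star> g = tetrahedron_vertex (\<rho> k) \<star> g"
      using assms(1,2) unfolding permutes_vertices_def by metis
    then have "tetrahedron_vertex (\<pi> k) = tetrahedron_vertex (\<rho> k)"
      using hmul_right_cancel assms(3) by (metis zero_neq_one)
    then show ?thesis
      using True tetrahedron_vertex_inj permutes_in_image[OF assms(4)] permutes_in_image[OF assms(5)] by blast
  next
    case False
    then show ?thesis using assms(4,5) by (simp add: permutes_def)
  qed
qed

text \<open>An element fixing all vertices commutes with two linearly independent imaginary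
  quaternions and is real.\<close>

lemma permutes_vertices_id:
  assumes "permutes_vertices g id" "hnorm g = 1"
  shows "g = hone \<or> g = - hone"
proof -
  obtain a b c d where g: "g = vec4 a b c d" by (rule vec4_exhaust)
  have "g \<star> tetrahedron_vertex k = tetrahedron_vertex k \<star> g" if "k \<in> {1..4}" for k
    using assms(1) that by (simp add: permutes_vertices_def)
  from this[of 1] this[of 2]
  have "g \<star> vec4 0 1 1 1 = vec4 0 1 1 1 \<star> g" "g \<star> vec4 0 1 (-1) (-1) = vec4 0 1 (-1) (-1) \<star> g"
    by (simp_all add: tetrahedron_vertex_def)
  then have "b = 0 \<and> c = 0 \<and> d = 0"
    unfolding g hmul_vec4 vec4_inject by - (elim conjE, intro conjI; linarith)
  then show ?thesis using assms(2) by (simp add: g power2_eq_1_iff)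
qed

lemma permutes_vertices_eq:
  assumes "permutes_vertices g \<pi>" "permutes_vertices h \<pi>" "hnorm g = 1" "hnorm h = 1" "\<pi> permutes {1..4}"
  shows "g = h \<or> g = - h"
proof -
  have "permutes_vertices (hcnj h \<star> g) (inv_into UNIV \<pi> \<circ> \<pi>)"
    using assms by (intro permutes_vertices_mult permutes_vertices_inverse)
  then have "hcnj h \<star> g = hone \<or> hcnj h \<star> g = - hone"
    using assms by (intro permutes_vertices_id) (simp_all add: permutes_inv_o(2) hnorm_hmul)
  moreover have "h \<star> (hcnj h \<star> g) = g" using assms(4) by (rule hmul_hcnj_cancel)
  ultimately show ?thesis by (metis hmul_one(2) hmul_linear(6))
qed

text \<open>The unit quaternions inducing an even permutation form a subgroup, so it suffices to
  inspect the generators: i gives a product of two disjoint transpositions, S a three-cycle.\<close>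

lemma hurwitz_permutes_vertices:
  assumes "g \<in> hurwitz_units"
  shows "\<exists>\<pi>\<in>carrier (alt_group 4). permutes_vertices g \<pi>"
proof -
  let ?H = "{g \<in> carrier SU2. \<exists>\<pi>\<in>carrier (alt_group 4). permutes_vertices g \<pi>}"
  interpret A: group "alt_group 4" by (rule alt_group_is_group)
  have "subgroup ?H SU2"
  proof (rule group.subgroupI[OF group_SU2])
    have "permutes_vertices hone id" by (simp add: permutes_vertices_def)
    moreover have "id \<in> carrier (alt_group 4)" using A.one_closed by (simp add: alt_group_one)
    ultimately have "hone \<in> ?H" by (auto simp: carrier_SU2)
    then show "?H \<noteq> {}" by blast
  next
    fix g assume "g \<in> ?H"
    then obtain \<pi> where "hnorm g = 1" "\<pi> \<in> carrier (alt_group 4)" "permutes_vertices g \<pi>"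
      by (auto simp: carrier_SU2)
    then show "inv\<^bsub>SU2\<^esub> g \<in> ?H"
      using permutes_vertices_inverse[of g \<pi>] alt_group_inv_closed[of \<pi> 4]
      by (auto simp: inv_SU2 carrier_SU2 alt_group_carrier)
  next
    fix g h assume "g \<in> ?H" "h \<in> ?H"
    then obtain \<pi> \<rho> where *: "hnorm g = 1" "\<pi> \<in> carrier (alt_group 4)" "permutes_vertices g \<pi>"
      "hnorm h = 1" "\<rho> \<in> carrier (alt_group 4)" "permutes_vertices h \<rho>"
      by (auto simp: carrier_SU2)
    then have "permutes_vertices (g \<star> h) (\<pi> \<circ> \<rho>)"
      by (intro permutes_vertices_mult) (auto simp: alt_group_carrier)
    moreover have "\<pi> \<circ> \<rho> \<in> carrier (alt_group 4)"
      using A.m_closed[OF *(2,5)] by (simp add: alt_group_mult)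
    ultimately show "g \<otimes>\<^bsub>SU2\<^esub> h \<in> ?H"
      using * by (auto simp: carrier_SU2 hnorm_hmul)
  qed auto
  moreover have "quat_i \<in> ?H"
  proof -
    have "permutes_vertices quat_i (Transposition.transpose 1 2 \<circ> Transposition.transpose 3 4)"
      by (simp add: permutes_vertices_def atLeast1AtMost4 tetrahedron_vertex_def quat_i_def Transposition.transpose_def)
    moreover have "Transposition.transpose 1 2 \<circ> Transposition.transpose 3 4 \<in> carrier (alt_group 4)"
      by (auto simp: alt_group_carrier evenperm_comp evenperm_swap permutation_swap_id
          intro!: permutes_compose permutes_swap_id)
    ultimately show ?thesis using carrier_generators by auto
  qed
  moreover have "quat_S \<in> ?H"
  proof -
    have "permutes_vertices quat_S (Transposition.transpose 1 2 \<circ> Transposition.transpose 1 4)"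
      by (simp add: permutes_vertices_def atLeast1AtMost4 tetrahedron_vertex_def quat_S_def Transposition.transpose_def)
    moreover have "Transposition.transpose 1 2 \<circ> Transposition.transpose 1 4 \<in> carrier (alt_group 4)"
      by (auto simp: alt_group_carrier evenperm_comp evenperm_swap permutation_swap_id
          intro!: permutes_compose permutes_swap_id)
    ultimately show ?thesis using carrier_generators by auto
  qed
  ultimately have "hurwitz_units \<subseteq> ?H" by (rule hurwitz_units_subset)
  then show ?thesis using assms by blast
qed

lemma card_alt_group_4: "card (carrier (alt_group 4)) = 12"
  using alt_group_card_carrier[of 4] by (simp add: fact_numeral)

text \<open>A counting argument: the permutation determines the unit up to sign, so the 24 units
  have 12 images, which is all of the alternating group.\<close>

lemma alt_group_lifts:
  assumes "\<pi> \<in> carrier (alt_group 4)"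
  shows "\<exists>g\<in>hurwitz_units. permutes_vertices g \<pi>"
proof -
  define P where "P g = (SOME \<pi>. \<pi> \<in> carrier (alt_group 4) \<and> permutes_vertices g \<pi>)" for g
  have P: "P g \<in> carrier (alt_group 4) \<and> permutes_vertices g (P g)" if "g \<in> hurwitz_units" for g
    using hurwitz_permutes_vertices[OF that] unfolding P_def Bex_def by (rule someI_ex)
  have "card hurwitz_units = 2 * card (P ` hurwitz_units)"
  proof (rule card_fibres[OF finite_hurwitz_units])
    fix \<pi> assume "\<pi> \<in> P ` hurwitz_units"
    then obtain g where g: "g \<in> hurwitz_units" "\<pi> = P g" by blast
    have "- g \<in> hurwitz_units"
      using hurwitz_units_closed(1)[of "vec4 (-1) 0 0 0" g] g(1) by (simp add: vec4_in_hurwitz_units)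
    moreover have "P (- g) = P g"
    proof (rule permutes_vertices_unique)
      show "permutes_vertices g (P (- g))"
        using P[OF \<open>- g \<in> hurwitz_units\<close>] by (simp only: permutes_vertices_uminus)
      show "permutes_vertices g (P g)" "hnorm g = 1"
        using P[OF g(1)] hnorm_hurwitz_units[OF g(1)] by blast+
      show "P (- g) permutes {1..4}" "P g permutes {1..4}"
        using P[OF \<open>- g \<in> hurwitz_units\<close>] P[OF g(1)] alt_group_permutes by blast+
    qed
    moreover have "h = g \<or> h = - g" if "h \<in> hurwitz_units" "P h = P g" for h
    proof (rule permutes_vertices_eq)
      show "permutes_vertices h (P g)" using P[OF that(1)] that(2) by simp
      show "permutes_vertices g (P g)" "P g permutes {1..4}"
        using P[OF g(1)] alt_group_permutes by blast+
    qed (use that g(1) hnorm_hurwitz_units in blast)+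
    ultimately have "{x \<in> hurwitz_units. P x = \<pi>} = {g, - g}"
      unfolding g(2) using g(1) by blast
    then show "card {x \<in> hurwitz_units. P x = \<pi>} = 2"
      using uminus_neq[OF hnorm_hurwitz_units[OF g(1)]] by simp
  qed
  then have "P ` hurwitz_units = carrier (alt_group 4)"
  proof (intro card_subset_eq)
    show "finite (carrier (alt_group 4))"
      by (rule card_ge_0_finite) (simp add: card_alt_group_4)
    show "P ` hurwitz_units \<subseteq> carrier (alt_group 4)" using P by blast
    show "card (P ` hurwitz_units) = card (carrier (alt_group 4))"
      using \<open>card hurwitz_units = 2 * card (P ` hurwitz_units)\<close>
      by (simp add: card_hurwitz_units card_alt_group_4)
  qed
  then have "\<pi> \<in> P ` hurwitz_units" using assms by simp
  then show ?thesis using P by blast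
qed

lemma fix_group_tetrahedral: "fix_group (vec.span {cvec hone}) \<cong> alt_group 4"
proof -
  define e where "e \<pi> = (SOME g. g \<in> hurwitz_units \<and> permutes_vertices g \<pi>)" for \<pi>
  have e: "e \<pi> \<in> hurwitz_units \<and> permutes_vertices (e \<pi>) \<pi>" if "\<pi> \<in> carrier (alt_group 4)" for \<pi>
    using alt_group_lifts[OF that] unfolding e_def Bex_def by (rule someI_ex)
  interpret A: group "alt_group 4" by (rule alt_group_is_group)
  show ?thesis
  proof (rule fix_group_iso[where e = e])
    fix \<pi> \<rho> assume *: "\<pi> \<in> carrier (alt_group 4)" "\<rho> \<in> carrier (alt_group 4)"
    then have "permutes_vertices (e \<pi> \<star> e \<rho>) (\<pi> \<circ> \<rho>)"
      using e by (intro permutes_vertices_mult) (auto simp: alt_group_carrier)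
    moreover have "\<pi> \<circ> \<rho> \<in> carrier (alt_group 4)"
      using A.m_closed[OF *] by (simp add: alt_group_mult)
    ultimately show "e (\<pi> \<otimes>\<^bsub>alt_group 4\<^esub> \<rho>) = e \<pi> \<star> e \<rho> \<or> e (\<pi> \<otimes>\<^bsub>alt_group 4\<^esub> \<rho>) = - (e \<pi> \<star> e \<rho>)"
      using e[of "\<pi> \<circ> \<rho>"] e[OF *(1)] e[OF *(2)] unfolding alt_group_mult
      by (intro permutes_vertices_eq[of _ "\<pi> \<circ> \<rho>"] alt_group_permutes)
        (auto simp: hnorm_hmul hnorm_hurwitz_units)
    show "\<pi> = \<rho>" if "e \<pi> = e \<rho> \<or> e \<pi> = - e \<rho>"
    proof -
      have "permutes_vertices (e \<rho>) \<pi>"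
        using e[OF *(1)] that by (metis permutes_vertices_uminus)
      then show ?thesis
        using e[OF *(2)] * hnorm_hurwitz_units alt_group_permutes
        by (intro permutes_vertices_unique[of "e \<rho>"]) blast+
    qed
  next
    fix g h assume "g \<in> binary_icosahedral" "h \<in> binary_octahedral" "g \<star> hone = hone \<star> h"
    then have h: "h \<in> hurwitz_units" using octahedral_icosahedral_hurwitz by simp
    obtain \<pi> where \<pi>: "\<pi> \<in> carrier (alt_group 4)" "permutes_vertices h \<pi>"
      using hurwitz_permutes_vertices[OF h] by blast
    then have "h = e \<pi> \<or> h = - e \<pi>"
      using e[OF \<pi>(1)] h \<pi> hnorm_hurwitz_units alt_group_permutes
      by (intro permutes_vertices_eq[of _ \<pi>]) blast+
    then show "\<exists>\<pi>\<in>carrier (alt_group 4). h = e \<pi> \<or> h = - e \<pi>" using \<pi> by blast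
  next
    fix \<pi> assume "\<pi> \<in> carrier (alt_group 4)"
    then show "e \<pi> \<in> binary_octahedral" "\<exists>g\<in>binary_icosahedral. g \<star> hone = hone \<star> e \<pi>"
      using e hurwitz_units_subset_binary by auto
  qed (simp_all add: vec_eq_iff4 alt_group_is_group)
qed

subsection \<open>The Klein four fix group\<close>

lemma binary_octahedralI:
  "vec4 a b c d \<in> hurwitz_units \<Longrightarrow> vec4 a b c d \<in> binary_octahedral"
  "vec4 a b c d \<in> hurwitz_units \<Longrightarrow> (1 / sqrt 2) *s vec4 (a - b) (a + b) (c - d) (c + d) \<in> binary_octahedral"
  unfolding quat_R4_mult[symmetric]
  using hurwitz_units_subset_binary(2) binary_closed(4)[OF generators_in(6)] by blast+

text \<open>The number sqrt 2 - 1 is tan(pi/8), so this quaternion induces the rotation by 45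
  degrees about the j axis, a two-fold axis of both groups.\<close>

definition klein_point :: "real ^ 4" where
  "klein_point = vec4 1 0 (sqrt 2 - 1) 0"

lemma klein_point_conj:
  assumes "g \<star> klein_point = klein_point \<star> h"
  shows "g = vec4 (h$0) ((h$1 + h$3) / sqrt 2) (h$2) ((h$3 - h$1) / sqrt 2)"
proof -
  obtain a b c d where h: "h = vec4 a b c d" by (rule vec4_exhaust)
  have "vec4 a ((b + d) / sqrt 2) c ((d - b) / sqrt 2) \<star> klein_point = klein_point \<star> h"
    by (simp add: klein_point_def h field_simps)
  then have "g \<star> klein_point = vec4 a ((b + d) / sqrt 2) c ((d - b) / sqrt 2) \<star> klein_point"
    using assms by simp
  moreover have "hnorm klein_point \<noteq> 0"
    unfolding hnorm_eq_0_iff by (simp add: klein_point_def vec_eq_iff4)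
  ultimately show ?thesis using hmul_right_cancel by (metis h vec4_nth)
qed

text \<open>For every octahedral h other than the eight listed, p h p^-1 has a coordinate of square
  1/2, which is impossible for an icosahedral element.\<close>

lemma klein_point_fix:
  assumes "g \<in> binary_icosahedral" "h \<in> binary_octahedral" "g \<star> klein_point = klein_point \<star> h"
  shows "h \<in> {hone, - hone, vec4 0 0 1 0, - vec4 0 0 1 0, vec4 0 (1 / sqrt 2) 0 (1 / sqrt 2),
    - vec4 0 (1 / sqrt 2) 0 (1 / sqrt 2), vec4 0 (1 / sqrt 2) 0 (- 1 / sqrt 2), - vec4 0 (1 / sqrt 2) 0 (- 1 / sqrt 2)}"
proof -
  have n: "(h$0)\<^sup>2 \<noteq> 1/2" "((h$1 + h$3) / sqrt 2)\<^sup>2 \<noteq> 1/2" "(h$2)\<^sup>2 \<noteq> 1/2" "((h$3 - h$1) / sqrt 2)\<^sup>2 \<noteq> 1/2"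
    using binary_icosahedral_nth_sq[OF assms(1)] unfolding klein_point_conj[OF assms(3)] by (metis vec4_nth)+
  show ?thesis
    using assms(2)
  proof (cases rule: binary_octahedral_cases)
    case (1 a b c d)
    have "(b + d) * (b + d) \<noteq> 1" "(d - b) * (d - b) \<noteq> 1"
      using n(2,4) by (simp_all add: 1 power_divide power2_eq_square)
    then show ?thesis
      using 1(2) unfolding 1 vec4_in_hurwitz_units insert_iff empty_iff
      by - (elim disjE conjE FalseE; hypsubst; simp)
  next
    case (2 a b c d)
    have "(a - b) * (a - b) \<noteq> 1" "(c - d) * (c - d) \<noteq> 1"
      using n(1,3) by (simp_all add: 2 power_divide power2_eq_square)
    then show ?thesis
      using 2(2) unfolding 2 vec4_in_hurwitz_units insert_iff empty_iff
      by - (elim disjE conjE FalseE; hypsubst; simp)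
  qed
qed

lemma fix_group_klein:
  "fix_group (vec.span {cvec klein_point}) \<cong> integer_mod_group 2 \<times>\<times> integer_mod_group 2"
proof -
  define e :: "int \<times> int \<Rightarrow> real ^ 4" where
    "e x = (if x = (0, 0) then hone else if x = (1, 0) then vec4 0 0 1 0
      else if x = (0, 1) then vec4 0 (1 / sqrt 2) 0 (1 / sqrt 2)
      else vec4 0 (1 / sqrt 2) 0 (- 1 / sqrt 2))" for x
  have "{0..<2} = {0, 1::int}" by auto
  then have carrier: "carrier (integer_mod_group 2 \<times>\<times> integer_mod_group 2) = {(0, 0), (1, 0), (0, 1), (1, 1)}"
    by (auto simp: DirProd_def carrier_integer_mod_group)
  have e_simps: "e (0, 0) = hone" "e (1, 0) = vec4 0 0 1 0" "e (0, 1) = vec4 0 (1 / sqrt 2) 0 (1 / sqrt 2)"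
    "e (1, 1) = vec4 0 (1 / sqrt 2) 0 (- 1 / sqrt 2)"
    by (simp_all add: e_def)
  show ?thesis
  proof (rule fix_group_iso[where e = e])
    show "klein_point \<noteq> 0" by (simp add: klein_point_def vec_eq_iff4)
    show "group (integer_mod_group 2 \<times>\<times> integer_mod_group 2)"
      by (intro DirProd_group) simp_all
    have mem: "hone \<in> binary_octahedral" "vec4 0 0 1 0 \<in> binary_octahedral"
      "vec4 0 (1 / sqrt 2) 0 (1 / sqrt 2) \<in> binary_octahedral"
      "vec4 0 (1 / sqrt 2) 0 (- 1 / sqrt 2) \<in> binary_octahedral"
      using binary_octahedralI(1)[of 1 0 0 0] binary_octahedralI(1)[of 0 0 1 0]
        binary_octahedralI(2)[of "1/2" "1/2" "1/2" "1/2"] binary_octahedralI(2)[of "1/2" "1/2" "-1/2" "-1/2"]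
      by (simp_all add: vec4_in_hurwitz_units)
    have fixes_point: "hone \<star> klein_point = klein_point \<star> hone" "vec4 0 0 1 0 \<star> klein_point = klein_point \<star> vec4 0 0 1 0"
      "vec4 0 1 0 0 \<star> klein_point = klein_point \<star> vec4 0 (1 / sqrt 2) 0 (1 / sqrt 2)"
      "vec4 0 0 0 (-1) \<star> klein_point = klein_point \<star> vec4 0 (1 / sqrt 2) 0 (- 1 / sqrt 2)"
      by (simp_all add: klein_point_def field_simps)
    have icos: "hone \<in> binary_icosahedral" "vec4 0 0 1 0 \<in> binary_icosahedral"
      "vec4 0 1 0 0 \<in> binary_icosahedral" "vec4 0 0 0 (-1) \<in> binary_icosahedral"
      by (auto intro!: subsetD[OF hurwitz_units_subset_binary(1)] simp: vec4_in_hurwitz_units)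
    fix x assume "x \<in> carrier (integer_mod_group 2 \<times>\<times> integer_mod_group 2)"
    then have x: "x = (0, 0) \<or> x = (1, 0) \<or> x = (0, 1) \<or> x = (1, 1)" unfolding carrier by blast
    show "e x \<in> binary_octahedral"
      using x mem by (elim disjE; hypsubst; simp only: e_simps)
    show "\<exists>g\<in>binary_icosahedral. g \<star> klein_point = klein_point \<star> e x"
      using x icos fixes_point by (elim disjE; hypsubst; simp only: e_simps; blast)
    fix y assume "y \<in> carrier (integer_mod_group 2 \<times>\<times> integer_mod_group 2)"
    then have y: "y = (0, 0) \<or> y = (1, 0) \<or> y = (0, 1) \<or> y = (1, 1)" unfolding carrier by blast
    show "e (x \<otimes>\<^bsub>integer_mod_group 2 \<times>\<times> integer_mod_group 2\<^esub> y) = e x \<star> e y \<or>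
      e (x \<otimes>\<^bsub>integer_mod_group 2 \<times>\<times> integer_mod_group 2\<^esub> y) = - (e x \<star> e y)"
      using x y by - (elim disjE; hypsubst; simp add: DirProd_def e_simps)
    show "x = y" if "e x = e y \<or> e x = - e y"
      using x y that by - (elim disjE; hypsubst; simp add: e_simps)
  next
    fix g h assume gh: "g \<in> binary_icosahedral" "h \<in> binary_octahedral" "g \<star> klein_point = klein_point \<star> h"
    show "\<exists>x\<in>carrier (integer_mod_group 2 \<times>\<times> integer_mod_group 2). h = e x \<or> h = - e x"
      using klein_point_fix[OF gh] unfolding carrier bex_simps e_simps insert_iff by blast
  qed
qed

subsection \<open>The dihedral fix groups\<close>

text \<open>A rotation about the three-fold axis i - j + k, which it shares with
  \<open>quat_S\<close>. The number n is tan(angle/2) / sqrt 3, and the angle is the one that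
  carries the octahedral two-fold axis (i + j)/r to the icosahedral two-fold axis (tau i + j + (1 -
  tau) k)/2. Changing the sign of r reverses the first of these vectors and gives the second
  rotation.\<close>

definition dihedral_point :: "real \<Rightarrow> real ^ 4" where
  "dihedral_point r = (let n = (2 * tau + 1 - 2 * tau * r) / 3 in vec4 1 n (- n) n)"

text \<open>The rotation part is the corresponding power of S, the reflection part the half turn (i
  + j)/r about an axis orthogonal to that of S. As S^3 = -1, the map respects products only up to
  sign.\<close>

definition dihedral_lift :: "real \<Rightarrow> int \<times> bool \<Rightarrow> real ^ 4" where
  "dihedral_lift r x =
    (if fst x = 0 then hone else if fst x = 1 then quat_S else vec4 (-1/2) (1/2) (-1/2) (1/2)) \<star>
    (if snd x then vec4 0 (1 / r) (1 / r) 0 else hone)"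

lemma dihedral_group_3_carrier:
  "carrier (dihedral_group 3) = {(0, False), (1, False), (2, False), (0, True), (1, True), (2, True)}"
proof -
  have "{0..<3} = {0, 1, 2::int}" by auto
  then show ?thesis by (auto simp: dihedral_group_def)
qed

lemma dihedral_group_3_mult:
  "(a, s) \<otimes>\<^bsub>dihedral_group 3\<^esub> (b, t) = ((if s then a - b else a + b) mod 3, s \<noteq> t)"
  by (simp add: dihedral_group_def)

lemma group_dihedral_group: "0 < n \<Longrightarrow> group (dihedral_group n)"
proof (rule groupI)
  assume n: "0 < n"
  show "x \<otimes>\<^bsub>dihedral_group n\<^esub> y \<in> carrier (dihedral_group n)" for x y
    using n by (simp add: dihedral_group_def split_beta)
  show "\<one>\<^bsub>dihedral_group n\<^esub> \<in> carrier (dihedral_group n)"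
    using n by (simp add: dihedral_group_def)
  show "x \<otimes>\<^bsub>dihedral_group n\<^esub> y \<otimes>\<^bsub>dihedral_group n\<^esub> z = x \<otimes>\<^bsub>dihedral_group n\<^esub> (y \<otimes>\<^bsub>dihedral_group n\<^esub> z)" for x y z
    by (auto simp: dihedral_group_def split_beta mod_simps algebra_simps)
  show "\<one>\<^bsub>dihedral_group n\<^esub> \<otimes>\<^bsub>dihedral_group n\<^esub> x = x" if "x \<in> carrier (dihedral_group n)" for x
    using that by (auto simp: dihedral_group_def)
  show "\<exists>y\<in>carrier (dihedral_group n). y \<otimes>\<^bsub>dihedral_group n\<^esub> x = \<one>\<^bsub>dihedral_group n\<^esub>"
    if "x \<in> carrier (dihedral_group n)" for x
    using that n
    by (intro bexI[of _ "(if snd x then fst x else (- fst x) mod int n, snd x)"])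
      (auto simp: dihedral_group_def mod_simps)
qed

context
  fixes r :: real
  assumes r: "r * r = 2"
begin

lemma r_mult_left: "r * (r * x) = 2 * x"
  using r by (metis mult.assoc)

lemma r_cases: "r = sqrt 2 \<or> r = - sqrt 2"
proof -
  have "r\<^sup>2 = (sqrt 2)\<^sup>2" using r by (simp add: power2_eq_square)
  then show ?thesis by (simp only: power2_eq_iff)
qed

lemma r_nonzero: "r \<noteq> 0" using r by auto

lemma dihedral_lift_simps:
  "dihedral_lift r (0, False) = hone" "dihedral_lift r (1, False) = vec4 (1/2) (1/2) (-1/2) (1/2)"
  "dihedral_lift r (2, False) = vec4 (-1/2) (1/2) (-1/2) (1/2)"
  "dihedral_lift r (0, True) = vec4 0 (1 / r) (1 / r) 0"
  "dihedral_lift r (1, True) = vec4 0 0 (1 / r) (1 / r)"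
  "dihedral_lift r (2, True) = vec4 0 (- 1 / r) 0 (1 / r)"
  using r_nonzero by (simp_all add: dihedral_lift_def quat_S_def field_simps)

lemma dihedral_lift_binary_octahedral:
  assumes "x \<in> carrier (dihedral_group 3)"
  shows "dihedral_lift r x \<in> binary_octahedral"
proof -
  have S: "vec4 (-1/2) (1/2) (-1/2) (1/2) \<in> binary_octahedral"
    by (rule binary_octahedralI) (simp add: vec4_in_hurwitz_units)
  have "vec4 0 (1 / sqrt 2) (1 / sqrt 2) 0 \<in> binary_octahedral"
    using binary_octahedralI(2)[of "1/2" "1/2" "1/2" "-1/2"] by (simp add: vec4_in_hurwitz_units)
  moreover from binary_closed(6)[OF this] have "vec4 0 (- (1 / sqrt 2)) (- (1 / sqrt 2)) 0 \<in> binary_octahedral"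
    by simp
  ultimately have f: "vec4 0 (1 / r) (1 / r) 0 \<in> binary_octahedral" using r_cases by auto
  show ?thesis
    using S f generators_in(5) binary_closed(8) binary_closed(4)
    by (simp add: dihedral_lift_def)
qed

lemma dihedral_point_fixed:
  assumes "x \<in> carrier (dihedral_group 3)"
  shows "\<exists>g\<in>binary_icosahedral. g \<star> dihedral_point r = dihedral_point r \<star> dihedral_lift r x"
proof -
  let ?p = "dihedral_point r"
  \<comment> \<open>The icosahedral partner of the half turn (i + j)/r, found as U i.\<close>
  let ?u = "vec4 0 (tau / 2) (1 / 2) ((1 - tau) / 2)"
  have S: "quat_S \<star> ?p = ?p \<star> quat_S" "vec4 (-1/2) (1/2) (-1/2) (1/2) \<star> ?p = ?p \<star> vec4 (-1/2) (1/2) (-1/2) (1/2)"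
    by (simp_all add: dihedral_point_def quat_S_def Let_def)
  have f: "?u \<star> ?p = ?p \<star> vec4 0 (1 / r) (1 / r) 0"
    using r_nonzero by (simp add: dihedral_point_def Let_def field_simps r r_mult_left tau_mult tau_mult_left)
  have "quat_U \<star> quat_i = ?u"
    by (simp add: quat_U_def quat_i_def field_simps)
  then have u: "?u \<in> binary_icosahedral"
    using binary_closed(1)[OF generators_in(3,1)] by simp
  have S2: "vec4 (-1/2) (1/2) (-1/2) (1/2) \<in> binary_icosahedral"
    using hurwitz_units_subset_binary(1) by (auto simp: vec4_in_hurwitz_units)
  obtain a s where x: "x = (a, s)" by (cases x)
  define t where "t = (if a = 0 then hone else if a = 1 then quat_S else vec4 (-1/2) (1/2) (-1/2) (1/2))"
  define w where "w = (if s then ?u else hone)"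
  define f where "f = (if s then vec4 0 (1 / r) (1 / r) 0 else hone)"
  have w: "w \<star> ?p = ?p \<star> f" and t: "t \<star> ?p = ?p \<star> t"
    using S f by (simp_all add: t_def w_def f_def)
  have "(t \<star> w) \<star> ?p = (t \<star> ?p) \<star> f"
    by (simp only: hmul_assoc w)
  also have "\<dots> = ?p \<star> (t \<star> f)"
    by (simp only: t hmul_assoc)
  also have "t \<star> f = dihedral_lift r x"
    by (simp only: dihedral_lift_def x fst_conv snd_conv t_def f_def)
  finally have "(t \<star> w) \<star> ?p = ?p \<star> dihedral_lift r x" .
  moreover have "t \<star> w \<in> binary_icosahedral"
    using u S2 generators_in(2) binary_closed(7) by (intro binary_closed(1)) (simp_all add: t_def w_def)
  ultimately show ?thesis by blast
qed

text \<open>Coset representatives of the dihedral group in the octahedral group. The rotations by \<open>180\<close> degrees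
  about the coordinate axes permute under conjugation, and the same diagonal entry excludes each of them from the fix group.\<close>

lemma binary_octahedral_dihedral_cosets:
  assumes "h \<in> binary_octahedral"
  shows "\<exists>q\<in>{hone, vec4 0 1 0 0, vec4 0 0 1 0, vec4 0 0 0 1}. \<exists>x\<in>carrier (dihedral_group 3).
    h = q \<star> dihedral_lift r x \<or> h = - (q \<star> dihedral_lift r x)"
  using assms
proof (cases rule: binary_octahedral_cases)
  case (1 a b c d)
  have "\<exists>q\<in>{hone, vec4 0 1 0 0, vec4 0 0 1 0, vec4 0 0 0 1}. \<exists>x\<in>{(0, False), (1, False), (2, False)}.
    vec4 a b c d = q \<star> dihedral_lift r x \<or> vec4 a b c d = - (q \<star> dihedral_lift r x)"
    using 1(2) unfolding vec4_in_hurwitz_units insert_iff empty_iff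
    by - (elim disjE conjE FalseE; hypsubst; simp add: dihedral_lift_simps)
  then show ?thesis unfolding dihedral_group_3_carrier 1 by blast
next
  case (2 a b c d)
  \<comment> \<open>Multiplication by r clears the radicals: the entries of r times a lifted
    reflection are integers, and r / sqrt 2 is only a sign.\<close>
  have "\<exists>q\<in>{hone, vec4 0 1 0 0, vec4 0 0 1 0, vec4 0 0 0 1}. \<exists>x\<in>{(0, True), (1, True), (2, True)}.
    vec4 (a - b) (a + b) (c - d) (c + d) = r *s (q \<star> dihedral_lift r x) \<or>
    vec4 (a - b) (a + b) (c - d) (c + d) = - (r *s (q \<star> dihedral_lift r x))"
    using 2(2) r_nonzero unfolding vec4_in_hurwitz_units insert_iff empty_iff
    by - (elim disjE conjE FalseE; hypsubst; simp add: dihedral_lift_simps)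
  then obtain q x where qx: "q \<in> {hone, vec4 0 1 0 0, vec4 0 0 1 0, vec4 0 0 0 1}"
    "x \<in> {(0, True), (1, True), (2, True)}"
    "vec4 (a - b) (a + b) (c - d) (c + d) = r *s (q \<star> dihedral_lift r x) \<or>
     vec4 (a - b) (a + b) (c - d) (c + d) = - (r *s (q \<star> dihedral_lift r x))"
    by blast
  have "1 / sqrt 2 * r = 1 \<or> 1 / sqrt 2 * r = - 1" using r_cases by auto
  then have scale: "(1 / sqrt 2) *s (r *s y) = y \<or> (1 / sqrt 2) *s (r *s y) = - y" for y :: "real ^ 4"
    by (auto simp only: vector_smult_assoc vector_smult_lid vector_sneg_minus1)
  have "h = (1 / sqrt 2) *s (r *s (q \<star> dihedral_lift r x)) \<or>
      h = - ((1 / sqrt 2) *s (r *s (q \<star> dihedral_lift r x)))"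
    using qx(3) 2(1) by (metis vec.scale_minus_right)
  then have "h = q \<star> dihedral_lift r x \<or> h = - (q \<star> dihedral_lift r x)"
    using scale by (metis minus_minus)
  then show ?thesis using qx(1,2) unfolding dihedral_group_3_carrier by blast
qed

lemma dihedral_point_conj_axis:
  assumes "g \<in> binary_icosahedral" "u \<in> {vec4 0 1 0 0, vec4 0 0 1 0, vec4 0 0 0 1}"
  shows "g \<star> dihedral_point r \<noteq> dihedral_point r \<star> u"
proof
  assume eq: "g \<star> dihedral_point r = dihedral_point r \<star> u"
  define n where "n = (2 * tau + 1 - 2 * tau * r) / 3"
  have p: "dihedral_point r = vec4 1 n (- n) n" by (simp add: dihedral_point_def n_def Let_def)
  have "g \<star> dihedral_point r \<star> hcnj (dihedral_point r) = (1 + 3 * n\<^sup>2) *s g"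
    by (simp add: hmul_assoc hmul_hcnj) (simp add: p)
  then have *: "(1 + 3 * n\<^sup>2) *s g = vec4 1 n (- n) n \<star> u \<star> vec4 1 (- n) n (- n)"
    by (simp add: eq) (simp add: p)
  \<comment> \<open>Here k is the coordinate of the axis u. All three coordinates of i - j + k have
    the same square, so the unnormalized diagonal entry is 1 - n^2 for each axis.\<close>
  obtain k where k: "(1 + 3 * n\<^sup>2) * g $ k = 1 - n\<^sup>2"
  proof -
    have "(1 + 3 * n\<^sup>2) * g $ 1 = 1 - n\<^sup>2 \<or> (1 + 3 * n\<^sup>2) * g $ 2 = 1 - n\<^sup>2 \<or> (1 + 3 * n\<^sup>2) * g $ 3 = 1 - n\<^sup>2"
      using assms(2) arg_cong[OF *, of "\<lambda>x. x $ 1"] arg_cong[OF *, of "\<lambda>x. x $ 2"] arg_cong[OF *, of "\<lambda>x. x $ 3"]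
      by (auto simp: power2_eq_square distrib_right)
    then show thesis using that by blast
  qed
  have "3 * (1 - n\<^sup>2) = (1 + 3 * n\<^sup>2) * (1 + (tau + 1) * r / 2)"
    by (simp add: n_def field_simps power2_eq_square r r_mult_left tau_mult tau_mult_left)
  with k have "(1 + 3 * n\<^sup>2) * (3 * g $ k) = (1 + 3 * n\<^sup>2) * (1 + (tau + 1) * r / 2)"
    by (metis mult.left_commute)
  moreover have "1 + 3 * n\<^sup>2 \<noteq> 0"
    using zero_le_power2[of n] by linarith
  ultimately have "3 * g $ k = 1 + (tau + 1) * r / 2" by (metis mult_left_cancel)
  then have e: "3 * g $ k - 1 = (tau + 1) * r / 2" by linarith
  \<comment> \<open>Squaring removes r, so that both signs of r are refuted by one comparison with
    the list of icosahedral coordinates.\<close>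
  have sq: "(3 * g $ k - 1) * (3 * g $ k - 1) = (3 * tau + 2) / 2"
    unfolding e by (simp add: field_simps r r_mult_left tau_mult tau_mult_left)
  have "(3 * y - 1) * (3 * y - 1) \<noteq> (3 * tau + 2) / 2"
    if "y \<in> {0, 1/2, -1/2, 1, -1, tau/2, -tau/2, (tau - 1)/2, (1 - tau)/2}" for y
    using that tau_bounds
    by - (elim insertE emptyE; hypsubst; simp add: field_simps tau_mult tau_mult_left)
  then show False using binary_icosahedral_nth[OF assms(1), of k] sq by blast
qed

lemma fix_group_dihedral: "fix_group (vec.span {cvec (dihedral_point r)}) \<cong> dihedral_group 3"
proof (rule fix_group_iso[where e = "dihedral_lift r"])
  show "dihedral_point r \<noteq> 0" by (simp add: dihedral_point_def vec_eq_iff4 Let_def)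
  show "group (dihedral_group 3)" by (rule group_dihedral_group) simp
next
  fix x y assume "x \<in> carrier (dihedral_group 3)" "y \<in> carrier (dihedral_group 3)"
  then have xy: "x = (0, False) \<or> x = (1, False) \<or> x = (2, False) \<or> x = (0, True) \<or> x = (1, True) \<or> x = (2, True)"
    "y = (0, False) \<or> y = (1, False) \<or> y = (2, False) \<or> y = (0, True) \<or> y = (1, True) \<or> y = (2, True)"
    by (simp_all add: dihedral_group_3_carrier)
  show "dihedral_lift r (x \<otimes>\<^bsub>dihedral_group 3\<^esub> y) = dihedral_lift r x \<star> dihedral_lift r y \<or>
      dihedral_lift r (x \<otimes>\<^bsub>dihedral_group 3\<^esub> y) = - (dihedral_lift r x \<star> dihedral_lift r y)"
    using xy r_nonzero
    by - (elim disjE; hypsubst; simp add: dihedral_group_3_mult dihedral_lift_simps field_simps r)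
  show "x = y" if "dihedral_lift r x = dihedral_lift r y \<or> dihedral_lift r x = - dihedral_lift r y"
    using xy r_nonzero that
    by - (elim disjE; hypsubst; simp add: dihedral_lift_simps field_simps)
next
  fix g h assume gh: "g \<in> binary_icosahedral" "h \<in> binary_octahedral" "g \<star> dihedral_point r = dihedral_point r \<star> h"
  obtain q x where qx: "q \<in> {hone, vec4 0 1 0 0, vec4 0 0 1 0, vec4 0 0 0 1}" "x \<in> carrier (dihedral_group 3)"
    "h = q \<star> dihedral_lift r x \<or> h = - (q \<star> dihedral_lift r x)"
    using binary_octahedral_dihedral_cosets[OF gh(2)] by blast
  obtain g' where g': "g' \<in> binary_icosahedral" "g' \<star> dihedral_point r = dihedral_point r \<star> dihedral_lift r x"
    using dihedral_point_fixed[OF qx(2)] by blast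
  note lift = hnorm_binary(2)[OF dihedral_lift_binary_octahedral[OF qx(2)]]
  \<comment> \<open>Dividing (g, h) by the pair already known to fix the point leaves a fixing pair
    whose octahedral part is q up to sign. Only q = 1 survives.\<close>
  have "hcnj g' \<star> dihedral_point r = dihedral_point r \<star> hcnj (dihedral_lift r x)"
  proof -
    have "hcnj g' \<star> (g' \<star> dihedral_point r) \<star> hcnj (dihedral_lift r x) =
      hcnj g' \<star> (dihedral_point r \<star> dihedral_lift r x) \<star> hcnj (dihedral_lift r x)"
      by (simp add: g'(2))
    then show ?thesis
      by (simp add: hmul_hcnj_cancel[OF hnorm_binary(1)[OF g'(1)]] hmul_assoc[of "hcnj g'"]
          hmul_hcnj_cancel[OF lift])
  qed
  then have eq: "g \<star> hcnj g' \<star> dihedral_point r = dihedral_point r \<star> (h \<star> hcnj (dihedral_lift r x))"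
    using gh(3) by (metis hmul_assoc)
  have "h \<star> hcnj (dihedral_lift r x) = q \<or> h \<star> hcnj (dihedral_lift r x) = - q"
    using qx(3) by (auto simp: hmul_linear hmul_hcnj_cancel[OF lift])
  then have "g \<star> hcnj g' \<star> dihedral_point r = dihedral_point r \<star> q \<or>
      - (g \<star> hcnj g') \<star> dihedral_point r = dihedral_point r \<star> q"
    using eq by (auto simp: hmul_linear)
  moreover have "g \<star> hcnj g' \<in> binary_icosahedral" "- (g \<star> hcnj g') \<in> binary_icosahedral"
    using gh(1) g'(1) by (simp_all add: binary_closed)
  ultimately have "q \<notin> {vec4 0 1 0 0, vec4 0 0 1 0, vec4 0 0 0 1}"
    using dihedral_point_conj_axis by blast
  then have "q = hone" using qx(1) by blast
  then show "\<exists>x\<in>carrier (dihedral_group 3). h = dihedral_lift r x \<or> h = - dihedral_lift r x"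
    using qx by auto
qed (use dihedral_lift_binary_octahedral dihedral_point_fixed in auto)

end

section \<open>Directional derivatives of polynomial functions\<close>

definition D1 :: "(complex ^ 'n \<Rightarrow> complex) \<Rightarrow> complex ^ 'n \<Rightarrow> complex ^ 'n \<Rightarrow> complex" where
  "D1 F v w = deriv (\<lambda>t. F (v + t *s w)) 0"

definition D2 :: "(complex ^ 'n \<Rightarrow> complex) \<Rightarrow> complex ^ 'n \<Rightarrow> complex ^ 'n \<Rightarrow> complex ^ 'n \<Rightarrow> complex" where
  "D2 F v u w = deriv (\<lambda>s. deriv (\<lambda>t. F (v + s *s u + t *s w)) 0) 0"

definition lin :: "(complex ^ 'n \<Rightarrow> complex) \<Rightarrow> bool" where
  "lin L \<longleftrightarrow> (\<forall>x y. L (x + y) = L x + L y) \<and> (\<forall>c x. L (c *s x) = c * L x)"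

text \<open>Derivatives along single lines carry no linearity in the direction and no symmetry by
  themselves. Recording both along with the derivatives gives a notion that is closed under sums and
  products and so reaches all polynomials.\<close>

definition jet :: "(complex ^ 'n \<Rightarrow> complex) \<Rightarrow> (complex ^ 'n \<Rightarrow> complex ^ 'n \<Rightarrow> complex) \<Rightarrow>
    (complex ^ 'n \<Rightarrow> complex ^ 'n \<Rightarrow> complex ^ 'n \<Rightarrow> complex) \<Rightarrow> bool" where
  "jet F G H \<longleftrightarrow>
    (\<forall>v w. ((\<lambda>t. F (v + t *s w)) has_field_derivative G v w) (at 0)) \<and>
    (\<forall>v u w. ((\<lambda>t. G (v + t *s u) w) has_field_derivative H v u w) (at 0)) \<and>
    (\<forall>v. lin (G v)) \<and> (\<forall>v u. lin (H v u)) \<and> (\<forall>v u w. H v u w = H v w u)"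

definition smooth2 :: "(complex ^ 'n \<Rightarrow> complex) \<Rightarrow> bool" where
  "smooth2 F \<longleftrightarrow> (\<exists>G H. jet F G H)"

lemma jet_D1: "jet F G H \<Longrightarrow> D1 F v w = G v w"
  by (simp add: jet_def D1_def DERIV_imp_deriv)

lemma jet_D2: "jet F G H \<Longrightarrow> D2 F v u w = H v u w"
proof -
  assume j: "jet F G H"
  have "deriv (\<lambda>t. F (v + s *s u + t *s w)) 0 = G (v + s *s u) w" for s
    using jet_D1[OF j] by (simp add: D1_def)
  then have "D2 F v u w = deriv (\<lambda>s. G (v + s *s u) w) 0" by (simp only: D2_def)
  also have "\<dots> = H v u w" using j by (intro DERIV_imp_deriv) (simp add: jet_def)
  finally show ?thesis .
qed

lemma smooth2_const: "smooth2 (\<lambda>x. c)"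
proof -
  have "jet (\<lambda>x. c) (\<lambda>v w. 0) (\<lambda>v u w. 0)" by (simp add: jet_def lin_def)
  then show ?thesis by (auto simp: smooth2_def)
qed

lemma smooth2_nth: "smooth2 (\<lambda>x. x $ i)" for i :: "'n::finite"
proof -
  have "((\<lambda>t. v $ i + t * w $ i) has_field_derivative w $ i) (at 0)" for v w :: "complex ^ 'n"
    by (auto intro!: derivative_eq_intros)
  then have "jet (\<lambda>x. x $ i) (\<lambda>v w. w $ i) (\<lambda>v u w. 0)" by (simp add: jet_def lin_def)
  then show ?thesis by (auto simp: smooth2_def)
qed

lemma smooth2_add:
  assumes "smooth2 F" "smooth2 F'" shows "smooth2 (\<lambda>x. F x + F' x)"
proof -
  obtain G H G' H' where "jet F G H" "jet F' G' H'" using assms by (auto simp: smooth2_def)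
  then have "jet (\<lambda>x. F x + F' x) (\<lambda>v w. G v w + G' v w) (\<lambda>v u w. H v u w + H' v u w)"
    unfolding jet_def by (intro conjI allI DERIV_add) (simp_all add: lin_def algebra_simps)
  then show ?thesis by (auto simp: smooth2_def)
qed

lemma smooth2_mult:
  assumes "smooth2 F" "smooth2 F'" shows "smooth2 (\<lambda>x. F x * F' x)"
proof -
  obtain G H G' H' where j: "jet F G H" "jet F' G' H'" using assms by (auto simp: smooth2_def)
  have d: "((\<lambda>t. F (v + t *s w)) has_field_derivative G v w) (at 0)"
    "((\<lambda>t. F' (v + t *s w)) has_field_derivative G' v w) (at 0)"
    "((\<lambda>t. G (v + t *s u) w) has_field_derivative H v u w) (at 0)"
    "((\<lambda>t. G' (v + t *s u) w) has_field_derivative H' v u w) (at 0)" for v u w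
    using j by (auto simp: jet_def)
  have sym: "H v u w = H v w u" "H' v u w = H' v w u" for v u w
    using j by (auto simp: jet_def)
  have l: "G v (x + y) = G v x + G v y" "G v (c *s x) = c * G v x"
    "G' v (x + y) = G' v x + G' v y" "G' v (c *s x) = c * G' v x"
    "H v u (x + y) = H v u x + H v u y" "H v u (c *s x) = c * H v u x"
    "H' v u (x + y) = H' v u x + H' v u y" "H' v u (c *s x) = c * H' v u x" for v u x y c
    using j by (simp_all add: jet_def lin_def)
  have "jet (\<lambda>x. F x * F' x) (\<lambda>v w. G v w * F' v + F v * G' v w)
    (\<lambda>v u w. H v u w * F' v + G v w * G' v u + (G v u * G' v w + F v * H' v u w))"
    unfolding jet_def
  proof (intro conjI allI)
    show "((\<lambda>t. F (v + t *s w) * F' (v + t *s w)) has_field_derivative G v w * F' v + F v * G' v w) (at 0)" for v w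
      using DERIV_mult[OF d(1,2), of v w v w] by (simp add: algebra_simps)
    show "((\<lambda>t. G (v + t *s u) w * F' (v + t *s u) + F (v + t *s u) * G' (v + t *s u) w) has_field_derivative
      H v u w * F' v + G v w * G' v u + (G v u * G' v w + F v * H' v u w)) (at 0)" for v u w
      using DERIV_add[OF DERIV_mult[OF d(3)[of v u w] d(2)[of v u]] DERIV_mult[OF d(1)[of v u] d(4)[of v u w]]]
      by (simp add: algebra_simps)
    show "lin (\<lambda>w. G v w * F' v + F v * G' v w)"
      "lin (\<lambda>w. H v u w * F' v + G v w * G' v u + (G v u * G' v w + F v * H' v u w))" for v u
      unfolding lin_def by (simp_all add: l algebra_simps)
    show "H v u w * F' v + G v w * G' v u + (G v u * G' v w + F v * H' v u w) =
      H v w u * F' v + G v u * G' v w + (G v w * G' v u + F v * H' v w u)" for v u w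
      unfolding sym(1)[of v u w] sym(2)[of v u w] by (simp add: algebra_simps)
  qed
  then show ?thesis by (auto simp: smooth2_def)
qed

lemma smooth2_sum: "finite A \<Longrightarrow> (\<And>a. a \<in> A \<Longrightarrow> smooth2 (f a)) \<Longrightarrow> smooth2 (\<lambda>x. \<Sum>a\<in>A. f a x)"
  by (induction A rule: finite_induct) (auto intro: smooth2_const smooth2_add)

lemma smooth2_prod: "finite A \<Longrightarrow> (\<And>a. a \<in> A \<Longrightarrow> smooth2 (f a)) \<Longrightarrow> smooth2 (\<lambda>x. \<Prod>a\<in>A. f a x)"
  by (induction A rule: finite_induct) (auto intro: smooth2_const smooth2_mult)

lemma smooth2_power: "smooth2 f \<Longrightarrow> smooth2 (\<lambda>x. f x ^ n)"
  by (induction n) (auto intro: smooth2_const smooth2_mult)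

lemma smooth2_homogeneous_polys: "F \<in> homogeneous_polys d \<Longrightarrow> smooth2 F"
proof -
  assume "F \<in> homogeneous_polys d"
  then obtain a where "F = (\<lambda>x. \<Sum>e\<in>exponents d. a e * (\<Prod>i\<in>UNIV. x $ i ^ e i))"
    by (auto simp: homogeneous_polys_def)
  then show ?thesis
    by (auto intro!: smooth2_sum smooth2_mult smooth2_const smooth2_prod smooth2_power smooth2_nth finite_exponents)
qed

lemma smooth2_differentiable: "smooth2 F \<Longrightarrow> (\<lambda>t. F (v + t *s w)) field_differentiable at 0"
  by (auto simp: smooth2_def jet_def field_differentiable_def)

lemma
  assumes "smooth2 F"
  shows D1_lin: "D1 F v (x + y) = D1 F v x + D1 F v y" "D1 F v (c *s x) = c * D1 F v x"
    and D2_lin: "D2 F v u (x + y) = D2 F v u x + D2 F v u y" "D2 F v u (c *s x) = c * D2 F v u x"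
    and D2_sym: "D2 F v u w = D2 F v w u"
proof -
  obtain G H where j: "jet F G H" using assms by (auto simp: smooth2_def)
  then have *: "lin (G v)" "lin (H v u)" "H v u w = H v w u" by (auto simp: jet_def)
  then show "D1 F v (x + y) = D1 F v x + D1 F v y" "D1 F v (c *s x) = c * D1 F v x"
    "D2 F v u (x + y) = D2 F v u x + D2 F v u y" "D2 F v u (c *s x) = c * D2 F v u x"
    "D2 F v u w = D2 F v w u"
    by (simp_all add: jet_D1[OF j] jet_D2[OF j] lin_def)
qed

lemma D2_lin':
  assumes "smooth2 F"
  shows "D2 F v (x + y) u = D2 F v x u + D2 F v y u" "D2 F v (c *s x) u = c * D2 F v x u"
  using D2_lin[OF assms, of v u] D2_sym[OF assms, of v] by metis+

text \<open>On the line through v the function is the polynomial p, so the repeated derivative is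
  p''(0). Second derivatives are thereby read off as coefficients.\<close>

lemma D2_eq_poly:
  assumes "\<And>t. F (v + t *s w) = poly p t"
  shows "D2 F v w w = 2 * coeff p 2"
proof -
  have "F (v + s *s w + t *s w) = poly p (s + t)" for s t
    using assms[of "s + t"] by (simp add: vec.scale_left_distrib add.assoc)
  moreover have "deriv (\<lambda>t. poly p (s + t)) 0 = poly (pderiv p) s" for s
    using DERIV_chain2[of "poly p" "poly (pderiv p) s" "\<lambda>t. s + t" 0 1 UNIV] poly_DERIV[of p s]
    by (intro DERIV_imp_deriv) (auto intro!: derivative_eq_intros)
  ultimately have "D2 F v w w = deriv (poly (pderiv p)) 0"
    by (simp only: D2_def)
  then show ?thesis
    by (simp add: DERIV_imp_deriv[OF poly_DERIV] poly_0_coeff_0 coeff_pderiv numeral_2_eq_2)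
qed

section \<open>Nodes of homogeneous surfaces\<close>

text \<open>The chart-free form of an ordinary double point: the Hessian form at a singular point
  \<open>v\<close> has no kernel besides the line through \<open>v\<close>, which Euler's relation puts there.\<close>

definition cone_node :: "(complex ^ 4 \<Rightarrow> complex) \<Rightarrow> complex ^ 4 \<Rightarrow> bool" where
  "cone_node F v \<longleftrightarrow> F v = 0 \<and> (\<forall>w. D1 F v w = 0) \<and>
    (\<forall>w. (\<forall>u. D2 F v u w = 0) \<longrightarrow> w \<in> vec.span {v})"

lemma homogeneous_polys_scale: "F \<in> homogeneous_polys d \<Longrightarrow> F (c *s x) = c ^ d * F x"
proof -
  assume "F \<in> homogeneous_polys d"
  then obtain a where F: "F = (\<lambda>x. \<Sum>e\<in>exponents d. a e * (\<Prod>i\<in>UNIV. x $ i ^ e i))"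
    by (auto simp: homogeneous_polys_def)
  have "(\<Prod>i\<in>UNIV. (c * x $ i) ^ e i) = c ^ d * (\<Prod>i\<in>UNIV. x $ i ^ e i)" if "e \<in> exponents d" for e
    using that by (simp add: exponents_def power_mult_distrib prod.distrib flip: power_sum)
  then show ?thesis by (simp add: F sum_distrib_left algebra_simps)
qed

lemma D_scale:
  assumes F: "F \<in> homogeneous_polys d" and "c \<noteq> 0"
  shows "D1 F (c *s v) w = c ^ d * D1 F v ((1 / c) *s w)"
    and "D2 F (c *s v) u w = c ^ d * D2 F v ((1 / c) *s u) ((1 / c) *s w)"
proof -
  note sm = smooth2_homogeneous_polys[OF F]
  have eq: "F (c *s v + t *s w) = c ^ d * F (v + t *s ((1 / c) *s w))" for t v w
    unfolding homogeneous_polys_scale[OF F, symmetric] using \<open>c \<noteq> 0\<close>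
    by (simp add: vec.scale_right_distrib vector_smult_assoc)
  show D1: "D1 F (c *s v) w = c ^ d * D1 F v ((1 / c) *s w)" for v w
    unfolding D1_def eq by (rule deriv_cmult[OF smooth2_differentiable[OF sm]])
  have "D1 F (c *s v + s *s u) w = c ^ d * D1 F (v + s *s ((1 / c) *s u)) ((1 / c) *s w)" for s
  proof -
    have "c *s v + s *s u = c *s (v + s *s ((1 / c) *s u))"
      using \<open>c \<noteq> 0\<close> by (simp add: vec.scale_right_distrib vector_smult_assoc)
    then show ?thesis by (simp only: D1)
  qed
  then have "D2 F (c *s v) u w = deriv (\<lambda>s. c ^ d * D1 F (v + s *s ((1 / c) *s u)) ((1 / c) *s w)) 0"
    by (simp only: D2_def flip: D1_def)
  also have "\<dots> = c ^ d * deriv (\<lambda>s. D1 F (v + s *s ((1 / c) *s u)) ((1 / c) *s w)) 0"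
  proof (rule deriv_cmult)
    obtain G H where j: "jet F G H" using sm by (auto simp: smooth2_def)
    then have "((\<lambda>s. G (v + s *s x) y) has_field_derivative H v x y) (at 0)" for x y
      by (simp add: jet_def)
    then show "(\<lambda>s. D1 F (v + s *s ((1 / c) *s u)) ((1 / c) *s w)) field_differentiable at 0"
      unfolding jet_D1[OF j] field_differentiable_def by blast
  qed
  finally show "D2 F (c *s v) u w = c ^ d * D2 F v ((1 / c) *s u) ((1 / c) *s w)"
    by (simp only: D2_def D1_def)
qed

text \<open>By homogeneity a gradient vanishing at v vanishes along the whole line through v, so its
  derivative in the direction v is zero.\<close>

lemma euler_D2:
  assumes F: "F \<in> homogeneous_polys d" and "\<And>w. D1 F v w = 0"
  shows "D2 F v v w = 0"
proof -
  \<comment> \<open>The scaling rule needs a nonzero factor 1 + s; a ball around 0 ensures this, and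
    \<open>deriv\<close> only depends on a neighbourhood.\<close>
  have "D1 F (v + s *s v) w = 0" if "s \<in> ball 0 1" for s
  proof -
    have "1 + s \<noteq> 0"
    proof
      assume "1 + s = 0"
      then have "s = - 1" by (simp add: add_eq_0_iff)
      then show False using that by simp
    qed
    then show ?thesis
      using D_scale(1)[OF F, of "1 + s" v w] assms(2) by (simp add: vec.scale_left_distrib)
  qed
  then have "eventually (\<lambda>s. D1 F (v + s *s v) w = 0) (nhds 0)"
    by (metis (mono_tags, lifting) centre_in_ball eventually_nhds open_ball zero_less_one)
  then have "deriv (\<lambda>s. D1 F (v + s *s v) w) 0 = deriv (\<lambda>s. 0) 0"
    by (intro deriv_cong_ev refl)
  then show ?thesis by (simp only: D2_def D1_def deriv_const)
qed

lemma cone_node_scale: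
  assumes F: "F \<in> homogeneous_polys d" and "c \<noteq> 0" "cone_node F v"
  shows "cone_node F (c *s v)"
proof -
  have "w \<in> vec.span {c *s v}" if "\<forall>u. D2 F (c *s v) u w = 0" for w
  proof -
    have "D2 F v u ((1 / c) *s w) = 0" for u
      using that[rule_format, of "c *s u"] \<open>c \<noteq> 0\<close> by (simp add: D_scale[OF F] vector_smult_assoc)
    then have "(1 / c) *s w \<in> vec.span {v}" using assms(3) by (auto simp: cone_node_def)
    then obtain b where "(1 / c) *s w = b *s v" by (auto simp: span_single)
    then have "w = b *s (c *s v)"
      using \<open>c \<noteq> 0\<close> by (metis (no_types) mult.commute nonzero_eq_divide_eq vector_smult_assoc vector_smult_lid)
    then show ?thesis by (auto simp: span_single)
  qed
  then show ?thesis
    using assms by (auto simp: cone_node_def homogeneous_polys_scale D_scale)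
qed

lemma cone_node_transfer:
  assumes inv: "\<And>x. F (cact g h x) = F x" and gh: "hnorm g = 1" "hnorm h = 1" and "cone_node F v"
  shows "cone_node F (cact g h v)"
proof -
  have eqs: "D1 F (cact g h v) (cact g h w) = D1 F v w"
    "D2 F (cact g h v) (cact g h u) (cact g h w) = D2 F v u w" for u w
    by (simp_all add: D1_def D2_def inv flip: cact_linear)
  have "w \<in> vec.span {cact g h v}" if "\<forall>u. D2 F (cact g h v) u w = 0" for w
  proof -
    have "D2 F v u (cact (hcnj g) (hcnj h) w) = 0" for u
      using that eqs(2)[of u "cact (hcnj g) (hcnj h) w"] by (simp add: cact_inverse gh)
    then have "cact (hcnj g) (hcnj h) w \<in> vec.span {v}" using assms(4) by (auto simp: cone_node_def)
    then obtain b where "cact (hcnj g) (hcnj h) w = b *s v" by (auto simp: span_single)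
    then have "w = b *s cact g h v" by (metis cact_inverse(2)[OF gh] cact_linear(2))
    then show ?thesis by (auto simp: span_single)
  qed
  moreover have "D1 F (cact g h v) w = 0" for w
    using eqs(1)[of "cact (hcnj g) (hcnj h) w"] assms(4) by (simp add: cact_inverse gh cone_node_def)
  ultimately show ?thesis using assms(4) by (simp add: cone_node_def inv)
qed

section \<open>Comparison with the affine charts\<close>

lemma forall_index3: "(\<forall>i::3. P i) \<longleftrightarrow> P 1 \<and> P 2 \<and> P 3"
  by (rule forall_3)

definition chart_lin :: "4 \<Rightarrow> complex ^ 3 \<Rightarrow> complex ^ 4" where
  "chart_lin k z = chart k z - chart k 0"

lemma chart_add: "chart k (y + z) = chart k y + chart_lin k z"
  by (simp add: chart_lin_def chart_def vec_eq_iff4)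

lemma chart_lin_linear:
  "chart_lin k (x + y) = chart_lin k x + chart_lin k y" "chart_lin k (c *s x) = c *s chart_lin k x"
  by (simp_all add: chart_lin_def chart_def vec_eq_iff4 algebra_simps)

lemma chart_lin_axis_sum: "chart_lin k z = (\<Sum>i\<in>UNIV. z $ i *s chart_lin k (axis i 1))"
  by (simp add: sum_3 chart_lin_def chart_def vec_eq_iff4 axis_def)

lemma chart_lin_nth: "chart_lin k z $ k = 0"
proof -
  have "\<forall>k. chart_lin k z $ k = 0"
    unfolding forall_index4 by (simp add: chart_lin_def chart_def)
  then show ?thesis by blast
qed

lemma chart_lin_eq_0: "chart_lin k z = 0 \<Longrightarrow> z = 0"
  by (auto simp: chart_lin_def chart_def vec_eq_iff4 vec_eq_iff forall_index3 split: if_splits)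

lemma chart_surj:
  assumes "a $ k = 1" shows "\<exists>y. chart k y = a"
proof -
  have "\<forall>k. a $ k = 1 \<longrightarrow> (\<exists>y. chart k y = a)"
    unfolding forall_index4
  proof (intro conjI impI)
    let ?v = "\<lambda>b c d. (\<chi> i::3. if i = 1 then b else if i = 2 then c else d)"
    show "\<exists>y. chart 0 y = a" if "a $ 0 = 1"
      using that by (intro exI[of _ "?v (a$1) (a$2) (a$3)"]) (simp add: chart_def vec_eq_iff4)
    show "\<exists>y. chart 1 y = a" if "a $ 1 = 1"
      using that by (intro exI[of _ "?v (a$0) (a$2) (a$3)"]) (simp add: chart_def vec_eq_iff4)
    show "\<exists>y. chart 2 y = a" if "a $ 2 = 1"
      using that by (intro exI[of _ "?v (a$0) (a$1) (a$3)"]) (simp add: chart_def vec_eq_iff4)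
    show "\<exists>y. chart 3 y = a" if "a $ 3 = 1"
      using that by (intro exI[of _ "?v (a$0) (a$1) (a$2)"]) (simp add: chart_def vec_eq_iff4)
  qed
  then show ?thesis using assms by blast
qed

lemma chart_lin_surj:
  assumes "a $ k = 0" shows "\<exists>z. chart_lin k z = a"
proof -
  have "(a + chart k 0) $ k = 1"
  proof -
    have "\<forall>k. chart k 0 $ k = 1" unfolding forall_index4 by (simp add: chart_def)
    then show ?thesis using assms by simp
  qed
  then obtain y where "chart k y = a + chart k 0" using chart_surj by blast
  then show ?thesis by (intro exI[of _ y]) (simp add: chart_lin_def)
qed

lemma partial_deriv_chart: "partial_deriv i (\<lambda>z. F (chart k z)) y = D1 F (chart k y) (chart_lin k (axis i 1))"
  by (simp add: partial_deriv_def D1_def chart_add chart_lin_linear)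

lemma hessian_chart:
  "hessian (\<lambda>z. F (chart k z)) y $ i $ j = D2 F (chart k y) (chart_lin k (axis i 1)) (chart_lin k (axis j 1))"
  by (simp add: hessian_def partial_deriv_def D2_def chart_add chart_lin_linear add.assoc)

text \<open>A kernel vector of the chart Hessian gives a vector w in the hyperplane of vanishing
  k-th coordinate. It is orthogonal to that hyperplane for the Hessian form, and to a by Euler's
  relation, hence to everything. So w is a multiple of a, and since the k-th coordinate of a is 1, w
  is zero.\<close>

lemma cone_node_is_node:
  assumes F: "F \<in> homogeneous_polys d" and v: "cone_node F v" "v \<noteq> 0"
  shows "is_node F (vec.span {v})"
proof -
  note sm = smooth2_homogeneous_polys[OF F]
  obtain k where k: "v $ k \<noteq> 0" using v(2) by (auto simp: vec_eq_iff)
  define a where "a = (1 / v $ k) *s v"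
  have a: "cone_node F a" unfolding a_def using k by (intro cone_node_scale[OF F _ v(1)]) simp
  have ak: "a $ k = 1" using k by (simp add: a_def)
  obtain y where y: "chart k y = a" using chart_surj[OF ak] by blast
  have mem: "a \<in> vec.span {v}" by (auto simp: a_def span_single)
  let ?H = "hessian (\<lambda>z. F (chart k z)) y"
  have "z = 0" if z: "?H *v z = 0" for z
  proof -
    let ?w = "chart_lin k z"
    have lin_sum: "D2 F a u (\<Sum>i\<in>A. f i) = (\<Sum>i\<in>A. D2 F a u (f i))" if "finite A" for u A and f :: "3 \<Rightarrow> complex ^ 4"
      using that D2_lin(2)[OF sm, of a u 0 0] by induction (simp_all add: D2_lin(1)[OF sm])
    have *: "D2 F a (chart_lin k (axis i 1)) ?w = 0" for i
    proof -
      have "D2 F a (chart_lin k (axis i 1)) ?w = (\<Sum>j\<in>UNIV. z $ j * ?H $ i $ j)"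
        by (subst chart_lin_axis_sum) (simp add: lin_sum D2_lin(2)[OF sm] hessian_chart y)
      also have "\<dots> = (?H *v z) $ i" by (simp add: matrix_vector_mult_def mult.commute)
      finally show ?thesis using z by simp
    qed
    have *: "D2 F a ?w (chart_lin k (axis i 1)) = 0" for i
      using *[of i] D2_sym[OF sm] by simp
    have "D2 F a u ?w = 0" for u
    proof -
      \<comment> \<open>The splitting of the whole space into the line of a and the hyperplane
        parallel to the chart.\<close>
      have "(u - (u $ k) *s a) $ k = 0" using ak by simp
      then obtain x where "chart_lin k x = u - (u $ k) *s a" using chart_lin_surj by blast
      then have u: "u = (u $ k) *s a + chart_lin k x" by simp
      have "D2 F a ?w (chart_lin k x) = 0"
        by (subst chart_lin_axis_sum[of k x]) (simp add: lin_sum D2_lin(2)[OF sm] *)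
      moreover have "D2 F a a ?w = 0" using a by (intro euler_D2[OF F]) (simp add: cone_node_def)
      ultimately show ?thesis
        by (subst u) (simp add: D2_lin'[OF sm] D2_sym[OF sm, of a "chart_lin k x"])
    qed
    then have "?w \<in> vec.span {a}" using a by (auto simp: cone_node_def)
    then obtain c where c: "?w = c *s a" by (auto simp: span_single)
    then have "c = 0" using ak chart_lin_nth[of k z] by simp
    then show "z = 0" using c chart_lin_eq_0 by simp
  qed
  then have "invertible ?H"
    using matrix_left_invertible_ker[of ?H] invertible_left_inverse[of ?H] by blast
  then have "det ?H \<noteq> 0" by (simp add: invertible_det_nz)
  then have "ordinary_double_point (\<lambda>z. F (chart k z)) y"
    using a by (simp add: ordinary_double_point_def partial_deriv_chart y cone_node_def)
  then show ?thesis
    unfolding is_node_def P3_def using v(2) mem y by auto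
qed

section \<open>Homogeneous polynomials\<close>

lemma homogeneous_polysI:
  "(\<And>x. P x = (\<Sum>e\<in>exponents d. a e * (\<Prod>i\<in>UNIV. x $ i ^ e i))) \<Longrightarrow> P \<in> homogeneous_polys d"
  unfolding homogeneous_polys_def by blast

lemma homogeneous_polys_add:
  assumes "P \<in> homogeneous_polys d" "Q \<in> homogeneous_polys d"
  shows "(\<lambda>x. P x + Q x) \<in> homogeneous_polys d"
proof -
  obtain a b where "\<And>x. P x = (\<Sum>e\<in>exponents d. a e * (\<Prod>i\<in>UNIV. x $ i ^ e i))"
    "\<And>x. Q x = (\<Sum>e\<in>exponents d. b e * (\<Prod>i\<in>UNIV. x $ i ^ e i))"
    using assms by (auto simp: homogeneous_polys_def)
  then show ?thesis
    by (intro homogeneous_polysI[where a = "\<lambda>e. a e + b e"]) (simp add: distrib_right sum.distrib)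
qed

lemma homogeneous_polys_const: "(\<lambda>x. c) \<in> homogeneous_polys 0"
proof -
  have "exponents 0 = {\<lambda>i. 0}" by (auto simp: exponents_def)
  then show ?thesis by (intro homogeneous_polysI[where a = "\<lambda>e. c"]) simp
qed

lemma homogeneous_polys_nth: "(\<lambda>x. x $ i) \<in> homogeneous_polys 1"
proof (rule homogeneous_polysI)
  fix x :: "complex ^ 4"
  let ?d = "\<lambda>j. if j = i then 1 else 0 :: nat"
  have "?d \<in> exponents 1" by (simp add: exponents_def)
  moreover have "(\<Prod>j\<in>UNIV. x $ j ^ ?d j) = (\<Prod>j\<in>UNIV. if j = i then x $ j else 1)"
    by (intro prod.cong) auto
  ultimately show "x $ i = (\<Sum>e\<in>exponents 1. (if e = ?d then 1 else 0) * (\<Prod>j\<in>UNIV. x $ j ^ e j))"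
    using finite_exponents[of 1] by (simp add: if_distrib[of "\<lambda>c. c * _"] cong: if_cong)
qed

lemma homogeneous_polys_mult:
  assumes "P \<in> homogeneous_polys d" "Q \<in> homogeneous_polys d'"
  shows "(\<lambda>x. P x * Q x) \<in> homogeneous_polys (d + d')"
proof -
  obtain a b where P: "\<And>x. P x = (\<Sum>e\<in>exponents d. a e * (\<Prod>i\<in>UNIV. x $ i ^ e i))"
    and Q: "\<And>x. Q x = (\<Sum>e\<in>exponents d'. b e * (\<Prod>i\<in>UNIV. x $ i ^ e i))"
    using assms by (auto simp: homogeneous_polys_def)
  let ?E = "exponents d \<times> exponents d'" and ?g = "\<lambda>(e, f) i. e i + f i"
  let ?c = "\<lambda>g. \<Sum>(e, f)\<in>{p \<in> ?E. ?g p = g}. a e * b f"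
  show ?thesis
  proof (rule homogeneous_polysI)
    fix x
    let ?h = "\<lambda>(e, f). a e * b f * (\<Prod>i\<in>UNIV. x $ i ^ (e i + f i))"
    have "P x * Q x = (\<Sum>p\<in>?E. ?h p)"
      unfolding P Q sum_product sum.cartesian_product
      by (intro sum.cong) (auto simp: power_add prod.distrib)
    also have "\<dots> = (\<Sum>g\<in>exponents (d + d'). \<Sum>p\<in>{p \<in> ?E. ?g p = g}. ?h p)"
      by (intro sum.group[symmetric] finite_cartesian_product finite_exponents)
        (auto simp: exponents_def sum.distrib)
    also have "\<dots> = (\<Sum>g\<in>exponents (d + d'). ?c g * (\<Prod>i\<in>UNIV. x $ i ^ g i))"
      unfolding sum_distrib_right by (intro sum.cong) auto
    finally show "P x * Q x = (\<Sum>g\<in>exponents (d + d'). ?c g * (\<Prod>i\<in>UNIV. x $ i ^ g i))" .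
  qed
qed

lemma homogeneous_polys_cmult: "P \<in> homogeneous_polys d \<Longrightarrow> (\<lambda>x. c * P x) \<in> homogeneous_polys d"
  using homogeneous_polys_mult[OF homogeneous_polys_const] by simp

lemma homogeneous_polys_diff:
  "P \<in> homogeneous_polys d \<Longrightarrow> Q \<in> homogeneous_polys d \<Longrightarrow> (\<lambda>x. P x - Q x) \<in> homogeneous_polys d"
  using homogeneous_polys_add[OF _ homogeneous_polys_cmult[of Q d "- 1"]] by simp

lemma homogeneous_polys_power: "P \<in> homogeneous_polys d \<Longrightarrow> (\<lambda>x. P x ^ n) \<in> homogeneous_polys (n * d)"
  by (induction n) (auto intro: homogeneous_polys_mult homogeneous_polys_const)

lemma homogeneous_polys_hmul:
  assumes "\<And>n. (\<lambda>x. f x $ n) \<in> homogeneous_polys d" "\<And>n. (\<lambda>x. g x $ n) \<in> homogeneous_polys d'"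
  shows "(\<lambda>x. (f x \<star> g x) $ n) \<in> homogeneous_polys (d + d')"
proof -
  have "\<forall>n. (\<lambda>x. (f x \<star> g x) $ n) \<in> homogeneous_polys (d + d')"
    unfolding forall_index4 hmul_def vec4_nth
    by (intro conjI homogeneous_polys_add homogeneous_polys_diff homogeneous_polys_mult assms)
  then show ?thesis by blast
qed

lemma homogeneous_polys_hcnj:
  assumes "\<And>n. (\<lambda>x. f x $ n) \<in> homogeneous_polys d"
  shows "(\<lambda>x. hcnj (f x) $ n) \<in> homogeneous_polys d"
proof -
  have "(\<lambda>x. - (f x $ n)) \<in> homogeneous_polys d" for n
    using homogeneous_polys_cmult[OF assms[of n], of "- 1"] by simp
  then have "\<forall>n. (\<lambda>x. hcnj (f x) $ n) \<in> homogeneous_polys d"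
    unfolding forall_index4 hcnj_def vec4_nth using assms by blast
  then show ?thesis by blast
qed

section \<open>The invariant of degree twelve\<close>

text \<open>The product of the six linear forms on the imaginary quaternions that vanish on the planes
  orthogonal to the five-fold axes of the icosahedron.\<close>

definition ico_form :: "complex ^ 4 \<Rightarrow> complex" where
  "ico_form z = (let t = complex_of_real tau; x = z$1; y = z$2; w = z$3 in
     (y\<^sup>2 - t\<^sup>2 * w\<^sup>2) * (w\<^sup>2 - t\<^sup>2 * x\<^sup>2) * (x\<^sup>2 - t\<^sup>2 * y\<^sup>2))"

text \<open>Without the inverse of x the expression stays a quadratic polynomial in x, defined at
  null vectors as well. For x of nonzero norm it is \<open>hnorm x\<close> times a rotation of
  b.\<close>

definition rot :: "complex ^ 4 \<Rightarrow> complex ^ 4 \<Rightarrow> complex ^ 4" where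
  "rot x b = x \<star> b \<star> hcnj x"

text \<open>The constant is \<open>1 / (2 tau^3)\<close>.\<close>

definition frame_form :: "complex ^ 4 \<Rightarrow> complex" where
  "frame_form x = (complex_of_real tau - 3/2) *
    (ico_form (rot x (vec4 0 1 0 0)) + ico_form (rot x (vec4 0 0 1 0)) + ico_form (rot x (vec4 0 0 0 1)))"

lemma ctau_mult: "complex_of_real tau * complex_of_real tau = complex_of_real tau + 1"
  using arg_cong[OF tau_mult, of complex_of_real] by simp

lemma ctau_mult_left: "complex_of_real tau * (complex_of_real tau * x) = complex_of_real tau * x + x"
  using ctau_mult by (metis distrib_right mult.assoc mult_1)

lemma rot_nth_homogeneous: "(\<lambda>x. rot x b $ n) \<in> homogeneous_polys 2"
proof -
  have "(\<lambda>x. (x \<star> b \<star> hcnj x) $ n) \<in> homogeneous_polys (1 + 0 + 1)"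
    by (intro homogeneous_polys_hmul homogeneous_polys_hcnj homogeneous_polys_nth homogeneous_polys_const)
  then show ?thesis by (simp add: rot_def numeral_2_eq_2)
qed

lemma frame_form_homogeneous: "frame_form \<in> homogeneous_polys 12"
proof -
  have sq: "(\<lambda>x. (rot x b $ n)\<^sup>2) \<in> homogeneous_polys 4" for b n
    using homogeneous_polys_power[OF rot_nth_homogeneous, of b n 2] by simp
  have *: "(\<lambda>x. (rot x b $ k)\<^sup>2 - (complex_of_real tau)\<^sup>2 * (rot x b $ l)\<^sup>2) \<in> homogeneous_polys 4" for b k l
    by (intro homogeneous_polys_diff homogeneous_polys_cmult sq)
  have "(\<lambda>x. ico_form (rot x b)) \<in> homogeneous_polys (4 + 4 + 4)" for b
    unfolding ico_form_def Let_def by (intro homogeneous_polys_mult *)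
  then have "(\<lambda>x. ico_form (rot x b)) \<in> homogeneous_polys 12" for b by simp
  then show ?thesis
    unfolding frame_form_def [abs_def] by (intro homogeneous_polys_cmult homogeneous_polys_add)
qed

lemma generate_induct_units:
  assumes g: "g \<in> generate SU2 H" and H: "H \<subseteq> carrier SU2"
    and one: "Q hone" and mult: "\<And>g h. hnorm g = 1 \<Longrightarrow> hnorm h = 1 \<Longrightarrow> Q g \<Longrightarrow> Q h \<Longrightarrow> Q (g \<star> h)"
    and gen: "\<And>h. h \<in> H \<Longrightarrow> Q h" and inv: "\<And>h. h \<in> H \<Longrightarrow> Q (hcnj h)"
  shows "Q g"
proof -
  have "hnorm g = 1 \<and> Q g"
    using g
  proof induction
    case (inv h)
    then have "hnorm h = 1" using H by (auto simp: carrier_SU2)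
    then show ?case using inv assms(6) by (simp add: inv_SU2)
  qed (use H one mult gen in \<open>auto simp: carrier_SU2 hnorm_hmul\<close>)
  then show ?thesis ..
qed

text \<open>The generators permute the six linear factors up to sign with an even number of sign
  changes. The set of such unit quaternions is closed under products and inverses.\<close>

lemma ico_form_invariant:
  assumes "g \<in> binary_icosahedral" "z $ 0 = 0"
  shows "ico_form (rot (cvec g) z) = ico_form z"
proof -
  define Q where "Q g \<longleftrightarrow> (\<forall>z. z $ 0 = 0 \<longrightarrow> ico_form (rot (cvec g) z) = ico_form z)" for g
  have rot0: "rot x z $ 0 = 0" if "z $ 0 = 0" for x z
    using that by (simp add: rot_def hmul_def hcnj_def algebra_simps)
  have inverse: "Q (hcnj h)" if Q: "Q h" and h: "hnorm h = 1" for h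
    unfolding Q_def
  proof (intro allI impI)
    fix z :: "complex ^ 4" assume z: "z $ 0 = 0"
    have "hnorm (cvec h) = 1" using h by (simp add: cvec_hom)
    then have "rot (cvec h) (rot (cvec (hcnj h)) z) = z"
      by (simp add: rot_def cvec_hom hmul_assoc hmul_hcnj hmul_hcnj_cancel)
    then show "ico_form (rot (cvec (hcnj h)) z) = ico_form z"
      using Q rot0[OF z] unfolding Q_def by metis
  qed
  have gens: "Q quat_i" "Q quat_S" "Q quat_U"
  proof -
    have "ico_form (rot (cvec quat_i) (vec4 0 x y w)) = ico_form (vec4 0 x y w)"
      "ico_form (rot (cvec quat_S) (vec4 0 x y w)) = ico_form (vec4 0 x y w)"
      "ico_form (rot (cvec quat_U) (vec4 0 x y w)) = ico_form (vec4 0 x y w)" for x y w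
    proof -
      let ?t = "complex_of_real tau"
      have "rot (cvec quat_i) (vec4 0 x y w) = vec4 0 x (- y) (- w)"
        by (simp add: rot_def quat_i_def cvec_vec4)
      then show "ico_form (rot (cvec quat_i) (vec4 0 x y w)) = ico_form (vec4 0 x y w)"
        by (simp add: ico_form_def)
      have "rot (cvec quat_S) (vec4 0 x y w) = vec4 0 (- y) (- w) x"
        by (simp add: rot_def quat_S_def cvec_vec4 field_simps)
      then show "ico_form (rot (cvec quat_S) (vec4 0 x y w)) = ico_form (vec4 0 x y w)"
        by (simp add: ico_form_def Let_def ac_simps)
      have factor: "ico_form (vec4 0 x y w) =
        ((y - ?t * w) * (y + ?t * w)) * ((w - ?t * x) * (w + ?t * x)) * ((x - ?t * y) * (x + ?t * y))" for x y w
        by (simp add: ico_form_def Let_def power2_eq_square algebra_simps)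
      let ?X = "((?t - 1) * x - ?t * y + w) / 2" and ?Y = "(?t * x + y + (?t - 1) * w) / 2"
        and ?W = "((?t - 1) * y + ?t * w - x) / 2"
      have "rot (cvec quat_U) (vec4 0 x y w) = vec4 0 ?X ?Y ?W"
        by (simp add: rot_def quat_U_def cvec_vec4 field_simps ctau_mult ctau_mult_left)
      \<comment> \<open>The action of U on the six linear factors: four of them acquire a minus
        sign, so the product is unchanged.\<close>
      moreover have "?Y - ?t * ?W = - (w - ?t * x)" "?Y + ?t * ?W = y + ?t * w"
        "?W - ?t * ?X = - (x - ?t * y)" "?W + ?t * ?X = - (y - ?t * w)"
        "?X - ?t * ?Y = - (x + ?t * y)" "?X + ?t * ?Y = w + ?t * x"
        by (simp_all add: field_simps ctau_mult ctau_mult_left)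
      ultimately show "ico_form (rot (cvec quat_U) (vec4 0 x y w)) = ico_form (vec4 0 x y w)"
        by (simp only: factor mult_minus_left mult_minus_right minus_minus mult_ac)
    qed
    then show "Q quat_i" "Q quat_S" "Q quat_U"
      unfolding Q_def by (metis vec4_exhaust vec4_nth(1))+
  qed
  have "Q g"
    using assms(1) unfolding binary_icosahedral_def
  proof (rule generate_induct_units)
    show "{quat_i, quat_S, quat_U} \<subseteq> carrier SU2" using carrier_generators by simp
    show "Q hone" by (simp add: Q_def rot_def cvec_hom)
    fix g h assume "Q g" "Q h"
    moreover have "rot (cvec (g \<star> h)) z = rot (cvec g) (rot (cvec h) z)" for z
      by (simp add: rot_def cvec_hom hcnj_hmul hmul_assoc)
    ultimately show "Q (g \<star> h)" using rot0 by (simp add: Q_def)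
  next
    fix h assume "h \<in> {quat_i, quat_S, quat_U}"
    then show "Q h" "Q (hcnj h)"
      using gens inverse generators_in(1-3)[THEN hnorm_binary(1)] by auto
  qed
  then show ?thesis using assms(2) by (simp add: Q_def)
qed

text \<open>The octahedral group permutes the three coordinate axes up to sign, and an even function
  does not see the signs.\<close>

lemma octahedral_frame_sum:
  assumes "h \<in> binary_octahedral" and even: "\<And>z. \<psi> (- z) = \<psi> z"
  shows "\<psi> (rot (cvec h) (vec4 0 1 0 0)) + \<psi> (rot (cvec h) (vec4 0 0 1 0)) + \<psi> (rot (cvec h) (vec4 0 0 0 1)) =
    \<psi> (vec4 0 1 0 0) + \<psi> (vec4 0 0 1 0) + (\<psi> (vec4 0 0 0 1) :: complex)"
proof -
  define T where "T h \<psi> = \<psi> (rot (cvec h) (vec4 0 1 0 0)) + \<psi> (rot (cvec h) (vec4 0 0 1 0)) +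
    (\<psi> (rot (cvec h) (vec4 0 0 0 1)) :: complex)" for h and \<psi> :: "complex ^ 4 \<Rightarrow> complex"
  \<comment> \<open>Quantifying over all even functions makes the property multiplicative: for a
    product g h, the property of h is applied to the function composed with the rotation by
    g.\<close>
  define Q where "Q h \<longleftrightarrow> (\<forall>\<psi>. (\<forall>z. \<psi> (- z) = \<psi> z) \<longrightarrow> T h \<psi> = T hone \<psi>)" for h
  have neg: "\<psi> (vec4 0 (-1) 0 0) = \<psi> (vec4 0 1 0 0)" "\<psi> (vec4 0 0 (-1) 0) = \<psi> (vec4 0 0 1 0)"
    "\<psi> (vec4 0 0 0 (-1)) = \<psi> (vec4 0 0 0 1)" if "\<forall>z. \<psi> (- z) = \<psi> z" for \<psi> :: "complex ^ 4 \<Rightarrow> complex"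
    using that[rule_format, of "vec4 0 1 0 0"] that[rule_format, of "vec4 0 0 1 0"]
      that[rule_format, of "vec4 0 0 0 1"] by simp_all
  have sq: "complex_of_real (sqrt 2) * complex_of_real (sqrt 2) = 2"
    by (simp flip: of_real_mult)
  have one: "rot (cvec hone) z = z" for z by (simp add: rot_def cvec_hom)
  have "Q h"
    using assms(1) unfolding binary_octahedral_def
  proof (rule generate_induct_units)
    show "{quat_i, quat_R4, quat_S} \<subseteq> carrier SU2" using carrier_generators by simp
    show "Q hone" by (simp add: Q_def)
    fix g h assume "Q g" "Q h"
    show "Q (g \<star> h)"
      unfolding Q_def
    proof (intro allI impI)
      fix \<psi> :: "complex ^ 4 \<Rightarrow> complex" assume \<psi>: "\<forall>z. \<psi> (- z) = \<psi> z"
      have "T (g \<star> h) \<psi> = T h (\<lambda>z. \<psi> (rot (cvec g) z))"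
        by (simp add: T_def rot_def cvec_hom hcnj_hmul hmul_assoc)
      also have "\<dots> = T hone (\<lambda>z. \<psi> (rot (cvec g) z))"
        using \<open>Q h\<close> \<psi> unfolding Q_def by (simp add: rot_def hmul_linear)
      also have "\<dots> = T g \<psi>" by (simp only: T_def one)
      finally show "T (g \<star> h) \<psi> = T hone \<psi>" using \<open>Q g\<close> \<psi> by (simp add: Q_def)
    qed
  next
    have rots: "rot (cvec quat_i) (vec4 0 x y w) = vec4 0 x (- y) (- w)"
      "rot (cvec (hcnj quat_i)) (vec4 0 x y w) = vec4 0 x (- y) (- w)"
      "rot (cvec quat_S) (vec4 0 x y w) = vec4 0 (- y) (- w) x"
      "rot (cvec (hcnj quat_S)) (vec4 0 x y w) = vec4 0 w (- x) (- y)"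
      "rot (cvec quat_R4) (vec4 0 x y w) = vec4 0 x (- w) y"
      "rot (cvec (hcnj quat_R4)) (vec4 0 x y w) = vec4 0 x w (- y)" for x y w
      by (simp_all add: rot_def quat_i_def quat_S_def quat_R4_def cvec_vec4 field_simps sq)
    fix h assume "h \<in> {quat_i, quat_R4, quat_S}"
    then show "Q h" "Q (hcnj h)"
      unfolding Q_def T_def one by (auto simp: rots neg)
  qed
  then show ?thesis using even unfolding Q_def T_def one by blast
qed

text \<open>Multiplying x on the left by g rotates each frame vector by g, which
  \<open>ico_form\<close> does not notice. Multiplying on the right by the inverse of h permutes the
  frame up to sign before x acts, which the even symmetric sum does not notice.\<close>

lemma frame_form_invariant:
  assumes "g \<in> binary_icosahedral" "h \<in> binary_octahedral"
  shows "frame_form (cact g h x) = frame_form x"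
proof -
  have rot: "rot (cact g h x) b = rot (cvec g) (rot x (rot (cvec (hcnj h)) b))" for b
    by (simp add: rot_def cact_def cvec_hom hcnj_hmul hmul_assoc)
  have "(rot x b) $ 0 = 0" if "b $ 0 = 0" for x b
    using that by (simp add: rot_def hmul_def hcnj_def algebra_simps)
  then have left: "ico_form (rot (cact g h x) b) = ico_form (rot x (rot (cvec (hcnj h)) b))" if "b $ 0 = 0" for b
    unfolding rot using that by (intro ico_form_invariant[OF assms(1)]) simp
  have "ico_form (rot x (- z)) = ico_form (rot x z)" for z
    by (simp add: rot_def hmul_linear ico_form_def Let_def)
  from octahedral_frame_sum[OF binary_closed(5)[OF assms(2)], of "\<lambda>z. ico_form (rot x z)", OF this]
  show ?thesis by (simp add: frame_form_def left)
qed

lemma frame_form_restricted: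
  "frame_form (vec4 x 0 y 0) = 2 * x^2 * y^2 * (x^2 - y^2)^2 * (x^2 + y^2)^2"
proof -
  let ?t = "complex_of_real tau"
  \<comment> \<open>The double-angle forms of (x, y), with c^2 + s^2 = n^2. The factor c^2 s^2 n^2
    of the restricted invariant arises from this identity.\<close>
  let ?c = "x^2 - y^2" and ?s = "2 * x * y" and ?n = "x^2 + y^2"
  have "rot (vec4 x 0 y 0) (vec4 0 1 0 0) = vec4 0 ?c 0 (- ?s)"
    "rot (vec4 x 0 y 0) (vec4 0 0 1 0) = vec4 0 0 ?n 0"
    "rot (vec4 x 0 y 0) (vec4 0 0 0 1) = vec4 0 ?s 0 ?c"
    by (simp_all add: rot_def power2_eq_square algebra_simps)
  then have "frame_form (vec4 x 0 y 0) = (?t - 3/2) *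
    (ico_form (vec4 0 ?c 0 (- ?s)) + ico_form (vec4 0 0 ?n 0) + ico_form (vec4 0 ?s 0 ?c))"
    by (simp add: frame_form_def)
  also have "\<dots> = ((?t - 3/2) * ?t^2 * (?t^2 - 1)) * (?c^2 * ?s^2 * (?c^2 + ?s^2))"
  proof -
    have "ico_form (vec4 0 c 0 s) = - (?t^2 * s^2 * (s^2 - ?t^2 * c^2) * c^2)" for c s
      by (simp add: ico_form_def Let_def)
    moreover have "ico_form (vec4 0 0 n 0) = 0" for n
      by (simp add: ico_form_def Let_def)
    moreover have "k * (- (t^2 * (- s)^2 * ((- s)^2 - t^2 * c^2) * c^2) + 0 + - (t^2 * c^2 * (c^2 - t^2 * s^2) * s^2)) =
      (k * t^2 * (t^2 - 1)) * (c^2 * s^2 * (c^2 + s^2))" for k t c s :: complex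
      by algebra
    ultimately show ?thesis by (simp only:)
  qed
  \<comment> \<open>This identity fixes the normalizing constant tau - 3/2 of
    \<open>frame_form\<close>.\<close>
  also have "(?t - 3/2) * ?t^2 * (?t^2 - 1) = 1/2"
    by (simp add: power2_eq_square field_simps ctau_mult ctau_mult_left)
  also have "?c^2 + ?s^2 = ?n^2" by algebra
  finally show ?thesis by (simp add: power2_eq_square)
qed

section \<open>Uniqueness of the invariant\<close>

text \<open>The sum over the twelve even permutations of the coordinates, arranged as the Klein four
  group combined with the cyclic permutations of the last three. Coinciding terms are all kept, so a
  symmetric monomial is counted several times.\<close>

definition orbsum :: "nat \<Rightarrow> nat \<Rightarrow> nat \<Rightarrow> nat \<Rightarrow> complex ^ 4 \<Rightarrow> complex" where
  "orbsum i j k l x = (\<Sum>(p, q, r, s)\<leftarrow>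
     [(x$0, x$1, x$2, x$3), (x$1, x$0, x$3, x$2), (x$2, x$3, x$0, x$1), (x$3, x$2, x$1, x$0),
      (x$0, x$2, x$3, x$1), (x$2, x$0, x$1, x$3), (x$3, x$1, x$0, x$2), (x$1, x$3, x$2, x$0),
      (x$0, x$3, x$1, x$2), (x$3, x$0, x$2, x$1), (x$1, x$2, x$0, x$3), (x$2, x$1, x$3, x$0)].
     p ^ i * q ^ j * r ^ k * s ^ l)"

text \<open>One step in tabulating the powers of a + b t in the normal form c + d t, so that high
  powers are never expanded before t^2 is replaced by t + 1.\<close>

lemma linear_power_step:
  fixes t :: complex
  assumes "t * t = t + 1" "p = a + b * t" "p ^ n = c + d * t" "m = Suc n" "a * c + b * d = c'" "a * d + b * c + b * d = d'"
  shows "p ^ m = c' + d' * t"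
proof -
  have "p ^ m = (a + b * t) * (c + d * t)"
    unfolding assms(4) power_Suc assms(3) by (simp only: assms(2))
  also have "\<dots> = (a * c + b * d) + (a * d + b * c + b * d) * t"
    using assms(1) by algebra
  finally show ?thesis using assms(5,6) by simp
qed

text \<open>The five points are images of points \<open>(1, 0, s, 0)\<close> under twice the left multiplication by
  \<^const>\<open>quat_U\<close>, chosen to have small coordinates.\<close>

lemma orbsum_golden0:
  fixes t :: complex assumes t: "t * t = t + 1"
  shows "orbsum 8 2 2 0 (vec4 ((-1 + 2*t)) (1) (-1) (1)) = 1908"
    "orbsum 6 4 2 0 (vec4 ((-1 + 2*t)) (1) (-1) (1)) = 468"
    "orbsum 6 4 0 2 (vec4 ((-1 + 2*t)) (1) (-1) (1)) = 468"
    "orbsum 4 4 4 0 (vec4 ((-1 + 2*t)) (1) (-1) (1)) = 228"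
    "orbsum 6 2 2 2 (vec4 ((-1 + 2*t)) (1) (-1) (1)) = 420"
    "orbsum 4 4 2 2 (vec4 ((-1 + 2*t)) (1) (-1) (1)) = 180"
    "orbsum 9 1 1 1 (vec4 ((-1 + 2*t)) (1) (-1) (1)) = (1884 + -3768*t)"
    "orbsum 7 3 1 1 (vec4 ((-1 + 2*t)) (1) (-1) (1)) = (396 + -792*t)"
    "orbsum 5 5 1 1 (vec4 ((-1 + 2*t)) (1) (-1) (1)) = (156 + -312*t)"
    "orbsum 5 3 3 1 (vec4 ((-1 + 2*t)) (1) (-1) (1)) = (108 + -216*t)"
    "orbsum 3 3 3 3 (vec4 ((-1 + 2*t)) (1) (-1) (1)) = (60 + -120*t)"
proof -
  define p where "p = (-1 + 2*t)"
  have p1: "p = -1 + 2 * t" by (simp add: p_def)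
  have p1': "p ^ 1 = -1 + 2 * t" using p1 by simp
  have p2: "p ^ 2 = 5 + 0 * t" by (rule linear_power_step[OF t p1 p1']) simp_all
  have p3: "p ^ 3 = -5 + 10 * t" by (rule linear_power_step[OF t p1 p2]) simp_all
  have p4: "p ^ 4 = 25 + 0 * t" by (rule linear_power_step[OF t p1 p3]) simp_all
  have p5: "p ^ 5 = -25 + 50 * t" by (rule linear_power_step[OF t p1 p4]) simp_all
  have p6: "p ^ 6 = 125 + 0 * t" by (rule linear_power_step[OF t p1 p5]) simp_all
  have p7: "p ^ 7 = -125 + 250 * t" by (rule linear_power_step[OF t p1 p6]) simp_all
  have p8: "p ^ 8 = 625 + 0 * t" by (rule linear_power_step[OF t p1 p7]) simp_all
  have p9: "p ^ 9 = -625 + 1250 * t" by (rule linear_power_step[OF t p1 p8]) simp_all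
  note powers = orbsum_def p2 p3 p4 p5 p6 p7 p8 p9
  note coords = p1
  have tt: "t * (t * x) = t * x + x" for x using t by (metis distrib_right mult.assoc mult_1)
  have v0: "orbsum 8 2 2 0 (vec4 p (1) (-1) (1)) = 1908" by (simp add: powers, (simp add: coords algebra_simps t tt)?)
  have v1: "orbsum 6 4 2 0 (vec4 p (1) (-1) (1)) = 468" by (simp add: powers, (simp add: coords algebra_simps t tt)?)
  have v2: "orbsum 6 4 0 2 (vec4 p (1) (-1) (1)) = 468" by (simp add: powers, (simp add: coords algebra_simps t tt)?)
  have v3: "orbsum 4 4 4 0 (vec4 p (1) (-1) (1)) = 228" by (simp add: powers, (simp add: coords algebra_simps t tt)?)
  have v4: "orbsum 6 2 2 2 (vec4 p (1) (-1) (1)) = 420" by (simp add: powers, (simp add: coords algebra_simps t tt)?)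
  have v5: "orbsum 4 4 2 2 (vec4 p (1) (-1) (1)) = 180" by (simp add: powers, (simp add: coords algebra_simps t tt)?)
  have v6: "orbsum 9 1 1 1 (vec4 p (1) (-1) (1)) = (1884 + -3768*t)" by (simp add: powers, (simp add: coords algebra_simps t tt)?)
  have v7: "orbsum 7 3 1 1 (vec4 p (1) (-1) (1)) = (396 + -792*t)" by (simp add: powers, (simp add: coords algebra_simps t tt)?)
  have v8: "orbsum 5 5 1 1 (vec4 p (1) (-1) (1)) = (156 + -312*t)" by (simp add: powers, (simp add: coords algebra_simps t tt)?)
  have v9: "orbsum 5 3 3 1 (vec4 p (1) (-1) (1)) = (108 + -216*t)" by (simp add: powers, (simp add: coords algebra_simps t tt)?)
  have v10: "orbsum 3 3 3 3 (vec4 p (1) (-1) (1)) = (60 + -120*t)" by (simp add: powers, (simp add: coords algebra_simps t tt)?)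
  show "orbsum 8 2 2 0 (vec4 ((-1 + 2*t)) (1) (-1) (1)) = 1908" "orbsum 6 4 2 0 (vec4 ((-1 + 2*t)) (1) (-1) (1)) = 468" "orbsum 6 4 0 2 (vec4 ((-1 + 2*t)) (1) (-1) (1)) = 468" "orbsum 4 4 4 0 (vec4 ((-1 + 2*t)) (1) (-1) (1)) = 228" "orbsum 6 2 2 2 (vec4 ((-1 + 2*t)) (1) (-1) (1)) = 420" "orbsum 4 4 2 2 (vec4 ((-1 + 2*t)) (1) (-1) (1)) = 180" "orbsum 9 1 1 1 (vec4 ((-1 + 2*t)) (1) (-1) (1)) = (1884 + -3768*t)" "orbsum 7 3 1 1 (vec4 ((-1 + 2*t)) (1) (-1) (1)) = (396 + -792*t)" "orbsum 5 5 1 1 (vec4 ((-1 + 2*t)) (1) (-1) (1)) = (156 + -312*t)" "orbsum 5 3 3 1 (vec4 ((-1 + 2*t)) (1) (-1) (1)) = (108 + -216*t)" "orbsum 3 3 3 3 (vec4 ((-1 + 2*t)) (1) (-1) (1)) = (60 + -120*t)"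
    using v0 v1 v2 v3 v4 v5 v6 v7 v8 v9 v10 by (simp_all only: p_def)
qed

lemma orbsum_golden1:
  fixes t :: complex assumes t: "t * t = t + 1"
  shows "orbsum 8 2 2 0 (vec4 ((1 + 1*t)) (1*t) (-2) (1)) = (12987 + 20768*t)"
    "orbsum 6 4 2 0 (vec4 ((1 + 1*t)) (1*t) (-2) (1)) = (7407 + 11943*t)"
    "orbsum 6 4 0 2 (vec4 ((1 + 1*t)) (1*t) (-2) (1)) = (7542 + 12153*t)"
    "orbsum 4 4 4 0 (vec4 ((1 + 1*t)) (1*t) (-2) (1)) = (5259 + 8496*t)"
    "orbsum 6 2 2 2 (vec4 ((1 + 1*t)) (1*t) (-2) (1)) = (4224 + 6816*t)"
    "orbsum 4 4 2 2 (vec4 ((1 + 1*t)) (1*t) (-2) (1)) = (2752 + 4448*t)"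
    "orbsum 9 1 1 1 (vec4 ((1 + 1*t)) (1*t) (-2) (1)) = (-17376 + -28704*t)"
    "orbsum 7 3 1 1 (vec4 ((1 + 1*t)) (1*t) (-2) (1)) = (-7808 + -12712*t)"
    "orbsum 5 5 1 1 (vec4 ((1 + 1*t)) (1*t) (-2) (1)) = (-5856 + -9504*t)"
    "orbsum 5 3 3 1 (vec4 ((1 + 1*t)) (1*t) (-2) (1)) = (-3648 + -5912*t)"
    "orbsum 3 3 3 3 (vec4 ((1 + 1*t)) (1*t) (-2) (1)) = (-2016 + -3264*t)"
proof -
  define p where "p = (1 + 1*t)"
  have p1: "p = 1 + 1 * t" by (simp add: p_def)
  have p1': "p ^ 1 = 1 + 1 * t" using p1 by simp
  have p2: "p ^ 2 = 2 + 3 * t" by (rule linear_power_step[OF t p1 p1']) simp_all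
  have p3: "p ^ 3 = 5 + 8 * t" by (rule linear_power_step[OF t p1 p2]) simp_all
  have p4: "p ^ 4 = 13 + 21 * t" by (rule linear_power_step[OF t p1 p3]) simp_all
  have p5: "p ^ 5 = 34 + 55 * t" by (rule linear_power_step[OF t p1 p4]) simp_all
  have p6: "p ^ 6 = 89 + 144 * t" by (rule linear_power_step[OF t p1 p5]) simp_all
  have p7: "p ^ 7 = 233 + 377 * t" by (rule linear_power_step[OF t p1 p6]) simp_all
  have p8: "p ^ 8 = 610 + 987 * t" by (rule linear_power_step[OF t p1 p7]) simp_all
  have p9: "p ^ 9 = 1597 + 2584 * t" by (rule linear_power_step[OF t p1 p8]) simp_all
  define q where "q = 1*t"
  have q1: "q = 0 + 1 * t" by (simp add: q_def)
  have q1': "q ^ 1 = 0 + 1 * t" using q1 by simp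
  have q2: "q ^ 2 = 1 + 1 * t" by (rule linear_power_step[OF t q1 q1']) simp_all
  have q3: "q ^ 3 = 1 + 2 * t" by (rule linear_power_step[OF t q1 q2]) simp_all
  have q4: "q ^ 4 = 2 + 3 * t" by (rule linear_power_step[OF t q1 q3]) simp_all
  have q5: "q ^ 5 = 3 + 5 * t" by (rule linear_power_step[OF t q1 q4]) simp_all
  have q6: "q ^ 6 = 5 + 8 * t" by (rule linear_power_step[OF t q1 q5]) simp_all
  have q7: "q ^ 7 = 8 + 13 * t" by (rule linear_power_step[OF t q1 q6]) simp_all
  have q8: "q ^ 8 = 13 + 21 * t" by (rule linear_power_step[OF t q1 q7]) simp_all
  have q9: "q ^ 9 = 21 + 34 * t" by (rule linear_power_step[OF t q1 q8]) simp_all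
  note powers = orbsum_def p2 p3 p4 p5 p6 p7 p8 p9 q2 q3 q4 q5 q6 q7 q8 q9
  note coords = p1 q1
  have tt: "t * (t * x) = t * x + x" for x using t by (metis distrib_right mult.assoc mult_1)
  have v0: "orbsum 8 2 2 0 (vec4 p q (-2) (1)) = (12987 + 20768*t)" by (simp add: powers, (simp add: coords algebra_simps t tt)?)
  have v1: "orbsum 6 4 2 0 (vec4 p q (-2) (1)) = (7407 + 11943*t)" by (simp add: powers, (simp add: coords algebra_simps t tt)?)
  have v2: "orbsum 6 4 0 2 (vec4 p q (-2) (1)) = (7542 + 12153*t)" by (simp add: powers, (simp add: coords algebra_simps t tt)?)
  have v3: "orbsum 4 4 4 0 (vec4 p q (-2) (1)) = (5259 + 8496*t)" by (simp add: powers, (simp add: coords algebra_simps t tt)?)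
  have v4: "orbsum 6 2 2 2 (vec4 p q (-2) (1)) = (4224 + 6816*t)" by (simp add: powers, (simp add: coords algebra_simps t tt)?)
  have v5: "orbsum 4 4 2 2 (vec4 p q (-2) (1)) = (2752 + 4448*t)" by (simp add: powers, (simp add: coords algebra_simps t tt)?)
  have v6: "orbsum 9 1 1 1 (vec4 p q (-2) (1)) = (-17376 + -28704*t)" by (simp add: powers, (simp add: coords algebra_simps t tt)?)
  have v7: "orbsum 7 3 1 1 (vec4 p q (-2) (1)) = (-7808 + -12712*t)" by (simp add: powers, (simp add: coords algebra_simps t tt)?)
  have v8: "orbsum 5 5 1 1 (vec4 p q (-2) (1)) = (-5856 + -9504*t)" by (simp add: powers, (simp add: coords algebra_simps t tt)?)
  have v9: "orbsum 5 3 3 1 (vec4 p q (-2) (1)) = (-3648 + -5912*t)" by (simp add: powers, (simp add: coords algebra_simps t tt)?)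
  have v10: "orbsum 3 3 3 3 (vec4 p q (-2) (1)) = (-2016 + -3264*t)" by (simp add: powers, (simp add: coords algebra_simps t tt)?)
  show "orbsum 8 2 2 0 (vec4 ((1 + 1*t)) (1*t) (-2) (1)) = (12987 + 20768*t)" "orbsum 6 4 2 0 (vec4 ((1 + 1*t)) (1*t) (-2) (1)) = (7407 + 11943*t)" "orbsum 6 4 0 2 (vec4 ((1 + 1*t)) (1*t) (-2) (1)) = (7542 + 12153*t)" "orbsum 4 4 4 0 (vec4 ((1 + 1*t)) (1*t) (-2) (1)) = (5259 + 8496*t)" "orbsum 6 2 2 2 (vec4 ((1 + 1*t)) (1*t) (-2) (1)) = (4224 + 6816*t)" "orbsum 4 4 2 2 (vec4 ((1 + 1*t)) (1*t) (-2) (1)) = (2752 + 4448*t)" "orbsum 9 1 1 1 (vec4 ((1 + 1*t)) (1*t) (-2) (1)) = (-17376 + -28704*t)" "orbsum 7 3 1 1 (vec4 ((1 + 1*t)) (1*t) (-2) (1)) = (-7808 + -12712*t)" "orbsum 5 5 1 1 (vec4 ((1 + 1*t)) (1*t) (-2) (1)) = (-5856 + -9504*t)" "orbsum 5 3 3 1 (vec4 ((1 + 1*t)) (1*t) (-2) (1)) = (-3648 + -5912*t)" "orbsum 3 3 3 3 (vec4 ((1 + 1*t)) (1*t) (-2) (1)) = (-2016 + -3264*t)"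
    using v0 v1 v2 v3 v4 v5 v6 v7 v8 v9 v10 by (simp_all only: p_def q_def)
qed

lemma orbsum_golden2:
  fixes t :: complex assumes t: "t * t = t + 1"
  shows "orbsum 8 2 2 0 (vec4 ((-1 + 1*t)) (-1*t) (2*t) (1)) = (13603 + 21776*t)"
    "orbsum 6 4 2 0 (vec4 ((-1 + 1*t)) (-1*t) (2*t) (1)) = (2823 + 4431*t)"
    "orbsum 6 4 0 2 (vec4 ((-1 + 1*t)) (-1*t) (2*t) (1)) = (2358 + 3681*t)"
    "orbsum 4 4 4 0 (vec4 ((-1 + 1*t)) (-1*t) (2*t) (1)) = (771 + 1152*t)"
    "orbsum 6 2 2 2 (vec4 ((-1 + 1*t)) (-1*t) (2*t) (1)) = (1056 + 1632*t)"
    "orbsum 4 4 2 2 (vec4 ((-1 + 1*t)) (-1*t) (2*t) (1)) = (288 + 416*t)"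
    "orbsum 9 1 1 1 (vec4 ((-1 + 1*t)) (-1*t) (2*t) (1)) = (-32256 + -52512*t)"
    "orbsum 7 3 1 1 (vec4 ((-1 + 1*t)) (-1*t) (2*t) (1)) = (-4248 + -7016*t)"
    "orbsum 5 5 1 1 (vec4 ((-1 + 1*t)) (-1*t) (2*t) (1)) = (-1536 + -2592*t)"
    "orbsum 5 3 3 1 (vec4 ((-1 + 1*t)) (-1*t) (2*t) (1)) = (-488 + -856*t)"
    "orbsum 3 3 3 3 (vec4 ((-1 + 1*t)) (-1*t) (2*t) (1)) = (-96 + -192*t)"
proof -
  define p where "p = (-1 + 1*t)"
  have p1: "p = -1 + 1 * t" by (simp add: p_def)
  have p1': "p ^ 1 = -1 + 1 * t" using p1 by simp
  have p2: "p ^ 2 = 2 + -1 * t" by (rule linear_power_step[OF t p1 p1']) simp_all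
  have p3: "p ^ 3 = -3 + 2 * t" by (rule linear_power_step[OF t p1 p2]) simp_all
  have p4: "p ^ 4 = 5 + -3 * t" by (rule linear_power_step[OF t p1 p3]) simp_all
  have p5: "p ^ 5 = -8 + 5 * t" by (rule linear_power_step[OF t p1 p4]) simp_all
  have p6: "p ^ 6 = 13 + -8 * t" by (rule linear_power_step[OF t p1 p5]) simp_all
  have p7: "p ^ 7 = -21 + 13 * t" by (rule linear_power_step[OF t p1 p6]) simp_all
  have p8: "p ^ 8 = 34 + -21 * t" by (rule linear_power_step[OF t p1 p7]) simp_all
  have p9: "p ^ 9 = -55 + 34 * t" by (rule linear_power_step[OF t p1 p8]) simp_all
  define q where "q = -1*t"
  have q1: "q = 0 + -1 * t" by (simp add: q_def)
  have q1': "q ^ 1 = 0 + -1 * t" using q1 by simp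
  have q2: "q ^ 2 = 1 + 1 * t" by (rule linear_power_step[OF t q1 q1']) simp_all
  have q3: "q ^ 3 = -1 + -2 * t" by (rule linear_power_step[OF t q1 q2]) simp_all
  have q4: "q ^ 4 = 2 + 3 * t" by (rule linear_power_step[OF t q1 q3]) simp_all
  have q5: "q ^ 5 = -3 + -5 * t" by (rule linear_power_step[OF t q1 q4]) simp_all
  have q6: "q ^ 6 = 5 + 8 * t" by (rule linear_power_step[OF t q1 q5]) simp_all
  have q7: "q ^ 7 = -8 + -13 * t" by (rule linear_power_step[OF t q1 q6]) simp_all
  have q8: "q ^ 8 = 13 + 21 * t" by (rule linear_power_step[OF t q1 q7]) simp_all
  have q9: "q ^ 9 = -21 + -34 * t" by (rule linear_power_step[OF t q1 q8]) simp_all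
  define r where "r = 2*t"
  have r1: "r = 0 + 2 * t" by (simp add: r_def)
  have r1': "r ^ 1 = 0 + 2 * t" using r1 by simp
  have r2: "r ^ 2 = 4 + 4 * t" by (rule linear_power_step[OF t r1 r1']) simp_all
  have r3: "r ^ 3 = 8 + 16 * t" by (rule linear_power_step[OF t r1 r2]) simp_all
  have r4: "r ^ 4 = 32 + 48 * t" by (rule linear_power_step[OF t r1 r3]) simp_all
  have r5: "r ^ 5 = 96 + 160 * t" by (rule linear_power_step[OF t r1 r4]) simp_all
  have r6: "r ^ 6 = 320 + 512 * t" by (rule linear_power_step[OF t r1 r5]) simp_all
  have r7: "r ^ 7 = 1024 + 1664 * t" by (rule linear_power_step[OF t r1 r6]) simp_all
  have r8: "r ^ 8 = 3328 + 5376 * t" by (rule linear_power_step[OF t r1 r7]) simp_all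
  have r9: "r ^ 9 = 10752 + 17408 * t" by (rule linear_power_step[OF t r1 r8]) simp_all
  note powers = orbsum_def p2 p3 p4 p5 p6 p7 p8 p9 q2 q3 q4 q5 q6 q7 q8 q9 r2 r3 r4 r5 r6 r7 r8 r9
  note coords = p1 q1 r1
  have tt: "t * (t * x) = t * x + x" for x using t by (metis distrib_right mult.assoc mult_1)
  have v0: "orbsum 8 2 2 0 (vec4 p q r (1)) = (13603 + 21776*t)" by (simp add: powers, (simp add: coords algebra_simps t tt)?)
  have v1: "orbsum 6 4 2 0 (vec4 p q r (1)) = (2823 + 4431*t)" by (simp add: powers, (simp add: coords algebra_simps t tt)?)
  have v2: "orbsum 6 4 0 2 (vec4 p q r (1)) = (2358 + 3681*t)" by (simp add: powers, (simp add: coords algebra_simps t tt)?)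
  have v3: "orbsum 4 4 4 0 (vec4 p q r (1)) = (771 + 1152*t)" by (simp add: powers, (simp add: coords algebra_simps t tt)?)
  have v4: "orbsum 6 2 2 2 (vec4 p q r (1)) = (1056 + 1632*t)" by (simp add: powers, (simp add: coords algebra_simps t tt)?)
  have v5: "orbsum 4 4 2 2 (vec4 p q r (1)) = (288 + 416*t)" by (simp add: powers, (simp add: coords algebra_simps t tt)?)
  have v6: "orbsum 9 1 1 1 (vec4 p q r (1)) = (-32256 + -52512*t)" by (simp add: powers, (simp add: coords algebra_simps t tt)?)
  have v7: "orbsum 7 3 1 1 (vec4 p q r (1)) = (-4248 + -7016*t)" by (simp add: powers, (simp add: coords algebra_simps t tt)?)
  have v8: "orbsum 5 5 1 1 (vec4 p q r (1)) = (-1536 + -2592*t)" by (simp add: powers, (simp add: coords algebra_simps t tt)?)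
  have v9: "orbsum 5 3 3 1 (vec4 p q r (1)) = (-488 + -856*t)" by (simp add: powers, (simp add: coords algebra_simps t tt)?)
  have v10: "orbsum 3 3 3 3 (vec4 p q r (1)) = (-96 + -192*t)" by (simp add: powers, (simp add: coords algebra_simps t tt)?)
  show "orbsum 8 2 2 0 (vec4 ((-1 + 1*t)) (-1*t) (2*t) (1)) = (13603 + 21776*t)" "orbsum 6 4 2 0 (vec4 ((-1 + 1*t)) (-1*t) (2*t) (1)) = (2823 + 4431*t)" "orbsum 6 4 0 2 (vec4 ((-1 + 1*t)) (-1*t) (2*t) (1)) = (2358 + 3681*t)" "orbsum 4 4 4 0 (vec4 ((-1 + 1*t)) (-1*t) (2*t) (1)) = (771 + 1152*t)" "orbsum 6 2 2 2 (vec4 ((-1 + 1*t)) (-1*t) (2*t) (1)) = (1056 + 1632*t)" "orbsum 4 4 2 2 (vec4 ((-1 + 1*t)) (-1*t) (2*t) (1)) = (288 + 416*t)" "orbsum 9 1 1 1 (vec4 ((-1 + 1*t)) (-1*t) (2*t) (1)) = (-32256 + -52512*t)" "orbsum 7 3 1 1 (vec4 ((-1 + 1*t)) (-1*t) (2*t) (1)) = (-4248 + -7016*t)" "orbsum 5 5 1 1 (vec4 ((-1 + 1*t)) (-1*t) (2*t) (1)) = (-1536 + -2592*t)" "orbsum 5 3 3 1 (vec4 ((-1 + 1*t)) (-1*t) (2*t) (1)) = (-488 + -856*t)" "orbsum 3 3 3 3 (vec4 ((-1 + 1*t)) (-1*t) (2*t) (1)) = (-96 + -192*t)"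
    using v0 v1 v2 v3 v4 v5 v6 v7 v8 v9 v10 by (simp_all only: p_def q_def r_def)
qed

lemma orbsum_golden3:
  fixes t :: complex assumes t: "t * t = t + 1"
  shows "orbsum 8 2 2 0 (vec4 (1*t) (0) ((-1 + 1*t)) (1)) = 19"
    "orbsum 6 4 2 0 (vec4 (1*t) (0) ((-1 + 1*t)) (1)) = (7 + -1*t)"
    "orbsum 6 4 0 2 (vec4 (1*t) (0) ((-1 + 1*t)) (1)) = (6 + 1*t)"
    "orbsum 4 4 4 0 (vec4 (1*t) (0) ((-1 + 1*t)) (1)) = 3"
    "orbsum 6 2 2 2 (vec4 (1*t) (0) ((-1 + 1*t)) (1)) = 0"
    "orbsum 4 4 2 2 (vec4 (1*t) (0) ((-1 + 1*t)) (1)) = 0"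
    "orbsum 9 1 1 1 (vec4 (1*t) (0) ((-1 + 1*t)) (1)) = 0"
    "orbsum 7 3 1 1 (vec4 (1*t) (0) ((-1 + 1*t)) (1)) = 0"
    "orbsum 5 5 1 1 (vec4 (1*t) (0) ((-1 + 1*t)) (1)) = 0"
    "orbsum 5 3 3 1 (vec4 (1*t) (0) ((-1 + 1*t)) (1)) = 0"
    "orbsum 3 3 3 3 (vec4 (1*t) (0) ((-1 + 1*t)) (1)) = 0"
proof -
  define p where "p = 1*t"
  have p1: "p = 0 + 1 * t" by (simp add: p_def)
  have p1': "p ^ 1 = 0 + 1 * t" using p1 by simp
  have p2: "p ^ 2 = 1 + 1 * t" by (rule linear_power_step[OF t p1 p1']) simp_all
  have p3: "p ^ 3 = 1 + 2 * t" by (rule linear_power_step[OF t p1 p2]) simp_all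
  have p4: "p ^ 4 = 2 + 3 * t" by (rule linear_power_step[OF t p1 p3]) simp_all
  have p5: "p ^ 5 = 3 + 5 * t" by (rule linear_power_step[OF t p1 p4]) simp_all
  have p6: "p ^ 6 = 5 + 8 * t" by (rule linear_power_step[OF t p1 p5]) simp_all
  have p7: "p ^ 7 = 8 + 13 * t" by (rule linear_power_step[OF t p1 p6]) simp_all
  have p8: "p ^ 8 = 13 + 21 * t" by (rule linear_power_step[OF t p1 p7]) simp_all
  have p9: "p ^ 9 = 21 + 34 * t" by (rule linear_power_step[OF t p1 p8]) simp_all
  define r where "r = (-1 + 1*t)"
  have r1: "r = -1 + 1 * t" by (simp add: r_def)
  have r1': "r ^ 1 = -1 + 1 * t" using r1 by simp
  have r2: "r ^ 2 = 2 + -1 * t" by (rule linear_power_step[OF t r1 r1']) simp_all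
  have r3: "r ^ 3 = -3 + 2 * t" by (rule linear_power_step[OF t r1 r2]) simp_all
  have r4: "r ^ 4 = 5 + -3 * t" by (rule linear_power_step[OF t r1 r3]) simp_all
  have r5: "r ^ 5 = -8 + 5 * t" by (rule linear_power_step[OF t r1 r4]) simp_all
  have r6: "r ^ 6 = 13 + -8 * t" by (rule linear_power_step[OF t r1 r5]) simp_all
  have r7: "r ^ 7 = -21 + 13 * t" by (rule linear_power_step[OF t r1 r6]) simp_all
  have r8: "r ^ 8 = 34 + -21 * t" by (rule linear_power_step[OF t r1 r7]) simp_all
  have r9: "r ^ 9 = -55 + 34 * t" by (rule linear_power_step[OF t r1 r8]) simp_all
  note powers = orbsum_def p2 p3 p4 p5 p6 p7 p8 p9 r2 r3 r4 r5 r6 r7 r8 r9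
  note coords = p1 r1
  have tt: "t * (t * x) = t * x + x" for x using t by (metis distrib_right mult.assoc mult_1)
  have v0: "orbsum 8 2 2 0 (vec4 p (0) r (1)) = 19" by (simp add: powers, (simp add: coords algebra_simps t tt)?)
  have v1: "orbsum 6 4 2 0 (vec4 p (0) r (1)) = (7 + -1*t)" by (simp add: powers, (simp add: coords algebra_simps t tt)?)
  have v2: "orbsum 6 4 0 2 (vec4 p (0) r (1)) = (6 + 1*t)" by (simp add: powers, (simp add: coords algebra_simps t tt)?)
  have v3: "orbsum 4 4 4 0 (vec4 p (0) r (1)) = 3" by (simp add: powers, (simp add: coords algebra_simps t tt)?)
  have v4: "orbsum 6 2 2 2 (vec4 p (0) r (1)) = 0" by (simp add: powers, (simp add: coords algebra_simps t tt)?)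
  have v5: "orbsum 4 4 2 2 (vec4 p (0) r (1)) = 0" by (simp add: powers, (simp add: coords algebra_simps t tt)?)
  have v6: "orbsum 9 1 1 1 (vec4 p (0) r (1)) = 0" by (simp add: powers, (simp add: coords algebra_simps t tt)?)
  have v7: "orbsum 7 3 1 1 (vec4 p (0) r (1)) = 0" by (simp add: powers, (simp add: coords algebra_simps t tt)?)
  have v8: "orbsum 5 5 1 1 (vec4 p (0) r (1)) = 0" by (simp add: powers, (simp add: coords algebra_simps t tt)?)
  have v9: "orbsum 5 3 3 1 (vec4 p (0) r (1)) = 0" by (simp add: powers, (simp add: coords algebra_simps t tt)?)
  have v10: "orbsum 3 3 3 3 (vec4 p (0) r (1)) = 0" by (simp add: powers, (simp add: coords algebra_simps t tt)?)
  show "orbsum 8 2 2 0 (vec4 (1*t) (0) ((-1 + 1*t)) (1)) = 19" "orbsum 6 4 2 0 (vec4 (1*t) (0) ((-1 + 1*t)) (1)) = (7 + -1*t)" "orbsum 6 4 0 2 (vec4 (1*t) (0) ((-1 + 1*t)) (1)) = (6 + 1*t)" "orbsum 4 4 4 0 (vec4 (1*t) (0) ((-1 + 1*t)) (1)) = 3" "orbsum 6 2 2 2 (vec4 (1*t) (0) ((-1 + 1*t)) (1)) = 0" "orbsum 4 4 2 2 (vec4 (1*t) (0) ((-1 + 1*t)) (1)) = 0" "orbsum 9 1 1 1 (vec4 (1*t) (0) ((-1 + 1*t)) (1)) = 0" "orbsum 7 3 1 1 (vec4 (1*t) (0) ((-1 + 1*t)) (1)) = 0" "orbsum 5 5 1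 1 (vec4 (1*t) (0) ((-1 + 1*t)) (1)) = 0" "orbsum 5 3 3 1 (vec4 (1*t) (0) ((-1 + 1*t)) (1)) = 0" "orbsum 3 3 3 3 (vec4 (1*t) (0) ((-1 + 1*t)) (1)) = 0"
    using v0 v1 v2 v3 v4 v5 v6 v7 v8 v9 v10 by (simp_all only: p_def r_def)
qed

lemma orbsum_golden4:
  fixes t :: complex assumes t: "t * t = t + 1"
  shows "orbsum 8 2 2 0 (vec4 (2*t) ((1 + 1*t)) ((-2 + -1*t)) (1)) = (1185747 + 1918512*t)"
    "orbsum 6 4 2 0 (vec4 (2*t) ((1 + 1*t)) ((-2 + -1*t)) (1)) = (924887 + 1496447*t)"
    "orbsum 6 4 0 2 (vec4 (2*t) ((1 + 1*t)) ((-2 + -1*t)) (1)) = (913942 + 1478737*t)"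
    "orbsum 4 4 4 0 (vec4 (2*t) ((1 + 1*t)) ((-2 + -1*t)) (1)) = (758547 + 1227312*t)"
    "orbsum 6 2 2 2 (vec4 (2*t) ((1 + 1*t)) ((-2 + -1*t)) (1)) = (256320 + 414720*t)"
    "orbsum 4 4 2 2 (vec4 (2*t) ((1 + 1*t)) ((-2 + -1*t)) (1)) = (170880 + 276480*t)"
    "orbsum 9 1 1 1 (vec4 (2*t) ((1 + 1*t)) ((-2 + -1*t)) (1)) = (-1108032 + -1792896*t)"
    "orbsum 7 3 1 1 (vec4 (2*t) ((1 + 1*t)) ((-2 + -1*t)) (1)) = (-619288 + -1002064*t)"
    "orbsum 5 5 1 1 (vec4 (2*t) ((1 + 1*t)) ((-2 + -1*t)) (1)) = (-547648 + -886144*t)"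
    "orbsum 5 3 3 1 (vec4 (2*t) ((1 + 1*t)) ((-2 + -1*t)) (1)) = (-297704 + -481712*t)"
    "orbsum 3 3 3 3 (vec4 (2*t) ((1 + 1*t)) ((-2 + -1*t)) (1)) = (-95520 + -154560*t)"
proof -
  define p where "p = 2*t"
  have p1: "p = 0 + 2 * t" by (simp add: p_def)
  have p1': "p ^ 1 = 0 + 2 * t" using p1 by simp
  have p2: "p ^ 2 = 4 + 4 * t" by (rule linear_power_step[OF t p1 p1']) simp_all
  have p3: "p ^ 3 = 8 + 16 * t" by (rule linear_power_step[OF t p1 p2]) simp_all
  have p4: "p ^ 4 = 32 + 48 * t" by (rule linear_power_step[OF t p1 p3]) simp_all
  have p5: "p ^ 5 = 96 + 160 * t" by (rule linear_power_step[OF t p1 p4]) simp_all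
  have p6: "p ^ 6 = 320 + 512 * t" by (rule linear_power_step[OF t p1 p5]) simp_all
  have p7: "p ^ 7 = 1024 + 1664 * t" by (rule linear_power_step[OF t p1 p6]) simp_all
  have p8: "p ^ 8 = 3328 + 5376 * t" by (rule linear_power_step[OF t p1 p7]) simp_all
  have p9: "p ^ 9 = 10752 + 17408 * t" by (rule linear_power_step[OF t p1 p8]) simp_all
  define q where "q = (1 + 1*t)"
  have q1: "q = 1 + 1 * t" by (simp add: q_def)
  have q1': "q ^ 1 = 1 + 1 * t" using q1 by simp
  have q2: "q ^ 2 = 2 + 3 * t" by (rule linear_power_step[OF t q1 q1']) simp_all
  have q3: "q ^ 3 = 5 + 8 * t" by (rule linear_power_step[OF t q1 q2]) simp_all
  have q4: "q ^ 4 = 13 + 21 * t" by (rule linear_power_step[OF t q1 q3]) simp_all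
  have q5: "q ^ 5 = 34 + 55 * t" by (rule linear_power_step[OF t q1 q4]) simp_all
  have q6: "q ^ 6 = 89 + 144 * t" by (rule linear_power_step[OF t q1 q5]) simp_all
  have q7: "q ^ 7 = 233 + 377 * t" by (rule linear_power_step[OF t q1 q6]) simp_all
  have q8: "q ^ 8 = 610 + 987 * t" by (rule linear_power_step[OF t q1 q7]) simp_all
  have q9: "q ^ 9 = 1597 + 2584 * t" by (rule linear_power_step[OF t q1 q8]) simp_all
  define r where "r = (-2 + -1*t)"
  have r1: "r = -2 + -1 * t" by (simp add: r_def)
  have r1': "r ^ 1 = -2 + -1 * t" using r1 by simp
  have r2: "r ^ 2 = 5 + 5 * t" by (rule linear_power_step[OF t r1 r1']) simp_all
  have r3: "r ^ 3 = -15 + -20 * t" by (rule linear_power_step[OF t r1 r2]) simp_all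
  have r4: "r ^ 4 = 50 + 75 * t" by (rule linear_power_step[OF t r1 r3]) simp_all
  have r5: "r ^ 5 = -175 + -275 * t" by (rule linear_power_step[OF t r1 r4]) simp_all
  have r6: "r ^ 6 = 625 + 1000 * t" by (rule linear_power_step[OF t r1 r5]) simp_all
  have r7: "r ^ 7 = -2250 + -3625 * t" by (rule linear_power_step[OF t r1 r6]) simp_all
  have r8: "r ^ 8 = 8125 + 13125 * t" by (rule linear_power_step[OF t r1 r7]) simp_all
  have r9: "r ^ 9 = -29375 + -47500 * t" by (rule linear_power_step[OF t r1 r8]) simp_all
  note powers = orbsum_def p2 p3 p4 p5 p6 p7 p8 p9 q2 q3 q4 q5 q6 q7 q8 q9 r2 r3 r4 r5 r6 r7 r8 r9
  note coords = p1 q1 r1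
  have tt: "t * (t * x) = t * x + x" for x using t by (metis distrib_right mult.assoc mult_1)
  have v0: "orbsum 8 2 2 0 (vec4 p q r (1)) = (1185747 + 1918512*t)" by (simp add: powers, (simp add: coords algebra_simps t tt)?)
  have v1: "orbsum 6 4 2 0 (vec4 p q r (1)) = (924887 + 1496447*t)" by (simp add: powers, (simp add: coords algebra_simps t tt)?)
  have v2: "orbsum 6 4 0 2 (vec4 p q r (1)) = (913942 + 1478737*t)" by (simp add: powers, (simp add: coords algebra_simps t tt)?)
  have v3: "orbsum 4 4 4 0 (vec4 p q r (1)) = (758547 + 1227312*t)" by (simp add: powers, (simp add: coords algebra_simps t tt)?)
  have v4: "orbsum 6 2 2 2 (vec4 p q r (1)) = (256320 + 414720*t)" by (simp add: powers, (simp add: coords algebra_simps t tt)?)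
  have v5: "orbsum 4 4 2 2 (vec4 p q r (1)) = (170880 + 276480*t)" by (simp add: powers, (simp add: coords algebra_simps t tt)?)
  have v6: "orbsum 9 1 1 1 (vec4 p q r (1)) = (-1108032 + -1792896*t)" by (simp add: powers, (simp add: coords algebra_simps t tt)?)
  have v7: "orbsum 7 3 1 1 (vec4 p q r (1)) = (-619288 + -1002064*t)" by (simp add: powers, (simp add: coords algebra_simps t tt)?)
  have v8: "orbsum 5 5 1 1 (vec4 p q r (1)) = (-547648 + -886144*t)" by (simp add: powers, (simp add: coords algebra_simps t tt)?)
  have v9: "orbsum 5 3 3 1 (vec4 p q r (1)) = (-297704 + -481712*t)" by (simp add: powers, (simp add: coords algebra_simps t tt)?)
  have v10: "orbsum 3 3 3 3 (vec4 p q r (1)) = (-95520 + -154560*t)" by (simp add: powers, (simp add: coords algebra_simps t tt)?)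
  show "orbsum 8 2 2 0 (vec4 (2*t) ((1 + 1*t)) ((-2 + -1*t)) (1)) = (1185747 + 1918512*t)" "orbsum 6 4 2 0 (vec4 (2*t) ((1 + 1*t)) ((-2 + -1*t)) (1)) = (924887 + 1496447*t)" "orbsum 6 4 0 2 (vec4 (2*t) ((1 + 1*t)) ((-2 + -1*t)) (1)) = (913942 + 1478737*t)" "orbsum 4 4 4 0 (vec4 (2*t) ((1 + 1*t)) ((-2 + -1*t)) (1)) = (758547 + 1227312*t)" "orbsum 6 2 2 2 (vec4 (2*t) ((1 + 1*t)) ((-2 + -1*t)) (1)) = (256320 + 414720*t)" "orbsum 4 4 2 2 (vec4 (2*t) ((1 + 1*t)) ((-2 + -1*t)) (1)) = (170880 + 276480*t)" "orbsum 9 1 1 1 (vec4 (2*t) ((1 + 1*t)) ((-2 + -1*t)) (1)) = (-1108032 + -1792896*t)" "orbsum 7 3 1 1 (vec4 (2*t) ((1 + 1*t)) ((-2 + -1*t)) (1)) = (-619288 + -1002064*t)" "orbsum 5 5 1 1 (vec4 (2*t) ((1 + 1*t)) ((-2 + -1*t)) (1)) = (-547648 + -886144*t)" "orbsum 5 3 3 1 (vec4 (2*t) ((1 + 1*t)) ((-2 + -1*t)) (1)) = (-297704 + -481712*t)" "orbsum 3 3 3 3 (vec4 (2*t) ((1 + 1*t)) ((-2 + -1*t)) (1)) = (-95520 + -154560*t)"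
    using v0 v1 v2 v3 v4 v5 v6 v7 v8 v9 v10 by (simp_all only: p_def q_def r_def)
qed

section \<open>The linear systems for the coefficients of an invariant\<close>

lemma eq_0_of_mult_eq_0: "c * x = 0 \<Longrightarrow> c \<noteq> 0 \<Longrightarrow> x = 0" for c :: complex
  by simp

text \<open>The equations are the values at (1, 0, s, 0) for s = 0, 1, 2, 3. After the first unknown
  is removed, the integer multipliers are rows of the inverse of the remaining 3 by 3 matrix,
  cleared of denominators.\<close>

lemma planar_coefficients_vanish:
  fixes b0 b1 b2 b3 :: complex
  assumes p0: "3*b0 = 0"
    and p1: "6*b0 + 2*b1 + 2*b2 + 2*b3 = 0"
    and p2: "12291*b0 + 1028*b1 + 272*b2 + 128*b3 = 0"
    and p3: "1594326*b0 + 59058*b1 + 6642*b2 + 1458*b3 = 0"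
  shows "b0 = 0 \<and> b1 = 0 \<and> b2 = 0 \<and> b3 = 0"
proof -
  have b0: "b0 = 0" using p0 by simp
  have p1': "2*b1 + 2*b2 + 2*b3 = 0" using p1 b0 by simp
  have p2': "1028*b1 + 272*b2 + 128*b3 = 0" using p2 b0 by simp
  have p3': "59058*b1 + 6642*b2 + 1458*b3 = 0" using p3 b0 by simp
  have "25200 * (b1) = 1575 * (2*b1 + 2*b2 + 2*b3) + -36 * (1028*b1 + 272*b2 + 128*b3) + 1 * (59058*b1 + 6642*b2 + 1458*b3)"
    by (simp add: algebra_simps)
  then have "25200 * (b1) = 0" by (simp only: p1' p2' p3' mult_zero_right add_0_left)
  then have b1: "b1 = 0" by (rule eq_0_of_mult_eq_0) simp
  have "4032 * (b2) = -3367 * (2*b1 + 2*b2 + 2*b3) + 64 * (1028*b1 + 272*b2 + 128*b3) + -1 * (59058*b1 + 6642*b2 + 1458*b3)"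
    by (simp add: algebra_simps)
  then have "4032 * (b2) = 0" by (simp only: p1' p2' p3' mult_zero_right add_0_left)
  then have b2: "b2 = 0" by (rule eq_0_of_mult_eq_0) simp
  have "14400 * (b3) = 18325 * (2*b1 + 2*b2 + 2*b3) + -208 * (1028*b1 + 272*b2 + 128*b3) + 3 * (59058*b1 + 6642*b2 + 1458*b3)"
    by (simp add: algebra_simps)
  then have "14400 * (b3) = 0" by (simp only: p1' p2' p3' mult_zero_right add_0_left)
  then have b3: "b3 = 0" by (rule eq_0_of_mult_eq_0) simp
  show ?thesis using b0 b1 b2 b3 by simp
qed

text \<open>The equations e come from images of the plane under the tetrahedral elements S and S^2
  and leave five free unknowns b4, b5, b7, b10, b11. The equations g come from the five-fold element
  U and remove these as well.\<close>

lemma invariant_coefficients_vanish: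
  fixes t b4 b5 b6 b7 b8 b9 b10 b11 b12 b13 b14 :: complex
  assumes t: "t * t = t + 1"
    and e0: "12*b4 + 12*b5 + 12*b6 + 12*b7 + 12*b8 + 12*b9 + -12*b10 + -12*b11 + -12*b12 + -12*b13 + -12*b14 = 0"
    and e1: "4656*b4 + 2856*b5 + 2856*b6 + 1632*b7 + 1632*b8 + 1056*b9 + -6168*b10 + -3144*b11 + -2568*b12 + -1344*b13 + -768*b14 = 0"
    and e2: "249516*b4 + 134316*b5 + 134316*b6 + 39852*b7 + 39852*b8 + 19116*b9 + -354348*b10 + -144684*b11 + -123948*b12 + -29484*b13 + -8748*b14 = 0"
    and e3: "12*b4 + 12*b5 + 12*b6 + 12*b7 + 12*b8 + 12*b9 + 12*b10 + 12*b11 + 12*b12 + 12*b13 + 12*b14 = 0"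
    and e4: "4656*b4 + 2856*b5 + 2856*b6 + 1632*b7 + 1632*b8 + 1056*b9 + 6168*b10 + 3144*b11 + 2568*b12 + 1344*b13 + 768*b14 = 0"
    and e5: "249516*b4 + 134316*b5 + 134316*b6 + 39852*b7 + 39852*b8 + 19116*b9 + 354348*b10 + 144684*b11 + 123948*b12 + 29484*b13 + 8748*b14 = 0"
    and g0: "1908*b4 + 468*b5 + 468*b6 + 228*b7 + 420*b8 + 180*b9 + (1884 + -3768*t)*b10 + (396 + -792*t)*b11 + (156 + -312*t)*b12 + (108 + -216*t)*b13 + (60 + -120*t)*b14 = 0"
    and g1: "(12987 + 20768*t)*b4 + (7407 + 11943*t)*b5 + (7542 + 12153*t)*b6 + (5259 + 8496*t)*b7 + (4224 + 6816*t)*b8 + (2752 + 4448*t)*b9 + (-17376 + -28704*t)*b10 + (-7808 + -12712*t)*b11 + (-5856 + -9504*t)*b12 + (-3648 + -5912*t)*b13 + (-2016 + -3264*t)*b14 = 0"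
    and g2: "(13603 + 21776*t)*b4 + (2823 + 4431*t)*b5 + (2358 + 3681*t)*b6 + (771 + 1152*t)*b7 + (1056 + 1632*t)*b8 + (288 + 416*t)*b9 + (-32256 + -52512*t)*b10 + (-4248 + -7016*t)*b11 + (-1536 + -2592*t)*b12 + (-488 + -856*t)*b13 + (-96 + -192*t)*b14 = 0"
    and g3: "19*b4 + (7 + -1*t)*b5 + (6 + 1*t)*b6 + 3*b7 = 0"
    and g4: "(1185747 + 1918512*t)*b4 + (924887 + 1496447*t)*b5 + (913942 + 1478737*t)*b6 + (758547 + 1227312*t)*b7 + (256320 + 414720*t)*b8 + (170880 + 276480*t)*b9 + (-1108032 + -1792896*t)*b10 + (-619288 + -1002064*t)*b11 + (-547648 + -886144*t)*b12 + (-297704 + -481712*t)*b13 + (-95520 + -154560*t)*b14 = 0"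
  shows "b4 = 0 \<and> b5 = 0 \<and> b6 = 0 \<and> b7 = 0 \<and> b8 = 0 \<and> b9 = 0 \<and> b10 = 0 \<and> b11 = 0 \<and> b12 = 0 \<and> b13 = 0 \<and> b14 = 0"
proof -
  let ?e0 = "12*b4 + 12*b5 + 12*b6 + 12*b7 + 12*b8 + 12*b9 + -12*b10 + -12*b11 + -12*b12 + -12*b13 + -12*b14"
  let ?e1 = "4656*b4 + 2856*b5 + 2856*b6 + 1632*b7 + 1632*b8 + 1056*b9 + -6168*b10 + -3144*b11 + -2568*b12 + -1344*b13 + -768*b14"
  let ?e2 = "249516*b4 + 134316*b5 + 134316*b6 + 39852*b7 + 39852*b8 + 19116*b9 + -354348*b10 + -144684*b11 + -123948*b12 + -29484*b13 + -8748*b14"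
  let ?e3 = "12*b4 + 12*b5 + 12*b6 + 12*b7 + 12*b8 + 12*b9 + 12*b10 + 12*b11 + 12*b12 + 12*b13 + 12*b14"
  let ?e4 = "4656*b4 + 2856*b5 + 2856*b6 + 1632*b7 + 1632*b8 + 1056*b9 + 6168*b10 + 3144*b11 + 2568*b12 + 1344*b13 + 768*b14"
  let ?e5 = "249516*b4 + 134316*b5 + 134316*b6 + 39852*b7 + 39852*b8 + 19116*b9 + 354348*b10 + 144684*b11 + 123948*b12 + 29484*b13 + 8748*b14"
  \<comment> \<open>From here on the left sides of the equations g after the six relations
    \<open>s0\<close> to \<open>s5\<close> have been substituted.\<close>
  let ?g0 = "1152*b4 + -192*b7 + (1536 + -3072*t)*b10 + (192 + -384*t)*b11"
  let ?g1 = "(655 + 910*t)*b4 + (-135 + -210*t)*b5 + (1035 + 1680*t)*b7 + (-3840 + -6720*t)*b10 + (-320 + -560*t)*b11"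
  let ?g2 = "(9175 + 14830*t)*b4 + (465 + 750*t)*b5 + (-285 + -480*t)*b7 + (-27840 + -45120*t)*b10 + (-2320 + -3760*t)*b11"
  let ?g3 = "(7 + -2*t)*b4 + (1 + -2*t)*b5 + 3*b7"
  let ?g4 = "(-471257 + -762482*t)*b4 + (10945 + 17710*t)*b5 + (502227 + 812592*t)*b7 + (343872 + 556416*t)*b10 + (130544 + 211232*t)*b11"
  have tt: "t * (t * x) = t * x + x" for x using t by (metis distrib_right mult.assoc mult_1)
  \<comment> \<open>The rows e0, e1, e2 differ from e3, e4, e5 only in the sign of b10 to b14. Sums
    of corresponding rows therefore isolate the even exponents and differences the odd ones, and
    integer multipliers then perform the elimination within each half.\<close>
  have "100800 * (b6 + 2*b4 + b5) = 1575 * ?e0 + -36 * ?e1 + 1 * ?e2 + 1575 * ?e3 + -36 * ?e4 + 1 * ?e5"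
    by (simp add: algebra_simps t tt)
  then have "100800 * (b6 + 2*b4 + b5) = 0" by (simp only: e0 e1 e2 e3 e4 e5 mult_zero_right add_0_left)
  then have r0: "b6 + 2*b4 + b5 = 0" by (rule eq_0_of_mult_eq_0) simp
  have "32256 * (b8 + b7) = -4039 * ?e0 + 64 * ?e1 + -1 * ?e2 + -4039 * ?e3 + 64 * ?e4 + -1 * ?e5"
    by (simp add: algebra_simps t tt)
  then have "32256 * (b8 + b7) = 0" by (simp only: e0 e1 e2 e3 e4 e5 mult_zero_right add_0_left)
  then have r1: "b8 + b7 = 0" by (rule eq_0_of_mult_eq_0) simp
  have "806400 * (b9 - b4) = 121975 * ?e0 + -1312 * ?e1 + 17 * ?e2 + 121975 * ?e3 + -1312 * ?e4 + 17 * ?e5"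
    by (simp add: algebra_simps t tt)
  then have "806400 * (b9 - b4) = 0" by (simp only: e0 e1 e2 e3 e4 e5 mult_zero_right add_0_left)
  then have r2: "b9 - b4 = 0" by (rule eq_0_of_mult_eq_0) simp
  have "100800 * (b12 + 3*b10 + b11) = -1575 * ?e0 + 36 * ?e1 + -1 * ?e2 + 1575 * ?e3 + -36 * ?e4 + 1 * ?e5"
    by (simp add: algebra_simps t tt)
  then have "100800 * (b12 + 3*b10 + b11) = 0" by (simp only: e0 e1 e2 e3 e4 e5 mult_zero_right add_0_left)
  then have r3: "b12 + 3*b10 + b11 = 0" by (rule eq_0_of_mult_eq_0) simp
  have "32256 * (b13 + b11) = 3367 * ?e0 + -64 * ?e1 + 1 * ?e2 + -3367 * ?e3 + 64 * ?e4 + -1 * ?e5"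
    by (simp add: algebra_simps t tt)
  then have "32256 * (b13 + b11) = 0" by (simp only: e0 e1 e2 e3 e4 e5 mult_zero_right add_0_left)
  then have r4: "b13 + b11 = 0" by (rule eq_0_of_mult_eq_0) simp
  have "806400 * (b14 - 2*b10 - b11) = -105175 * ?e0 + 1312 * ?e1 + -17 * ?e2 + 105175 * ?e3 + -1312 * ?e4 + 17 * ?e5"
    by (simp add: algebra_simps t tt)
  then have "806400 * (b14 - 2*b10 - b11) = 0" by (simp only: e0 e1 e2 e3 e4 e5 mult_zero_right add_0_left)
  then have r5: "b14 - 2*b10 - b11 = 0" by (rule eq_0_of_mult_eq_0) simp
  have s0: "b6 = - 2*b4 - b5" using r0 by algebra
  have s1: "b8 = - b7" using r1 by algebra
  have s2: "b9 = b4" using r2 by algebra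
  have s3: "b12 = - 3*b10 - b11" using r3 by algebra
  have s4: "b13 = - b11" using r4 by algebra
  have s5: "b14 = 2*b10 + b11" using r5 by algebra
  have g0': "1152*b4 + -192*b7 + (1536 + -3072*t)*b10 + (192 + -384*t)*b11 = 0"
    using g0 by (simp add: algebra_simps s0 s1 s2 s3 s4 s5)
  have g1': "(655 + 910*t)*b4 + (-135 + -210*t)*b5 + (1035 + 1680*t)*b7 + (-3840 + -6720*t)*b10 + (-320 + -560*t)*b11 = 0"
    using g1 by (simp add: algebra_simps s0 s1 s2 s3 s4 s5)
  have g2': "(9175 + 14830*t)*b4 + (465 + 750*t)*b5 + (-285 + -480*t)*b7 + (-27840 + -45120*t)*b10 + (-2320 + -3760*t)*b11 = 0"
    using g2 by (simp add: algebra_simps s0 s1 s2 s3 s4 s5)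
  have g3': "(7 + -2*t)*b4 + (1 + -2*t)*b5 + 3*b7 = 0"
    using g3 by (simp add: algebra_simps s0 s1 s2 s3 s4 s5)
  have g4': "(-471257 + -762482*t)*b4 + (10945 + 17710*t)*b5 + (502227 + 812592*t)*b7 + (343872 + 556416*t)*b10 + (130544 + 211232*t)*b11 = 0"
    using g4 by (simp add: algebra_simps s0 s1 s2 s3 s4 s5)
  \<comment> \<open>The multipliers lie in the ring generated by t: they are rows of the inverse of
    the 5 by 5 matrix over that quadratic field, scaled to be integral.\<close>
  have "5120 * (b4) = 40 * ?g0 + (-44 + 23*t) * ?g1 + (-1581 + 977*t) * ?g2 + 1580 * ?g3 + (1165 + -720*t) * ?g4"
    by (simp add: algebra_simps t tt)
  then have "5120 * (b4) = 0" by (simp only: g0' g1' g2' g3' g4' mult_zero_right add_0_left)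
  then have z0: "b4 = 0" by (rule eq_0_of_mult_eq_0) simp
  have "5120 * (b5) = (-120 + 160*t) * ?g0 + (304 + -201*t) * ?g1 + (8107 + -5011*t) * ?g2 + (-3380 + 3600*t) * ?g3 + (-6375 + 3940*t) * ?g4"
    by (simp add: algebra_simps t tt)
  then have "5120 * (b5) = 0" by (simp only: g0' g1' g2' g3' g4' mult_zero_right add_0_left)
  then have z1: "b5 = 0" by (rule eq_0_of_mult_eq_0) simp
  have "3840 * (b7) = 40 * ?g0 + (-88 + 51*t) * ?g1 + (-1277 + 789*t) * ?g2 + 1160 * ?g3 + (1165 + -720*t) * ?g4"
    by (simp add: algebra_simps t tt)
  then have "3840 * (b7) = 0" by (simp only: g0' g1' g2' g3' g4' mult_zero_right add_0_left)
  then have z2: "b7 = 0" by (rule eq_0_of_mult_eq_0) simp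
  have "19200 * (b10) = (-45 + 90*t) * ?g0 + (256 + -167*t) * ?g1 + (3311 + -2047*t) * ?g2 + (-1250 + 2500*t) * ?g3 + (-2605 + 1610*t) * ?g4"
    by (simp add: algebra_simps t tt)
  then have "19200 * (b10) = 0" by (simp only: g0' g1' g2' g3' g4' mult_zero_right add_0_left)
  then have z3: "b10 = 0" by (rule eq_0_of_mult_eq_0) simp
  have "12800 * (b11) = (160 + -320*t) * ?g0 + (-1222 + 779*t) * ?g1 + (-8957 + 5539*t) * ?g2 + (2700 + -5400*t) * ?g3 + (7815 + -4830*t) * ?g4"
    by (simp add: algebra_simps t tt)
  then have "12800 * (b11) = 0" by (simp only: g0' g1' g2' g3' g4' mult_zero_right add_0_left)
  then have z4: "b11 = 0" by (rule eq_0_of_mult_eq_0) simp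
  show ?thesis
    using z0 z1 z2 z3 z4 s0 s1 s2 s3 s4 s5 by simp
qed

section \<open>Exponents up to even permutations\<close>

definition even_perms :: "nat \<Rightarrow> nat \<Rightarrow> nat \<Rightarrow> nat \<Rightarrow> (nat \<times> nat \<times> nat \<times> nat) list" where
  "even_perms i j k l =
    [(i, j, k, l), (j, i, l, k), (k, l, i, j), (l, k, j, i), (i, k, l, j), (k, i, j, l),
     (l, j, i, k), (j, l, k, i), (i, l, j, k), (l, i, k, j), (j, k, i, l), (k, j, l, i)]"

text \<open>The exponent vectors of degree twelve with all entries of equal parity, up to even
  permutations. Where an entry is repeated, odd permutations give nothing new; (6, 4, 2, 0) has
  distinct entries and therefore needs the second representative (6, 4, 0, 2).\<close>

definition exponent_reps :: "(nat \<times> nat \<times> nat \<times> nat) list" where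
  "exponent_reps = [(12, 0, 0, 0), (10, 2, 0, 0), (8, 4, 0, 0), (6, 6, 0, 0), (8, 2, 2, 0), (6, 4, 2, 0),
    (6, 4, 0, 2), (4, 4, 4, 0), (6, 2, 2, 2), (4, 4, 2, 2), (9, 1, 1, 1), (7, 3, 1, 1), (5, 5, 1, 1),
    (5, 3, 3, 1), (3, 3, 3, 3)]"

lemma orbsum_even_perms:
  "(i', j', k', l') \<in> set (even_perms i j k l) \<Longrightarrow> orbsum i' j' k' l' = orbsum i j k l"
  unfolding even_perms_def list.set insert_iff empty_iff prod.inject
  by (elim disjE conjE FalseE; hypsubst; rule ext; simp add: orbsum_def ac_simps)

definition represented :: "nat \<Rightarrow> nat \<Rightarrow> nat \<Rightarrow> nat \<Rightarrow> bool" where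
  "represented i j k l \<longleftrightarrow> (\<exists>p\<in>set (even_perms i j k l). p \<in> set exponent_reps)"

lemma all_less_7: "(\<forall>i<7. Q i) \<longleftrightarrow> Q 0 \<and> Q 1 \<and> Q 2 \<and> Q 3 \<and> Q 4 \<and> Q 5 \<and> Q (6::nat)"
  by (simp add: numeral_eq_Suc All_less_Suc conj_ac)

lemma even_exponents_cover_all:
  "\<forall>i<7. \<forall>j<7. \<forall>k<7. i + j + k \<le> 6 \<longrightarrow> represented (2*i) (2*j) (2*k) (2*(6-(i+j+k)))"
  unfolding all_less_7
  by (simp del: One_nat_def, (intro conjI)?; simp add: represented_def even_perms_def exponent_reps_def)

lemma odd_exponents_cover_all:
  "\<forall>i<7. \<forall>j<7. \<forall>k<7. i + j + k \<le> 4 \<longrightarrow> represented (2*i+1) (2*j+1) (2*k+1) (2*(4-(i+j+k))+1)"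
  unfolding all_less_7
  by (simp del: One_nat_def, (intro conjI)?; simp add: represented_def even_perms_def exponent_reps_def)

lemma even_exponents_cover:
  assumes "i + j + k + l = 6" shows "represented (2*i) (2*j) (2*k) (2*l)"
proof -
  have "i < 7" "j < 7" "k < 7" "i + j + k \<le> 6" "l = 6 - (i + j + k)" using assms by auto
  then show ?thesis using even_exponents_cover_all by blast
qed

lemma odd_exponents_cover:
  assumes "i + j + k + l = 4" shows "represented (2*i+1) (2*j+1) (2*k+1) (2*l+1)"
proof -
  have "i < 7" "j < 7" "k < 7" "i + j + k \<le> 4" "l = 4 - (i + j + k)" using assms by auto
  then show ?thesis using odd_exponents_cover_all by blast
qed

text \<open>The parity conditions make the first three exponents congruent mod 2, and the even total
  adds the fourth. Halving reduces both cases to a finite check on small exponents.\<close>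

lemma exponent_reps_cover:
  assumes sum: "i + j + k + l = 12" and par: "even (i + j)" "even (j + k)"
  shows "\<exists>n<15. orbsum i j k l = (case exponent_reps ! n of (i', j', k', l') \<Rightarrow> orbsum i' j' k' l')"
proof -
  have "even l \<longleftrightarrow> even i" using par arg_cong[OF sum, of even] by auto
  have "\<exists>p\<in>set (even_perms i j k l). p \<in> set exponent_reps"
  proof (cases "even i")
    case True
    then obtain i' j' k' l' where *: "i = 2 * i'" "j = 2 * j'" "k = 2 * k'" "l = 2 * l'"
      using par \<open>even l \<longleftrightarrow> even i\<close> by (auto elim!: evenE)
    then show ?thesis using even_exponents_cover sum unfolding * represented_def by simp
  next
    case False
    then obtain i' j' k' l' where *: "i = 2 * i' + 1" "j = 2 * j' + 1" "k = 2 * k' + 1" "l = 2 * l' + 1"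
      using par \<open>even l \<longleftrightarrow> even i\<close> by (auto elim!: oddE)
    then show ?thesis using odd_exponents_cover sum unfolding * represented_def by simp
  qed
  then obtain i' j' k' l' where *: "(i', j', k', l') \<in> set (even_perms i j k l)" "(i', j', k', l') \<in> set exponent_reps"
    by (metis prod_cases4)
  then obtain n where "n < length exponent_reps" "exponent_reps ! n = (i', j', k', l')"
    by (auto simp: in_set_conv_nth)
  then show ?thesis
    using orbsum_even_perms[OF *(1)] by (intro exI[of _ n]) (simp add: exponent_reps_def)
qed

lemma sum_regroup:
  fixes N :: nat and c :: "'a \<Rightarrow> complex" and f :: "'a \<Rightarrow> 'b \<Rightarrow> complex"
  assumes "finite E" "\<And>e. e \<in> E \<Longrightarrow> \<exists>n<N. f e = g n"
  shows "\<exists>b. \<forall>x. (\<Sum>e\<in>E. c e * f e x) = (\<Sum>n<N. b n * g n x)"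
proof -
  obtain \<iota> where \<iota>: "\<And>e. e \<in> E \<Longrightarrow> \<iota> e < N \<and> f e = g (\<iota> e)" using assms(2) by metis
  have "(\<Sum>e\<in>E. c e * f e x) = (\<Sum>n<N. (\<Sum>e\<in>{e \<in> E. \<iota> e = n}. c e) * g n x)" for x
  proof -
    have "(\<Sum>e\<in>E. c e * f e x) = (\<Sum>n<N. \<Sum>e\<in>{e \<in> E. \<iota> e = n}. c e * f e x)"
      using \<iota> by (intro sum.group[symmetric] assms(1)) auto
    also have "\<dots> = (\<Sum>n<N. (\<Sum>e\<in>{e \<in> E. \<iota> e = n}. c e) * g n x)"
      unfolding sum_distrib_right using \<iota> by (intro sum.cong refl) auto
    finally show ?thesis .
  qed
  then show ?thesis by (intro exI[of _ "\<lambda>n. \<Sum>e\<in>{e \<in> E. \<iota> e = n}. c e"] allI)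
qed

section \<open>An invariant is determined by its values on the plane\<close>

lemma IO_invariants_cact:
  assumes "P \<in> IO_invariants d" "g \<in> binary_icosahedral" "h \<in> binary_octahedral"
  shows "P (cact g h x) = P x"
proof -
  have "P (complex_act (double_cover g h) x) = P x"
    using assms(1) double_cover_in_IO[OF assms(2,3)] by (auto simp: IO_invariants_def)
  then show ?thesis
    using complex_act_double_cover[OF hnorm_binary(2)[OF assms(3)]] by (simp only: cact_def)
qed

lemma cact_vec4:
  "cact (vec4 a b c d) (vec4 a' b' c' d') (vec4 x y z w) =
    vec4 (complex_of_real a) (of_real b) (of_real c) (of_real d) \<star> vec4 x y z w \<star>
    vec4 (of_real a') (- of_real b') (- of_real c') (- of_real d')"
  by (simp add: cact_def cvec_vec4)

text \<open>The first three are the conjugations by i, j, k, the next three the left multiplications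
  by them, the last the conjugation by S. Together they supply the sign changes and the even
  permutations over which an invariant is averaged.\<close>

lemma IO_invariants_symmetries:
  assumes P: "P \<in> IO_invariants d"
  shows "P (vec4 x y (- z) (- w)) = P (vec4 x y z w)" "P (vec4 x (- y) z (- w)) = P (vec4 x y z w)"
    "P (vec4 x (- y) (- z) w) = P (vec4 x y z w)"
    "P (vec4 (- y) x (- w) z) = P (vec4 x y z w)" "P (vec4 (- z) w x (- y)) = P (vec4 x y z w)"
    "P (vec4 (- w) (- z) y x) = P (vec4 x y z w)" "P (vec4 x (- z) (- w) y) = P (vec4 x y z w)"
proof -
  have T: "{vec4 0 1 0 0, vec4 0 0 1 0, vec4 0 0 0 1, vec4 1 0 0 0, vec4 (1/2) (1/2) (-1/2) (1/2)} \<subseteq> hurwitz_units"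
    by (simp add: vec4_in_hurwitz_units)
  have *: "P (cact g h v) = P v" if "g \<in> hurwitz_units" "h \<in> hurwitz_units" for g h v
    using IO_invariants_cact[OF P] that hurwitz_units_subset_binary by blast
  show "P (vec4 x y (- z) (- w)) = P (vec4 x y z w)"
    using *[of "vec4 0 1 0 0" "vec4 0 1 0 0" "vec4 x y z w"] T by (simp add: cact_vec4)
  show "P (vec4 x (- y) z (- w)) = P (vec4 x y z w)"
    using *[of "vec4 0 0 1 0" "vec4 0 0 1 0" "vec4 x y z w"] T by (simp add: cact_vec4)
  show "P (vec4 x (- y) (- z) w) = P (vec4 x y z w)"
    using *[of "vec4 0 0 0 1" "vec4 0 0 0 1" "vec4 x y z w"] T by (simp add: cact_vec4)
  show "P (vec4 (- y) x (- w) z) = P (vec4 x y z w)"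
    using *[of "vec4 0 1 0 0" "vec4 1 0 0 0" "vec4 x y z w"] T by (simp add: cact_vec4)
  show "P (vec4 (- z) w x (- y)) = P (vec4 x y z w)"
    using *[of "vec4 0 0 1 0" "vec4 1 0 0 0" "vec4 x y z w"] T by (simp add: cact_vec4)
  show "P (vec4 (- w) (- z) y x) = P (vec4 x y z w)"
    using *[of "vec4 0 0 0 1" "vec4 1 0 0 0" "vec4 x y z w"] T by (simp add: cact_vec4)
  have "cact (vec4 (1/2) (1/2) (-1/2) (1/2)) (vec4 (1/2) (1/2) (-1/2) (1/2)) (vec4 x y z w) = vec4 x (- z) (- w) y"
    by (simp add: cact_vec4 field_simps)
  then show "P (vec4 x (- z) (- w) y) = P (vec4 x y z w)"
    using *[of "vec4 (1/2) (1/2) (-1/2) (1/2)" "vec4 (1/2) (1/2) (-1/2) (1/2)" "vec4 x y z w"] T by simp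
qed

lemma IO_invariants_span:
  assumes P: "P \<in> IO_invariants 12"
  shows "\<exists>b. \<forall>x. P x = (\<Sum>n<15. b n * (case exponent_reps ! n of (i, j, k, l) \<Rightarrow> orbsum i j k l) x)"
proof -
  define m where "m e x = (x$0) ^ e 0 * (x$1) ^ e 1 * (x$2) ^ e 2 * (x$3) ^ e (3::4)" for e :: "4 \<Rightarrow> nat" and x :: "complex ^ 4"
  define E where "E = {e \<in> exponents 12. even (e 0 + e 1) \<and> even (e 1 + e 2)}"
  obtain a where a: "\<And>x. P x = (\<Sum>e\<in>exponents 12. a e * m e x)"
    using P unfolding IO_invariants_def homogeneous_polys_def m_def by (auto simp: prod_index4)
  note sym = IO_invariants_symmetries[OF P]
  have PE: "P v = (\<Sum>e\<in>E. a e * m e v)" for v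
  proof -
    obtain x y z w where v: "v = vec4 x y z w" by (rule vec4_exhaust)
    let ?s = "\<lambda>e. m e (vec4 x y z w) + m e (vec4 x y (- z) (- w)) + m e (vec4 x (- y) z (- w)) + m e (vec4 x (- y) (- z) w)"
    \<comment> \<open>Averaging over the four sign changes cancels every monomial whose exponents
      are not all of one parity and multiplies the remaining ones by four.\<close>
    have "4 * P v = P (vec4 x y z w) + P (vec4 x y (- z) (- w)) + P (vec4 x (- y) z (- w)) + P (vec4 x (- y) (- z) w)"
      by (simp add: sym v)
    also have "\<dots> = (\<Sum>e\<in>exponents 12. a e * ?s e)"
      by (simp add: a distrib_left sum.distrib)
    also have "\<dots> = (\<Sum>e\<in>exponents 12. if e \<in> E then 4 * (a e * m e v) else 0)"
    proof (intro sum.cong refl)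
      fix e assume e: "e \<in> exponents 12"
      then have "even (e 0 + e 1 + e 2 + e 3)" by (simp add: exponents_def sum_index4)
      then show "a e * ?s e = (if e \<in> E then 4 * (a e * m e v) else 0)"
        using e by (cases "even (e 1)"; cases "even (e 2)"; cases "even (e 3)")
          (simp_all add: E_def m_def v)
    qed
    also have "\<dots> = 4 * (\<Sum>e\<in>E. a e * m e v)"
      by (simp add: sum.If_cases finite_exponents sum_distrib_left E_def Int_def)
    finally show ?thesis by simp
  qed
  have "P v = (\<Sum>e\<in>E. (a e / 12) * orbsum (e 0) (e 1) (e 2) (e 3) v)" for v
  proof -
    obtain x y z w where v: "v = vec4 x y z w" by (rule vec4_exhaust)
    \<comment> \<open>The twelve even permutations of the coordinates as the group realizes them,
      each with an even number of minus signs. On monomials whose exponents all have the same parity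
      these signs cancel.\<close>
    let ?V = "[vec4 x y z w, vec4 (- y) x (- w) z, vec4 (- z) w x (- y), vec4 (- w) (- z) y x,
      vec4 x (- z) (- w) y, vec4 z x (- y) (- w), vec4 w y x z, vec4 (- y) w (- z) x,
      vec4 x w (- y) (- z), vec4 (- w) x z (- y), vec4 y (- z) x (- w), vec4 z y w x]"
    have L: "P (vec4 (- b) a (- d) c) = P (vec4 a b c d)" "P (vec4 (- c) d a (- b)) = P (vec4 a b c d)"
      "P (vec4 (- d) (- c) b a) = P (vec4 a b c d)" for a b c d
      by (rule sym)+
    have C1: "P (vec4 x (- z) (- w) y) = P v" unfolding v by (rule sym)
    have C2: "P (vec4 x w (- y) (- z)) = P v"
      using sym(7)[where x=x and y="- z" and z="- w" and w=y] unfolding minus_minus C1 .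
    have Vv1: "P (vec4 (- y) x (- w) z) = P v"
      using L(1)[where a="x" and b="y" and c="z" and d="w"] unfolding minus_minus v[symmetric] .
    have Vv2: "P (vec4 (- z) w x (- y)) = P v"
      using L(2)[where a="x" and b="y" and c="z" and d="w"] unfolding minus_minus v[symmetric] .
    have Vv3: "P (vec4 (- w) (- z) y x) = P v"
      using L(3)[where a="x" and b="y" and c="z" and d="w"] unfolding minus_minus v[symmetric] .
    have VC11: "P (vec4 z x (- y) (- w)) = P v"
      using L(1)[where a="x" and b="- z" and c="- w" and d="y"] unfolding minus_minus C1 .
    have VC12: "P (vec4 w y x z) = P v"
      using L(2)[where a="x" and b="- z" and c="- w" and d="y"] unfolding minus_minus C1 .
    have VC13: "P (vec4 (- y) w (- z) x) = P v"
      using L(3)[where a="x" and b="- z" and c="- w" and d="y"] unfolding minus_minus C1 .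
    have VC21: "P (vec4 (- w) x z (- y)) = P v"
      using L(1)[where a="x" and b="w" and c="- y" and d="- z"] unfolding minus_minus C2 .
    have VC22: "P (vec4 y (- z) x (- w)) = P v"
      using L(2)[where a="x" and b="w" and c="- y" and d="- z"] unfolding minus_minus C2 .
    have VC23: "P (vec4 z y w x) = P v"
      using L(3)[where a="x" and b="w" and c="- y" and d="- z"] unfolding minus_minus C2 .
    have "12 * P v = (\<Sum>u\<leftarrow>?V. P u)"
      by (simp add: C1 C2 Vv1 Vv2 Vv3 VC11 VC12 VC13 VC21 VC22 VC23 flip: v)
    also have "\<dots> = (\<Sum>e\<in>E. a e * (\<Sum>u\<leftarrow>?V. m e u))"
      by (simp add: PE distrib_left sum.distrib)
    also have "\<dots> = (\<Sum>e\<in>E. a e * orbsum (e 0) (e 1) (e 2) (e 3) v)"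
    proof (intro sum.cong refl arg_cong2[of _ _ _ _ "(*)"])
      fix e assume e: "e \<in> E"
      then have par: "even (e 1) \<longleftrightarrow> even (e 0)" "even (e 2) \<longleftrightarrow> even (e 0)" "even (e 3) \<longleftrightarrow> even (e 0)"
        by (auto simp: E_def exponents_def sum_index4 dest: arg_cong[of _ 12 even])
      show "(\<Sum>u\<leftarrow>?V. m e u) = orbsum (e 0) (e 1) (e 2) (e 3) v"
        by (cases "even (e 0)") (simp_all add: m_def orbsum_def v par)
    qed
    finally have eq: "12 * P v = (\<Sum>e\<in>E. a e * orbsum (e 0) (e 1) (e 2) (e 3) v)" .
    have "P v = 12 * P v / 12" by simp
    then show ?thesis unfolding eq by (simp add: sum_divide_distrib)
  qed
  moreover have "\<exists>b. \<forall>x. (\<Sum>e\<in>E. (a e / 12) * orbsum (e 0) (e 1) (e 2) (e 3) x) =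
      (\<Sum>n<15. b n * (case exponent_reps ! n of (i, j, k, l) \<Rightarrow> orbsum i j k l) x)"
  proof (rule sum_regroup)
    show "finite E" by (simp add: E_def finite_exponents)
    fix e assume "e \<in> E"
    then show "\<exists>n<15. orbsum (e 0) (e 1) (e 2) (e 3) = (case exponent_reps ! n of (i, j, k, l) \<Rightarrow> orbsum i j k l)"
      by (intro exponent_reps_cover) (auto simp: E_def exponents_def sum_index4)
  qed
  ultimately show ?thesis by simp
qed

lemma IO_invariants_determined:
  assumes P: "P \<in> IO_invariants 12" and zero: "\<And>x y. P (vec4 x 0 y 0) = 0"
  shows "P x = 0"
proof -
  obtain b where b: "\<And>x. P x = (\<Sum>n<15. b n * (case exponent_reps ! n of (i, j, k, l) \<Rightarrow> orbsum i j k l) x)"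
    using IO_invariants_span[OF P] by blast
  have Pb: "P x = b 0 * orbsum 12 0 0 0 x + b 1 * orbsum 10 2 0 0 x + b 2 * orbsum 8 4 0 0 x + b 3 * orbsum 6 6 0 0 x +
    b 4 * orbsum 8 2 2 0 x + b 5 * orbsum 6 4 2 0 x + b 6 * orbsum 6 4 0 2 x + b 7 * orbsum 4 4 4 0 x +
    b 8 * orbsum 6 2 2 2 x + b 9 * orbsum 4 4 2 2 x + b 10 * orbsum 9 1 1 1 x + b 11 * orbsum 7 3 1 1 x +
    b 12 * orbsum 5 5 1 1 x + b 13 * orbsum 5 3 3 1 x + b 14 * orbsum 3 3 3 3 x" for x
    unfolding b by (simp add: exponent_reps_def lessThan_nat_numeral lessThan_Suc ac_simps)
  have b03: "b 0 = 0 \<and> b 1 = 0 \<and> b 2 = 0 \<and> b 3 = 0"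
    using zero[of 1 0] zero[of 1 1] zero[of 1 2] zero[of 1 3] unfolding Pb
    by (intro planar_coefficients_vanish) (simp_all add: orbsum_def algebra_simps)
  have left: "P (cact g hone v) = P v" if "g \<in> binary_icosahedral" for g v
    using IO_invariants_cact[OF P that binary_closed(8)] .
  \<comment> \<open>Images of the plane under S and S^2. They provide the rational equations
    e.\<close>
  have T: "P (vec4 1 t (- t) 1) = 0" "P (vec4 (- t) t (- 1) 1) = 0" for t
  proof -
    have "vec4 (1/2) (1/2) (-1/2) (1/2) \<in> binary_icosahedral" "vec4 (-1/2) (1/2) (-1/2) (1/2) \<in> binary_icosahedral"
      by (auto intro!: subsetD[OF hurwitz_units_subset_binary(1)] simp: vec4_in_hurwitz_units)
    from this[THEN left, of "vec4 (1 + t) 0 (1 - t) 0"] zero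
    show "P (vec4 1 t (- t) 1) = 0" "P (vec4 (- t) t (- 1) 1) = 0"
      by (simp_all add: cact_vec4 field_simps)
  qed
  let ?t = "complex_of_real tau"
  \<comment> \<open>Images of the plane under twice U; the factor two avoids denominators.\<close>
  have G: "P (vec4 (?t * c - (?t - 1) * s) (- s) ((?t - 1) * c + ?t * s) c) = 0" for c s
  proof -
    have "cact quat_U hone (vec4 (2 * c) 0 (2 * s) 0) = vec4 (?t * c - (?t - 1) * s) (- s) ((?t - 1) * c + ?t * s) c"
      by (simp add: quat_U_def cact_vec4 field_simps)
    then show ?thesis using left[OF generators_in(3)] zero by metis
  qed
  have pts: "P (vec4 (- 1 + 2*?t) 1 (- 1) 1) = 0" "P (vec4 (1 + 1*?t) (1*?t) (- 2) 1) = 0"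
    "P (vec4 (- 1 + 1*?t) (- 1*?t) (2*?t) 1) = 0" "P (vec4 (1*?t) 0 (- 1 + 1*?t) 1) = 0"
    "P (vec4 (2*?t) (1 + 1*?t) (- 2 + - 1*?t) 1) = 0"
    using G[of 1 "- 1"] G[of 1 "- ?t"] G[of 1 ?t] G[of 1 0] G[of 1 "- ?t - 1"]
    by (simp_all add: algebra_simps ctau_mult ctau_mult_left)
  have "b 4 = 0 \<and> b 5 = 0 \<and> b 6 = 0 \<and> b 7 = 0 \<and> b 8 = 0 \<and> b 9 = 0 \<and> b 10 = 0 \<and> b 11 = 0 \<and>
    b 12 = 0 \<and> b 13 = 0 \<and> b 14 = 0"
  proof (rule invariant_coefficients_vanish[OF ctau_mult])
    show "12*b 4 + 12*b 5 + 12*b 6 + 12*b 7 + 12*b 8 + 12*b 9 + -12*b 10 + -12*b 11 + -12*b 12 + -12*b 13 + -12*b 14 = 0"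
      using T(1)[of 1] b03 unfolding Pb by (simp add: orbsum_def algebra_simps)
    show "4656*b 4 + 2856*b 5 + 2856*b 6 + 1632*b 7 + 1632*b 8 + 1056*b 9 + -6168*b 10 + -3144*b 11 + -2568*b 12 + -1344*b 13 + -768*b 14 = 0"
      using T(1)[of 2] b03 unfolding Pb by (simp add: orbsum_def algebra_simps)
    show "249516*b 4 + 134316*b 5 + 134316*b 6 + 39852*b 7 + 39852*b 8 + 19116*b 9 + -354348*b 10 + -144684*b 11 + -123948*b 12 + -29484*b 13 + -8748*b 14 = 0"
      using T(1)[of 3] b03 unfolding Pb by (simp add: orbsum_def algebra_simps)
    show "12*b 4 + 12*b 5 + 12*b 6 + 12*b 7 + 12*b 8 + 12*b 9 + 12*b 10 + 12*b 11 + 12*b 12 + 12*b 13 + 12*b 14 = 0"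
      using T(2)[of 1] b03 unfolding Pb by (simp add: orbsum_def algebra_simps)
    show "4656*b 4 + 2856*b 5 + 2856*b 6 + 1632*b 7 + 1632*b 8 + 1056*b 9 + 6168*b 10 + 3144*b 11 + 2568*b 12 + 1344*b 13 + 768*b 14 = 0"
      using T(2)[of 2] b03 unfolding Pb by (simp add: orbsum_def algebra_simps)
    show "249516*b 4 + 134316*b 5 + 134316*b 6 + 39852*b 7 + 39852*b 8 + 19116*b 9 + 354348*b 10 + 144684*b 11 + 123948*b 12 + 29484*b 13 + 8748*b 14 = 0"
      using T(2)[of 3] b03 unfolding Pb by (simp add: orbsum_def algebra_simps)
    show "1908*b 4 + 468*b 5 + 468*b 6 + 228*b 7 + 420*b 8 + 180*b 9 + (1884 + -3768*?t)*b 10 + (396 + -792*?t)*b 11 + (156 + -312*?t)*b 12 + (108 + -216*?t)*b 13 + (60 + -120*?t)*b 14 = 0"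
      using pts(1) b03 unfolding Pb orbsum_golden0[OF ctau_mult] by (simp add: algebra_simps)
    show "(12987 + 20768*?t)*b 4 + (7407 + 11943*?t)*b 5 + (7542 + 12153*?t)*b 6 + (5259 + 8496*?t)*b 7 + (4224 + 6816*?t)*b 8 + (2752 + 4448*?t)*b 9 + (-17376 + -28704*?t)*b 10 + (-7808 + -12712*?t)*b 11 + (-5856 + -9504*?t)*b 12 + (-3648 + -5912*?t)*b 13 + (-2016 + -3264*?t)*b 14 = 0"
      using pts(2) b03 unfolding Pb orbsum_golden1[OF ctau_mult] by (simp add: algebra_simps)
    show "(13603 + 21776*?t)*b 4 + (2823 + 4431*?t)*b 5 + (2358 + 3681*?t)*b 6 + (771 + 1152*?t)*b 7 + (1056 + 1632*?t)*b 8 + (288 + 416*?t)*b 9 + (-32256 + -52512*?t)*b 10 + (-4248 + -7016*?t)*b 11 + (-1536 + -2592*?t)*b 12 + (-488 + -856*?t)*b 13 + (-96 + -192*?t)*b 14 = 0"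
      using pts(3) b03 unfolding Pb orbsum_golden2[OF ctau_mult] by (simp add: algebra_simps)
    show "19*b 4 + (7 + -1*?t)*b 5 + (6 + 1*?t)*b 6 + 3*b 7 = 0"
      using pts(4) b03 unfolding Pb orbsum_golden3[OF ctau_mult] by (simp add: algebra_simps)
    show "(1185747 + 1918512*?t)*b 4 + (924887 + 1496447*?t)*b 5 + (913942 + 1478737*?t)*b 6 + (758547 + 1227312*?t)*b 7 + (256320 + 414720*?t)*b 8 + (170880 + 276480*?t)*b 9 + (-1108032 + -1792896*?t)*b 10 + (-619288 + -1002064*?t)*b 11 + (-547648 + -886144*?t)*b 12 + (-297704 + -481712*?t)*b 13 + (-95520 + -154560*?t)*b 14 = 0"
      using pts(5) b03 unfolding Pb orbsum_golden4[OF ctau_mult] by (simp add: algebra_simps)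
  qed
  then show ?thesis using b03 by (simp add: Pb)
qed

lemma S_IO_eq: "S_IO = frame_form"
  unfolding S_IO_def
proof (rule the_equality)
  have inv: "frame_form \<in> IO_invariants 12"
    unfolding IO_invariants_def
    using frame_form_homogeneous frame_form_invariant complex_act_double_cover
    by (auto simp: carrier_IO cact_def)
  then show *: "frame_form \<in> IO_invariants 12 \<and>
    (\<forall>x0 x2. frame_form (vec4 x0 0 x2 0) = 2 * x0^2 * x2^2 * (x0^2 - x2^2)^2 * (x0^2 + x2^2)^2)"
    using frame_form_restricted by blast
  fix P assume P: "P \<in> IO_invariants 12 \<and>
    (\<forall>x0 x2. P (vec4 x0 0 x2 0) = 2 * x0^2 * x2^2 * (x0^2 - x2^2)^2 * (x0^2 + x2^2)^2)"
  then have "(\<lambda>x. P x - frame_form x) \<in> IO_invariants 12"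
    using inv by (auto simp: IO_invariants_def intro: homogeneous_polys_diff)
  then have "P x - frame_form x = 0" for x
    by (rule IO_invariants_determined) (use P frame_form_restricted in simp)
  then show "P = frame_form" by auto
qed

section \<open>Nodes at points with a large fix group\<close>

lemma pencil_eq: "pencil l x = frame_form x + l * hnorm x ^ 6"
  by (simp add: pencil_def S_IO_eq q_eq_hnorm)

lemma pencil_homogeneous: "pencil l \<in> homogeneous_polys 12"
proof -
  have "(\<lambda>x. (x $ i)\<^sup>2) \<in> homogeneous_polys 2" for i
    using homogeneous_polys_power[OF homogeneous_polys_nth, of i 2] by simp
  then have "hnorm \<in> homogeneous_polys 2"
    unfolding hnorm_def[abs_def] by (intro homogeneous_polys_add)
  then have "(\<lambda>x. hnorm x ^ 6) \<in> homogeneous_polys 12"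
    using homogeneous_polys_power[of hnorm 2 6] by simp
  then have "(\<lambda>x. frame_form x + l * hnorm x ^ 6) \<in> homogeneous_polys 12"
    by (intro homogeneous_polys_add homogeneous_polys_cmult frame_form_homogeneous)
  then show ?thesis by (simp add: pencil_eq[abs_def])
qed

lemma pencil_invariant:
  assumes "g \<in> binary_icosahedral" "h \<in> binary_octahedral"
  shows "pencil l (cact g h x) = pencil l x"
proof -
  have "hnorm (cact g h x) = hnorm x"
    using assms by (simp add: cact_def hnorm_hmul cvec_hom)
  then show ?thesis using assms by (simp add: pencil_eq frame_form_invariant)
qed

abbreviation hi :: "complex ^ 4" where "hi \<equiv> vec4 0 1 0 0"
abbreviation hj :: "complex ^ 4" where "hj \<equiv> vec4 0 0 1 0"
abbreviation hk :: "complex ^ 4" where "hk \<equiv> vec4 0 0 0 1"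

text \<open>The vectors v, i v, j v, k v form a basis as soon as v has nonzero norm. Homogeneity
  takes care of the direction v, so only the three rotation directions and their 3 by 3 Hessian
  remain.\<close>

lemma cone_node_imaginary:
  assumes F: "F \<in> homogeneous_polys d" and v: "hnorm v \<noteq> 0" "F v = 0"
    and D1: "D1 F v (hi \<star> v) = 0" "D1 F v (hj \<star> v) = 0" "D1 F v (hk \<star> v) = 0"
    and D2: "\<And>a b c.
      a * D2 F v (hi \<star> v) (hi \<star> v) + b * D2 F v (hi \<star> v) (hj \<star> v) + c * D2 F v (hi \<star> v) (hk \<star> v) = 0 \<Longrightarrow>
      a * D2 F v (hj \<star> v) (hi \<star> v) + b * D2 F v (hj \<star> v) (hj \<star> v) + c * D2 F v (hj \<star> v) (hk \<star> v) = 0 \<Longrightarrow>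
      a * D2 F v (hk \<star> v) (hi \<star> v) + b * D2 F v (hk \<star> v) (hj \<star> v) + c * D2 F v (hk \<star> v) (hk \<star> v) = 0 \<Longrightarrow>
      a = 0 \<and> b = 0 \<and> c = 0"
  shows "cone_node F v"
proof -
  note sm = smooth2_homogeneous_polys[OF F]
  have dec: "\<exists>e a b c. w = e *s v + (a *s (hi \<star> v) + (b *s (hj \<star> v) + c *s (hk \<star> v)))" for w
  proof -
    \<comment> \<open>The quaternion w v^-1, whose coordinates are those of w in the basis v, i v, j
      v, k v.\<close>
    obtain e a b c where "(1 / hnorm v) *s (w \<star> hcnj v) = vec4 e a b c" by (rule vec4_exhaust)
    moreover have "(1 / hnorm v) *s (w \<star> hcnj v) \<star> v = w"
      using v(1) by (simp add: hmul_linear hmul_assoc hmul_hcnj vector_smult_assoc)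
    moreover have "vec4 e a b c = e *s hone + (a *s hi + (b *s hj + c *s hk))" by simp
    ultimately have "w = (e *s hone + (a *s hi + (b *s hj + c *s hk))) \<star> v" by metis
    then show ?thesis unfolding hmul_linear hmul_one by blast
  qed
  have D1v: "D1 F v v = 0"
  proof -
    have "F (v + t *s v) = 0" for t
      using homogeneous_polys_scale[OF F, of "1 + t" v] v(2) by (simp add: vec.scale_left_distrib)
    then show ?thesis by (simp add: D1_def)
  qed
  have D1_zero: "D1 F v w = 0" for w
    using dec[of w] D1 D1v by (auto simp: D1_lin[OF sm])
  have "w \<in> vec.span {v}" if w: "\<forall>u. D2 F v u w = 0" for w
  proof -
    obtain e a b c where dw: "w = e *s v + (a *s (hi \<star> v) + (b *s (hj \<star> v) + c *s (hk \<star> v)))"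
      using dec by blast
    have "D2 F v u v = 0" for u
      using euler_D2[OF F D1_zero] D2_sym[OF sm] by metis
    then have "a * D2 F v u (hi \<star> v) + b * D2 F v u (hj \<star> v) + c * D2 F v u (hk \<star> v) = 0" for u
      using w[rule_format, of u] by (simp add: dw D2_lin[OF sm] add.assoc)
    then have "a = 0 \<and> b = 0 \<and> c = 0" by (intro D2)
    then show ?thesis by (auto simp: dw span_single)
  qed
  then show ?thesis using v(2) D1_zero by (simp add: cone_node_def)
qed

text \<open>If g p = p h, then the pair (g, h) sends z p to g z p h^-1 = (g z g^-1) p. The fix group
  thus acts on the directions z p by rotating z, and derivatives of an invariant function respect
  this.\<close>

lemma derivatives_fix_group:
  assumes inv: "\<And>x. F (cact g h x) = F x" and "hnorm h = 1" and fix_p: "g \<star> p = p \<star> h"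
  shows "D1 F (cvec p) (rot (cvec g) z \<star> cvec p) = D1 F (cvec p) (z \<star> cvec p)"
    and "D2 F (cvec p) (rot (cvec g) y \<star> cvec p) (rot (cvec g) z \<star> cvec p) = D2 F (cvec p) (y \<star> cvec p) (z \<star> cvec p)"
proof -
  have h: "hnorm (cvec h) = 1" using assms(2) by (simp add: cvec_hom)
  have eq: "cvec g \<star> cvec p = cvec p \<star> cvec h" using fix_p by (metis cvec_hom(1))
  have conj: "hcnj (cvec g) \<star> cvec p = cvec p \<star> hcnj (cvec h)" if "hnorm g = 1"
  proof -
    have "hnorm (cvec g) = 1" using that by (simp add: cvec_hom)
    have "hcnj (cvec g) \<star> (cvec g \<star> cvec p) \<star> hcnj (cvec h) = hcnj (cvec g) \<star> (cvec p \<star> cvec h) \<star> hcnj (cvec h)"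
      by (simp add: eq)
    then show ?thesis
      by (simp add: hmul_hcnj_cancel[OF \<open>hnorm (cvec g) = 1\<close>] hmul_assoc[of "hcnj (cvec g)"] hmul_hcnj_cancel[OF h])
  qed
  have fixed: "cact g h (cvec p) = cvec p" by (simp add: cact_def eq hmul_hcnj_cancel[OF h])
  have rot: "rot (cvec g) z \<star> cvec p = cact g h (z \<star> cvec p)" if "hnorm g = 1" for z
    by (simp add: rot_def cact_def hmul_assoc conj[OF that])
  have "hnorm g = 1" if "p \<noteq> 0"
    using arg_cong[OF fix_p, of hnorm] assms(2) that by (simp add: hnorm_hmul hnorm_eq_0_iff)
  \<comment> \<open>For p = 0 the relation g p = p h says nothing about the norm of g, but then all
    directions z p are zero.\<close>
  moreover have "x \<star> cvec p = 0" if "p = 0" for x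
    using that by (simp add: vec_eq_iff4 hmul_def)
  ultimately have rot': "rot (cvec g) z \<star> cvec p = cact g h (z \<star> cvec p)" for z
    using rot by (cases "p = 0") (simp_all add: cact_def vec_eq_iff4 hmul_def)
  have "F (cvec p + t *s cact g h w) = F (cvec p + t *s w)"
    "F (cvec p + s *s cact g h u + t *s cact g h w) = F (cvec p + s *s u + t *s w)" for s t u w
    using inv[of "cvec p + t *s w"] inv[of "cvec p + s *s u + t *s w"] by (simp_all add: cact_linear fixed)
  then show "D1 F (cvec p) (rot (cvec g) z \<star> cvec p) = D1 F (cvec p) (z \<star> cvec p)"
    "D2 F (cvec p) (rot (cvec g) y \<star> cvec p) (rot (cvec g) z \<star> cvec p) = D2 F (cvec p) (y \<star> cvec p) (z \<star> cvec p)"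
    by (simp_all add: rot' D1_def D2_def)
qed

lemma self_uminus_zero: "- x = x \<Longrightarrow> x = 0" "x = - x \<Longrightarrow> x = 0" for x :: complex
  by (simp_all add: eq_neg_iff_add_eq_0 neg_eq_iff_add_eq_0)

lemma rot_units:
  "rot (cvec (vec4 0 1 0 0)) hi = hi" "rot (cvec (vec4 0 1 0 0)) hj = - hj" "rot (cvec (vec4 0 1 0 0)) hk = - hk"
  "rot (cvec (vec4 0 0 1 0)) hi = - hi" "rot (cvec (vec4 0 0 1 0)) hj = hj" "rot (cvec (vec4 0 0 1 0)) hk = - hk"
  "rot (cvec quat_S) hi = hk" "rot (cvec quat_S) hj = - hi" "rot (cvec quat_S) hk = - hj"
  by (simp_all add: rot_def cvec_vec4 quat_S_def field_simps)

lemma D_uminus: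
  assumes "smooth2 F"
  shows "D1 F v (- x) = - D1 F v x" "D2 F v u (- x) = - D2 F v u x" "D2 F v (- x) u = - D2 F v x u"
  using D1_lin(2)[OF assms, of v "- 1" x] D2_lin(2)[OF assms, of v u "- 1" x] D2_lin'(2)[OF assms, of v "- 1" x u]
  by (simp_all add: vector_sneg_minus1[symmetric])

text \<open>The half turns about i and j reverse the sign of every first derivative and of every
  mixed second derivative for one of the two elements. So the gradient vanishes and the Hessian is
  diagonal, with three entries left to test.\<close>

lemma cone_node_klein_symmetry:
  assumes "hnorm p \<noteq> 0" "pencil l (cvec p) = 0"
    and h1: "h1 \<in> binary_octahedral" "vec4 0 1 0 0 \<star> p = p \<star> h1"
    and h2: "h2 \<in> binary_octahedral" "vec4 0 0 1 0 \<star> p = p \<star> h2"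
    and nz: "D2 (pencil l) (cvec p) (hi \<star> cvec p) (hi \<star> cvec p) \<noteq> 0"
      "D2 (pencil l) (cvec p) (hj \<star> cvec p) (hj \<star> cvec p) \<noteq> 0"
      "D2 (pencil l) (cvec p) (hk \<star> cvec p) (hk \<star> cvec p) \<noteq> 0"
  shows "cone_node (pencil l) (cvec p)"
proof -
  note sm = smooth2_homogeneous_polys[OF pencil_homogeneous[of l]]
  have icos: "vec4 0 1 0 0 \<in> binary_icosahedral" "vec4 0 0 1 0 \<in> binary_icosahedral"
    by (auto intro!: subsetD[OF hurwitz_units_subset_binary(1)] simp: vec4_in_hurwitz_units)
  note s1 = derivatives_fix_group[where F = "pencil l", OF pencil_invariant[OF icos(1) h1(1)] hnorm_binary(2)[OF h1(1)] h1(2)]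
  note s2 = derivatives_fix_group[where F = "pencil l", OF pencil_invariant[OF icos(2) h2(1)] hnorm_binary(2)[OF h2(1)] h2(2)]
  note neg = rot_units hmul_linear D_uminus[OF sm] minus_minus
  let ?B = "\<lambda>x y. D2 (pencil l) (cvec p) (x \<star> cvec p) (y \<star> cvec p)"
  have B: "?B hi hj = 0" "?B hi hk = 0" "?B hj hi = 0" "?B hj hk = 0" "?B hk hi = 0" "?B hk hj = 0"
    using s1(2)[of hi hj] s1(2)[of hi hk] s1(2)[of hj hi] s1(2)[of hk hi] s2(2)[of hj hk] s2(2)[of hk hj]
    unfolding neg by (simp_all only: self_uminus_zero)
  show ?thesis
  proof (rule cone_node_imaginary[OF pencil_homogeneous _ assms(2)])
    show "hnorm (cvec p) \<noteq> 0" using assms(1) by (simp add: cvec_hom)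
    show "D1 (pencil l) (cvec p) (hi \<star> cvec p) = 0" "D1 (pencil l) (cvec p) (hj \<star> cvec p) = 0"
      "D1 (pencil l) (cvec p) (hk \<star> cvec p) = 0"
      using s1(1)[of hj] s1(1)[of hk] s2(1)[of hi] unfolding neg by (simp_all only: self_uminus_zero)
  qed (use nz in \<open>simp add: B\<close>)
qed

text \<open>Conjugation by S cycles i, k, -j, so the Hessian has only two free entries b and e. Its
  eigenvalues are b + 2 e on the axis i - j + k and twice b - e on the plane orthogonal to it. The
  value on the axis vector is 3 (b + 2 e), which explains the two inequalities required.\<close>

lemma cone_node_dihedral_symmetry:
  fixes l :: complex
  defines "B \<equiv> \<lambda>p x y. D2 (pencil l) (cvec p) (x \<star> cvec p) (y \<star> cvec p)"
  assumes "hnorm p \<noteq> 0" "pencil l (cvec p) = 0"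
    and S: "quat_S \<star> p = p \<star> quat_S"
    and u: "vec4 0 (tau / 2) (1 / 2) ((1 - tau) / 2) \<in> binary_icosahedral"
    and h: "h \<in> binary_octahedral" "vec4 0 (tau / 2) (1 / 2) ((1 - tau) / 2) \<star> p = p \<star> h"
    and nz: "B p (vec4 0 1 (-1) 1) (vec4 0 1 (-1) 1) \<noteq> 0"
      "9 * B p hi hi \<noteq> B p (vec4 0 1 (-1) 1) (vec4 0 1 (-1) 1)"
  shows "cone_node (pencil l) (cvec p)"
proof -
  note sm = smooth2_homogeneous_polys[OF pencil_homogeneous[of l]]
  note s1 = derivatives_fix_group[where F = "pencil l", OF pencil_invariant[OF generators_in(2,5)] hnorm_binary(2)[OF generators_in(5)] S]
  note s2 = derivatives_fix_group[where F = "pencil l", OF pencil_invariant[OF u h(1)] hnorm_binary(2)[OF h(1)] h(2)]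
  note neg = rot_units hmul_linear D_uminus[OF sm] minus_minus
  define b where "b = B p hi hi"
  define e where "e = B p hi hk"
  have "B p hj hj = b" "B p hk hk = b" "B p hj hk = B p hi hj" "B p hi hj = - B p hk hi" "e = - B p hk hj"
    using s1(2)[of hj hj] s1(2)[of hi hi] s1(2)[of hj hk] s1(2)[of hi hj] s1(2)[of hi hk]
    unfolding neg B_def b_def e_def by simp_all
  moreover have sym: "B p x y = B p y x" for x y unfolding B_def by (rule D2_sym[OF sm])
  ultimately have Bs: "B p hi hi = b" "B p hj hj = b" "B p hk hk = b" "B p hi hk = e" "B p hk hi = e"
    "B p hi hj = - e" "B p hj hi = - e" "B p hj hk = - e" "B p hk hj = - e"
    unfolding b_def e_def by (metis minus_minus)+
  have split: "vec4 0 x y z = x *s hi + (y *s hj + z *s hk)" for x y z by simp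
  have n: "B p (vec4 0 1 (-1) 1) (vec4 0 1 (-1) 1) = 3 * b + 6 * e"
    unfolding split[of 1 "-1" 1] B_def hmul_linear D2_lin[OF sm] D2_lin'[OF sm] Bs[unfolded B_def] by simp
  have D1s: "D1 (pencil l) (cvec p) (hk \<star> cvec p) = D1 (pencil l) (cvec p) (hi \<star> cvec p)"
    "D1 (pencil l) (cvec p) (hj \<star> cvec p) = - D1 (pencil l) (cvec p) (hi \<star> cvec p)"
    using s1(1)[of hi] s1(1)[of hj] unfolding neg by simp_all
  let ?t = "complex_of_real tau"
  \<comment> \<open>By S the gradient has components g, -g, g. The rotated vector found here pairs
    with it to -g, since the half turn reverses the axis of S; equality with the pairing against i
    gives -g = g.\<close>
  have "rot (cvec (vec4 0 (tau / 2) (1 / 2) ((1 - tau) / 2))) hi =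
      vec4 0 ((?t * ?t) / 2 - 1) (?t / 2) (?t * (1 - ?t) / 2)"
    by (simp add: rot_def cvec_vec4 field_simps ctau_mult ctau_mult_left)
  with s2(1)[of hi] have "D1 (pencil l) (cvec p) (vec4 0 ((?t * ?t) / 2 - 1) (?t / 2) (?t * (1 - ?t) / 2) \<star> cvec p)
      = D1 (pencil l) (cvec p) (hi \<star> cvec p)" by simp
  then have D1i: "D1 (pencil l) (cvec p) (hi \<star> cvec p) = 0"
    unfolding split[of "(?t * ?t) / 2 - 1"] hmul_linear D1_lin[OF sm] D1s
    by (simp add: field_simps ctau_mult)
  show ?thesis
  proof (rule cone_node_imaginary[OF pencil_homogeneous _ assms(3)])
    show "hnorm (cvec p) \<noteq> 0" using assms(2) by (simp add: cvec_hom)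
    show "D1 (pencil l) (cvec p) (hi \<star> cvec p) = 0" "D1 (pencil l) (cvec p) (hj \<star> cvec p) = 0"
      "D1 (pencil l) (cvec p) (hk \<star> cvec p) = 0" by (simp_all add: D1s D1i)
    fix x y z
    assume "x * D2 (pencil l) (cvec p) (hi \<star> cvec p) (hi \<star> cvec p) + y * D2 (pencil l) (cvec p) (hi \<star> cvec p) (hj \<star> cvec p) +
        z * D2 (pencil l) (cvec p) (hi \<star> cvec p) (hk \<star> cvec p) = 0"
      "x * D2 (pencil l) (cvec p) (hj \<star> cvec p) (hi \<star> cvec p) + y * D2 (pencil l) (cvec p) (hj \<star> cvec p) (hj \<star> cvec p) +
        z * D2 (pencil l) (cvec p) (hj \<star> cvec p) (hk \<star> cvec p) = 0"
      "x * D2 (pencil l) (cvec p) (hk \<star> cvec p) (hi \<star> cvec p) + y * D2 (pencil l) (cvec p) (hk \<star> cvec p) (hj \<star> cvec p) +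
        z * D2 (pencil l) (cvec p) (hk \<star> cvec p) (hk \<star> cvec p) = 0"
    then have eqs: "x * b + y * (- e) + z * e = 0" "x * (- e) + y * b + z * (- e) = 0" "x * e + y * (- e) + z * b = 0"
      unfolding Bs[unfolded B_def] .
    have "(b - e) * (x + y) = 0" "(b - e) * (x - z) = 0" using eqs by algebra+
    moreover have "b - e \<noteq> 0"
    proof
      assume "b - e = 0"
      then have "b = e" by simp
      then show False using nz(2) unfolding n Bs(1) by simp
    qed
    moreover have nz': "b + 2 * e \<noteq> 0"
    proof
      assume "b + 2 * e = 0"
      then have "3 * b + 6 * e = 0" by algebra
      then show False using nz(1) unfolding n by simp
    qed
    ultimately have xy: "y = - x" "z = x" by (simp_all add: eq_neg_iff_add_eq_0 add.commute)
    have "(b + 2 * e) * x = 0" using eqs(1) unfolding xy by algebra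
    then show "x = 0 \<and> y = 0 \<and> z = 0" using xy nz' by simp
  qed
qed

subsection \<open>Second derivatives along rotations\<close>

text \<open>The t^2 coefficient of \<open>ico_form\<close> along the rotation by 1 + t i, as a
  function of the squared coordinates X, Y, W. The first three products take the second-order term
  of one factor, the last three the first-order terms of two factors. The latter are multiples of y
  w, and their products involve only Y W.\<close>

definition ico_coeff :: "complex \<Rightarrow> complex \<Rightarrow> complex \<Rightarrow> complex" where
  "ico_coeff X Y W = (let T = (complex_of_real tau)\<^sup>2; A = Y - T * W; B = W - T * X; C = X - T * Y in
     (4 * W - 2 * Y - T * (4 * Y - 2 * W)) * B * C + A * (4 * Y - 2 * W - 2 * T * X) * C
     + A * B * (2 * X - T * (4 * W - 2 * Y))
     - 16 * (1 + T) * (Y * W) * C - 16 * T * (1 + T) * (Y * W) * B + 16 * T * (Y * W) * A)"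

lemma coeff_mult3:
  "coeff (p * q * r) 0 = coeff p 0 * coeff q 0 * coeff r 0"
  "coeff (p * q * r) 1 = coeff p 1 * coeff q 0 * coeff r 0 + coeff p 0 * coeff q 1 * coeff r 0 + coeff p 0 * coeff q 0 * coeff r 1"
  "coeff (p * q * r) 2 = coeff p 2 * coeff q 0 * coeff r 0 + coeff p 0 * coeff q 2 * coeff r 0 + coeff p 0 * coeff q 0 * coeff r 2
    + coeff p 1 * coeff q 1 * coeff r 0 + coeff p 1 * coeff q 0 * coeff r 1 + coeff p 0 * coeff q 1 * coeff r 1"
  for p q r :: "complex poly"
  by (simp_all add: coeff_mult numeral_2_eq_2 algebra_simps)

lemma ico_form_cyclic: "ico_form (vec4 0 y w x) = ico_form (vec4 0 x y w)"
  by (simp add: ico_form_def Let_def)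

lemma ico_form_rotation:
  "\<exists>p. (\<forall>t. ico_form (vec4 0 ((1 + t\<^sup>2) * x) ((1 - t\<^sup>2) * y - 2 * t * w) ((1 - t\<^sup>2) * w + 2 * t * y)) = poly p t)
    \<and> coeff p 2 = ico_coeff (x\<^sup>2) (y\<^sup>2) (w\<^sup>2)"
proof (intro exI conjI allI)
  let ?T = "(complex_of_real tau)\<^sup>2"
  let ?X = "[:x\<^sup>2, 0, 2 * x\<^sup>2, 0, x\<^sup>2:]" and ?Y = "[:y\<^sup>2, - 4 * y * w, 4 * w\<^sup>2 - 2 * y\<^sup>2, 4 * y * w, y\<^sup>2:]"
    and ?W = "[:w\<^sup>2, 4 * y * w, 4 * y\<^sup>2 - 2 * w\<^sup>2, - 4 * y * w, w\<^sup>2:]"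
  let ?p = "(?Y - smult ?T ?W) * (?W - smult ?T ?X) * (?X - smult ?T ?Y)"
  show "ico_form (vec4 0 ((1 + t\<^sup>2) * x) ((1 - t\<^sup>2) * y - 2 * t * w) ((1 - t\<^sup>2) * w + 2 * t * y)) = poly ?p t" for t
  proof -
    have "((1 + t\<^sup>2) * x)\<^sup>2 = poly ?X t" "((1 - t\<^sup>2) * y - 2 * t * w)\<^sup>2 = poly ?Y t"
      "((1 - t\<^sup>2) * w + 2 * t * y)\<^sup>2 = poly ?W t"
      by (simp_all add: power2_eq_square algebra_simps)
    then show ?thesis
      by (simp only: ico_form_def Let_def vec4_nth poly_mult poly_diff poly_smult)
  qed
  have "coeff ?p 2 = ico_coeff (x\<^sup>2) (y\<^sup>2) (w\<^sup>2)"
    unfolding coeff_mult3(3) ico_coeff_def Let_def by (simp add: numeral_2_eq_2) algebra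
  then show "coeff ?p 2 = ico_coeff (x\<^sup>2) (y\<^sup>2) (w\<^sup>2)" .
qed

subsection \<open>The four orbits\<close>

lemma rot_hmul: "rot (a \<star> v) b = rot a (rot v b)"
  by (simp add: rot_def hcnj_hmul hmul_assoc)

text \<open>Moving from v in the direction e v is left multiplication by 1 + t e, so the norm grows
  by the factor 1 + m t^2. Its sixth power contributes 6 m to the coefficient of t^2.\<close>

lemma rotation_D2:
  assumes dir: "w = e \<star> v" "\<And>t. hnorm (hone + t *s e) = 1 + m * t\<^sup>2"
    and forms: "\<And>t. frame_form (v + t *s w) = poly p t"
  shows "D2 (pencil l) v w w = 2 * (coeff p 2 + 6 * m * l * hnorm v ^ 6)"
proof -
  have "v + t *s w = (hone + t *s e) \<star> v" for t
    by (simp only: dir(1) hmul_linear hmul_one)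
  then have "hnorm (v + t *s w) = (1 + m * t\<^sup>2) * hnorm v" for t
    by (simp only: hnorm_hmul dir(2))
  then have "pencil l (v + t *s w) = poly (p + smult (l * hnorm v ^ 6) ([:1, 0, m:] ^ 6)) t" for t
    by (simp add: pencil_eq forms power_mult_distrib power2_eq_square ac_simps)
  then have "D2 (pencil l) v w w = 2 * coeff (p + smult (l * hnorm v ^ 6) ([:1, 0, m:] ^ 6)) 2"
    by (rule D2_eq_poly)
  also have "coeff ([:1, 0, m:] ^ 6) 2 = 6 * m"
    by (simp add: eval_nat_numeral)
  then have "coeff (p + smult (l * hnorm v ^ 6) ([:1, 0, m:] ^ 6)) 2 = coeff p 2 + 6 * m * l * hnorm v ^ 6"
    by simp
  finally show ?thesis .
qed

text \<open>The left factor 1 + t e rotates all three frame vectors simultaneously, so the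
  coefficients of the three sextics add up. The axes j and k reduce to i by the cyclic symmetry of
  \<open>ico_form\<close>.\<close>

lemma frame_D2:
  assumes v: "rot v hi = vec4 0 x1 y1 w1" "rot v hj = vec4 0 x2 y2 w2" "rot v hk = vec4 0 x3 y3 w3"
  shows "D2 (pencil l) v (hi \<star> v) (hi \<star> v) = 2 * ((complex_of_real tau - 3/2) *
      (ico_coeff (x1\<^sup>2) (y1\<^sup>2) (w1\<^sup>2) + ico_coeff (x2\<^sup>2) (y2\<^sup>2) (w2\<^sup>2) + ico_coeff (x3\<^sup>2) (y3\<^sup>2) (w3\<^sup>2)) + 6 * l * hnorm v ^ 6)"
    and "D2 (pencil l) v (hj \<star> v) (hj \<star> v) = 2 * ((complex_of_real tau - 3/2) *
      (ico_coeff (y1\<^sup>2) (w1\<^sup>2) (x1\<^sup>2) + ico_coeff (y2\<^sup>2) (w2\<^sup>2) (x2\<^sup>2) + ico_coeff (y3\<^sup>2) (w3\<^sup>2) (x3\<^sup>2)) + 6 * l * hnorm v ^ 6)"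
    and "D2 (pencil l) v (hk \<star> v) (hk \<star> v) = 2 * ((complex_of_real tau - 3/2) *
      (ico_coeff (w1\<^sup>2) (x1\<^sup>2) (y1\<^sup>2) + ico_coeff (w2\<^sup>2) (x2\<^sup>2) (y2\<^sup>2) + ico_coeff (w3\<^sup>2) (x3\<^sup>2) (y3\<^sup>2)) + 6 * l * hnorm v ^ 6)"
proof -
  have shift: "v + t *s (e \<star> v) = (hone + t *s e) \<star> v" for t e
    by (simp only: hmul_linear hmul_one)
  have rots: "rot (hone + t *s hi) (vec4 0 x y w) = vec4 0 ((1 + t\<^sup>2) * x) ((1 - t\<^sup>2) * y - 2 * t * w) ((1 - t\<^sup>2) * w + 2 * t * y)"
    "rot (hone + t *s hj) (vec4 0 x y w) = vec4 0 ((1 - t\<^sup>2) * x + 2 * t * w) ((1 + t\<^sup>2) * y) ((1 - t\<^sup>2) * w - 2 * t * x)"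
    "rot (hone + t *s hk) (vec4 0 x y w) = vec4 0 ((1 - t\<^sup>2) * x - 2 * t * y) ((1 - t\<^sup>2) * y + 2 * t * x) ((1 + t\<^sup>2) * w)" for t x y w
    by (simp_all add: rot_def power2_eq_square algebra_simps)
  have main: "D2 (pencil l) v (e \<star> v) (e \<star> v) = 2 * ((complex_of_real tau - 3/2) * (c1 + c2 + c3) + 6 * l * hnorm v ^ 6)"
    if e: "\<And>t. hnorm (hone + t *s e) = 1 + 1 * t\<^sup>2"
      and c: "\<exists>p. (\<forall>t. ico_form (rot (hone + t *s e) (vec4 0 x1 y1 w1)) = poly p t) \<and> coeff p 2 = c1"
      "\<exists>p. (\<forall>t. ico_form (rot (hone + t *s e) (vec4 0 x2 y2 w2)) = poly p t) \<and> coeff p 2 = c2"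
      "\<exists>p. (\<forall>t. ico_form (rot (hone + t *s e) (vec4 0 x3 y3 w3)) = poly p t) \<and> coeff p 2 = c3" for e c1 c2 c3
  proof -
    obtain p1 p2 p3 where p: "\<And>t. ico_form (rot (hone + t *s e) (vec4 0 x1 y1 w1)) = poly p1 t" "coeff p1 2 = c1"
      "\<And>t. ico_form (rot (hone + t *s e) (vec4 0 x2 y2 w2)) = poly p2 t" "coeff p2 2 = c2"
      "\<And>t. ico_form (rot (hone + t *s e) (vec4 0 x3 y3 w3)) = poly p3 t" "coeff p3 2 = c3"
      using c by blast
    have "frame_form (v + t *s (e \<star> v)) = poly (smult (complex_of_real tau - 3/2) (p1 + p2 + p3)) t" for t
      by (simp only: frame_form_def shift rot_hmul v p poly_smult poly_add)
    from rotation_D2[OF refl e this] show ?thesis by (simp add: p)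
  qed
  have n: "hnorm (hone + t *s hi) = 1 + 1 * t\<^sup>2" "hnorm (hone + t *s hj) = 1 + 1 * t\<^sup>2" "hnorm (hone + t *s hk) = 1 + 1 * t\<^sup>2" for t
    by simp_all
  have j: "\<exists>p. (\<forall>t. ico_form (rot (hone + t *s hj) (vec4 0 x y w)) = poly p t) \<and> coeff p 2 = ico_coeff (y\<^sup>2) (w\<^sup>2) (x\<^sup>2)" for x y w
    using ico_form_rotation[of y w x] ico_form_cyclic unfolding rots by metis
  have k: "\<exists>p. (\<forall>t. ico_form (rot (hone + t *s hk) (vec4 0 x y w)) = poly p t) \<and> coeff p 2 = ico_coeff (w\<^sup>2) (x\<^sup>2) (y\<^sup>2)" for x y w
    using ico_form_rotation[of w x y] ico_form_cyclic unfolding rots by metis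
  show "D2 (pencil l) v (hi \<star> v) (hi \<star> v) = 2 * ((complex_of_real tau - 3/2) *
      (ico_coeff (x1\<^sup>2) (y1\<^sup>2) (w1\<^sup>2) + ico_coeff (x2\<^sup>2) (y2\<^sup>2) (w2\<^sup>2) + ico_coeff (x3\<^sup>2) (y3\<^sup>2) (w3\<^sup>2)) + 6 * l * hnorm v ^ 6)"
    by (rule main[OF n(1)]; unfold rots; rule ico_form_rotation)
  show "D2 (pencil l) v (hj \<star> v) (hj \<star> v) = 2 * ((complex_of_real tau - 3/2) *
      (ico_coeff (y1\<^sup>2) (w1\<^sup>2) (x1\<^sup>2) + ico_coeff (y2\<^sup>2) (w2\<^sup>2) (x2\<^sup>2) + ico_coeff (y3\<^sup>2) (w3\<^sup>2) (x3\<^sup>2)) + 6 * l * hnorm v ^ 6)"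
    by (rule main[OF n(2) j j j])
  show "D2 (pencil l) v (hk \<star> v) (hk \<star> v) = 2 * ((complex_of_real tau - 3/2) *
      (ico_coeff (w1\<^sup>2) (x1\<^sup>2) (y1\<^sup>2) + ico_coeff (w2\<^sup>2) (x2\<^sup>2) (y2\<^sup>2) + ico_coeff (w3\<^sup>2) (x3\<^sup>2) (y3\<^sup>2)) + 6 * l * hnorm v ^ 6)"
    by (rule main[OF n(3) k k k])
qed

text \<open>Each number times its Galois conjugate is -5, its norm from the field of tau.\<close>

lemma tau_combination_nonzero:
  "complex_of_real tau * 3 + 1 \<noteq> 0" "complex_of_real tau * 3 - 4 \<noteq> 0"
proof -
  have "(complex_of_real tau * 3 + 1) * (4 - 3 * complex_of_real tau) = - 5"
    "(complex_of_real tau * 3 - 4) * (- 1 - 3 * complex_of_real tau) = - 5"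
    by (simp_all add: algebra_simps ctau_mult ctau_mult_left)
  then show "complex_of_real tau * 3 + 1 \<noteq> 0" "complex_of_real tau * 3 - 4 \<noteq> 0" by auto
qed

lemma cone_node_tetrahedral: "cone_node (pencil 0) (cvec hone)"
proof -
  have rot: "rot (cvec hone) x = x" for x by (simp add: rot_def cvec_hom)
  have D: "D2 (pencil 0) (cvec hone) (e \<star> cvec hone) (e \<star> cvec hone) = 4" if "e \<in> {hi, hj, hk}" for e
    using that frame_D2[OF rot rot rot, of 0]
    by (auto simp: ico_coeff_def Let_def power2_eq_square field_simps ctau_mult ctau_mult_left)
  have mem: "hone \<in> binary_octahedral" "vec4 0 1 0 0 \<in> binary_octahedral" "vec4 0 0 1 0 \<in> binary_octahedral"
    by (auto intro!: binary_octahedralI simp: vec4_in_hurwitz_units)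
  show ?thesis
  proof (rule cone_node_klein_symmetry[OF _ _ mem(2) _ mem(3)])
    show "pencil 0 (cvec hone) = 0"
      using frame_form_restricted[of 1 0] by (simp add: pencil_eq cvec_hom)
  qed (use D in \<open>simp_all\<close>)
qed

lemma cone_node_klein: "cone_node (pencil (- (1 / 8))) (cvec klein_point)"
proof -
  define m where "m = complex_of_real (sqrt 2 - 1)"
  have "complex_of_real (sqrt 2) * complex_of_real (sqrt 2) = 2"
    by (simp flip: of_real_mult)
  then have m: "m * m = 1 - 2 * m" by (simp add: m_def algebra_simps)
  have v: "cvec klein_point = vec4 1 0 m 0"
    by (simp add: klein_point_def cvec_vec4 m_def)
  \<comment> \<open>From m^2 = 1 - 2 m the squares of 1 - m^2, 2 m and 1 + m^2 are 4 M, 4 M and 8 M.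
    All frame data become multiples of M and all second derivatives multiples of M^3.\<close>
  define M where "M = m * m"
  have M: "(1 - m * m)\<^sup>2 = 4 * M" "(2 * m)\<^sup>2 = 4 * M" "(1 + m * m)\<^sup>2 = 8 * M"
    unfolding M_def using m by algebra+
  have "m \<noteq> 0" using m by auto
  then have "M \<noteq> 0" by (simp add: M_def)
  have n: "hnorm (vec4 1 0 m 0) ^ 6 = 512 * M ^ 3"
  proof -
    have "hnorm (vec4 1 0 m 0) ^ 6 = ((1 + m * m)\<^sup>2) ^ 3"
      by (simp add: power2_eq_square[of m] flip: power_mult)
    then show ?thesis by (simp add: M)
  qed
  have rots: "rot (vec4 1 0 m 0) hi = vec4 0 (1 - m * m) 0 (- (2 * m))"
    "rot (vec4 1 0 m 0) hj = vec4 0 0 (1 + m * m) 0" "rot (vec4 1 0 m 0) hk = vec4 0 (2 * m) 0 (1 - m * m)"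
    by (simp_all add: rot_def)
  note D = frame_D2[OF rots, of "- (1 / 8)", unfolded power2_minus M n]
  have cubes: "D2 (pencil (- (1/8))) (vec4 1 0 m 0) (hi \<star> vec4 1 0 m 0) (hi \<star> vec4 1 0 m 0) = - 512 * (complex_of_real tau * 3 + 1) * M ^ 3"
    "D2 (pencil (- (1/8))) (vec4 1 0 m 0) (hj \<star> vec4 1 0 m 0) (hj \<star> vec4 1 0 m 0) = - 2048 * M ^ 3"
    "D2 (pencil (- (1/8))) (vec4 1 0 m 0) (hk \<star> vec4 1 0 m 0) (hk \<star> vec4 1 0 m 0) = 512 * (complex_of_real tau * 3 - 4) * M ^ 3"
    unfolding D by (simp_all add: ico_coeff_def Let_def power2_eq_square power3_eq_cube field_simps ctau_mult ctau_mult_left)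
  have mem: "vec4 0 (1 / sqrt 2) 0 (1 / sqrt 2) \<in> binary_octahedral" "vec4 0 0 1 0 \<in> binary_octahedral"
    using binary_octahedralI(1)[of 0 0 1 0] binary_octahedralI(2)[of "1/2" "1/2" "1/2" "1/2"]
    by (simp_all add: vec4_in_hurwitz_units)
  show ?thesis
  proof (rule cone_node_klein_symmetry[OF _ _ mem(1) _ mem(2)])
    show "hnorm klein_point \<noteq> 0"
      unfolding hnorm_eq_0_iff by (simp add: klein_point_def vec_eq_iff4)
    \<comment> \<open>The invariant has the value 64 M^3 and q^6 the value 512 M^3, whence lambda =
      -1/8.\<close>
    have "pencil (- (1/8)) (vec4 1 0 m 0) = 2 * M * (1 - m * m)\<^sup>2 * (1 + m * m)\<^sup>2 - 1/8 * hnorm (vec4 1 0 m 0) ^ 6"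
      unfolding pencil_eq frame_form_restricted by (simp add: M_def power2_eq_square)
    also have "\<dots> = 0" unfolding n M by (simp add: power3_eq_cube)
    finally show "pencil (- (1/8)) (cvec klein_point) = 0" by (simp only: v)
    show "vec4 0 1 0 0 \<star> klein_point = klein_point \<star> vec4 0 (1 / sqrt 2) 0 (1 / sqrt 2)"
      "vec4 0 0 1 0 \<star> klein_point = klein_point \<star> vec4 0 0 1 0"
      by (simp_all add: klein_point_def field_simps)
    show "D2 (pencil (- (1/8))) (cvec klein_point) (hi \<star> cvec klein_point) (hi \<star> cvec klein_point) \<noteq> 0"
      "D2 (pencil (- (1/8))) (cvec klein_point) (hj \<star> cvec klein_point) (hj \<star> cvec klein_point) \<noteq> 0"
      "D2 (pencil (- (1/8))) (cvec klein_point) (hk \<star> cvec klein_point) (hk \<star> cvec klein_point) \<noteq> 0"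
      unfolding v cubes
      by (intro no_zero_divisors tau_combination_nonzero power_not_zero \<open>M \<noteq> 0\<close>; simp)+
  qed
qed

text \<open>Normal form for the arithmetic of the field generated by \<open>tau\<close> and \<open>sqrt 2\<close>; taking \<open>r = \<plusminus> sqrt 2\<close>
  treats the two dihedral orbits, which are Galois conjugate, at once.\<close>

definition qf :: "complex \<Rightarrow> complex \<Rightarrow> complex \<Rightarrow> complex \<Rightarrow> complex \<Rightarrow> complex \<Rightarrow> complex" where
  "qf t r a b c d = a + b * t + c * r + d * (t * r)"

lemma qf_arith:
  assumes t: "t * t = t + 1" and r: "r * r = 2"
  shows "qf t r a b c d * qf t r a' b' c' d' = qf t r
      (a * a' + b * b' + 2 * (c * c' + d * d')) (a * b' + b * a' + b * b' + 2 * (c * d' + d * c' + d * d'))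
      (a * c' + c * a' + b * d' + d * b') (a * d' + d * a' + b * c' + c * b' + b * d' + d * b')"
    "qf t r a b c d + qf t r a' b' c' d' = qf t r (a + a') (b + b') (c + c') (d + d')"
    "qf t r a b c d - qf t r a' b' c' d' = qf t r (a - a') (b - b') (c - c') (d - d')"
    "- qf t r a b c d = qf t r (- a) (- b) (- c) (- d)"
    "numeral n * qf t r a b c d = qf t r (numeral n * a) (numeral n * b) (numeral n * c) (numeral n * d)"
proof -
  show "qf t r a b c d * qf t r a' b' c' d' = qf t r
      (a * a' + b * b' + 2 * (c * c' + d * d')) (a * b' + b * a' + b * b' + 2 * (c * d' + d * c' + d * d'))
      (a * c' + c * a' + b * d' + d * b') (a * d' + d * a' + b * c' + c * b' + b * d' + d * b')"
    unfolding qf_def using t r by algebra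
qed (simp_all add: qf_def algebra_simps)

text \<open>Points x + y (i - j + k) commute with S, which cycles i, j, k up to sign, so the three
  terms of the frame sum agree. The factor 12 is this 3 times the 4 in (2 y)^2.\<close>

lemma frame_form_line:
  "frame_form (vec4 x y (- y) y) = (let T = (complex_of_real tau)\<^sup>2 in 12 * (complex_of_real tau - 3/2) *
    ((((x - y)\<^sup>2 - T * (x + y)\<^sup>2) * (x + y)\<^sup>2 * (4 * y\<^sup>2 - T * (x - y)\<^sup>2)) *
     ((x - y)\<^sup>2 * ((x + y)\<^sup>2 - 4 * T * y\<^sup>2) * y\<^sup>2)))"
proof -
  have ico: "ico_form (vec4 0 a b c) = (let T = (complex_of_real tau)\<^sup>2 in (b\<^sup>2 - T * c\<^sup>2) * (c\<^sup>2 - T * a\<^sup>2) * (a\<^sup>2 - T * b\<^sup>2))" for a b c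
    by (simp add: ico_form_def Let_def)
  have "frame_form (vec4 x y (- y) y) = (complex_of_real tau - 3/2) *
    (ico_form (vec4 0 ((x - y) * (x + y)) (2 * y * (x - y)) (2 * y * (x + y)))
    + ico_form (vec4 0 (- (2 * y * (x + y))) ((x - y) * (x + y)) (2 * y * (x - y)))
    + ico_form (vec4 0 (- (2 * y * (x - y))) (- (2 * y * (x + y))) ((x - y) * (x + y))))"
    by (simp add: frame_form_def rot_def algebra_simps)
  also have "\<dots> = (complex_of_real tau - 3/2) * (3 * ico_form (vec4 0 ((x - y) * (x + y)) (2 * y * (x - y)) (2 * y * (x + y))))"
    unfolding ico Let_def power2_minus by algebra
  also have "\<dots> = (complex_of_real tau - 3/2) * (12 * (let T = (complex_of_real tau)\<^sup>2 in
    (((x - y)\<^sup>2 - T * (x + y)\<^sup>2) * (x + y)\<^sup>2 * (4 * y\<^sup>2 - T * (x - y)\<^sup>2)) *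
     ((x - y)\<^sup>2 * ((x + y)\<^sup>2 - 4 * T * y\<^sup>2) * y\<^sup>2)))"
    unfolding ico Let_def by algebra
  finally show ?thesis by (simp only: Let_def mult.assoc mult.left_commute[of _ 12])
qed

lemma coeff_mult2: "coeff (p * q) 2 = coeff p 0 * coeff q 2 + coeff p 1 * coeff q 1 + coeff p 2 * coeff q 0"
  for p q :: "complex poly"
  by (simp add: coeff_mult numeral_2_eq_2)

lemma qf_one:
  "1 + qf t r a b c d = qf t r (1 + a) b c d" "qf t r a b c d + 1 = qf t r (a + 1) b c d"
  "1 - qf t r a b c d = qf t r (1 - a) (- b) (- c) (- d)" "qf t r a b c d - 1 = qf t r (a - 1) b c d"
  "- 1 - qf t r a b c d = qf t r (- 1 - a) (- b) (- c) (- d)"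
  "numeral n + qf t r a b c d = qf t r (numeral n + a) b c d"
  "numeral n - qf t r a b c d = qf t r (numeral n - a) (- b) (- c) (- d)"
  "qf t r a b c d - numeral n = qf t r (a - numeral n) b c d"
  "qf t r a b c d + numeral n = qf t r (a + numeral n) b c d"
  by (simp_all add: qf_def)

lemma qf_nonzero:
  assumes "qf t r a b c d * qf t r a' b' c' d' = qf t r 1 0 0 0"
  shows "qf t r a b c d \<noteq> 0"
  using assms by (auto simp: qf_def)

lemma cone_node_dihedral:
  fixes r c :: real
  assumes r: "r * r = 2" and c: "c = - (37 / 486) + 4 / 243 * (r * (2 * tau - 1))"
  shows "cone_node (pencil (complex_of_real c)) (cvec (dihedral_point r))"
proof -
  let ?t = "complex_of_real tau" and ?r = "complex_of_real r"
  let ?K = "qf ?t ?r"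
  have rr: "?r * ?r = 2" using r by (metis of_real_mult of_real_numeral)
  note arith = qf_arith[OF ctau_mult rr] qf_one
  define nu where "nu = complex_of_real ((2 * tau + 1 - 2 * tau * r) / 3)"
  have nu: "nu = ?K (1/3) (2/3) 0 (-2/3)" by (simp add: nu_def qf_def field_simps)
  have A: "1 + nu = ?K (4/3) (2/3) 0 (-2/3)" by (simp add: nu arith)
  have B: "1 - nu = ?K (2/3) (-2/3) 0 (2/3)" by (simp add: nu arith)
  have T: "?t\<^sup>2 = ?K 1 1 0 0" by (simp add: power2_eq_square ctau_mult qf_def)
  have kap: "?t - 3/2 = ?K (-3/2) 1 0 0" by (simp add: qf_def)
  have cK: "complex_of_real c = ?K (-37/486) 0 (-4/243) (8/243)" by (simp add: c qf_def field_simps)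
  define v where "v = vec4 1 nu (- nu) nu"
  have p: "cvec (dihedral_point r) = v"
    by (simp add: dihedral_point_def Let_def cvec_vec4 v_def nu_def)
  have n: "hnorm v = ?K (16/3) (16/3) (-8/3) (-4)"
  proof -
    have "hnorm v = 1 + 3 * (nu * nu)" by (simp add: v_def power2_eq_square)
    then show ?thesis by (simp add: nu arith)
  qed
  have n6: "hnorm v ^ 6 = ?K (38061506560/729) (2280914944/27) (-26913538048/729) (-43546968064/729)"
  proof -
    have "x ^ 6 = (x * x * x) * (x * x * x)" for x :: complex by (simp add: eval_nat_numeral)
    then show ?thesis by (simp add: n arith)
  qed
  have vanishes: "pencil (complex_of_real c) v = 0"
  proof -
    have "pencil (complex_of_real c) v = ?K 0 0 0 0"
      unfolding pencil_eq n6 unfolding v_def frame_form_line Let_def A B T kap cK unfolding nu power2_eq_square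
      by (simp add: arith)
    then show ?thesis by (simp add: qf_def)
  qed
  have D2i: "D2 (pencil (complex_of_real c)) v (hi \<star> v) (hi \<star> v) = ?K (-29396754759680/177147) (-1761666400256/6561) (20786636128256/177147) (33633534476288/177147)"
  proof -
    \<comment> \<open>The entries of one frame vector; the other two arise from it by cyclic shift
      and signs, which the squares forget.\<close>
    define x where "x = (1 - nu) * (1 + nu)"
    define y where "y = 2 * (nu * (1 - nu))"
    define w where "w = 2 * (nu * (1 + nu))"
    have "rot v hi = vec4 0 x y w" "rot v hj = vec4 0 (- w) x y" "rot v hk = vec4 0 (- y) (- w) x"
      by (simp_all add: rot_def v_def x_def y_def w_def algebra_simps)
    note D = frame_D2(1)[OF this, of "complex_of_real c", unfolded power2_minus]
    have "x\<^sup>2 = ?K (688/81) (352/27) (-448/81) (-736/81)" "y\<^sup>2 = ?K (1600/81) (752/27) (-1120/81) (-1600/81)" "w\<^sup>2 = ?K (6064/81) (1072/9) (-4192/81) (-6880/81)"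
      unfolding x_def y_def w_def A B nu power2_eq_square by (simp_all add: arith)
    then show ?thesis
      unfolding D unfolding n6 cK kap ico_coeff_def Let_def T by (simp add: arith)
  qed
  have D2n: "D2 (pencil (complex_of_real c)) v (vec4 0 1 (-1) 1 \<star> v) (vec4 0 1 (-1) 1 \<star> v) = ?K (-6797645578240/6561) (-407363387392/243) (4806659276800/6561) (7777335377920/6561)"
  proof -
    \<comment> \<open>Multiplying v by 1 + s (i - j + k) stays in the plane spanned by 1 and the
      axis, because the axis vector has square -3. So the one-variable formula of
      \<open>frame_form_line\<close> applies, with coordinates 1 - 3 nu s and nu + s.\<close>
    let ?a = "1 + nu" and ?a' = "1 - 3 * nu" and ?b = "1 - nu" and ?b' = "- (1 + 3 * nu)"
    let ?A = "[:?a * ?a, 2 * (?a * ?a'), ?a' * ?a':]" and ?B = "[:?b * ?b, 2 * (?b * ?b'), ?b' * ?b':]"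
      and ?Y = "[:nu * nu, 2 * nu, 1:]"
    let ?p = "smult (12 * (?t - 3/2)) (((?B - smult (?t\<^sup>2) ?A) * ?A * (smult 4 ?Y - smult (?t\<^sup>2) ?B)) *
      (?B * (?A - smult (4 * ?t\<^sup>2) ?Y) * ?Y))"
    have "frame_form (v + s *s (vec4 0 1 (-1) 1 \<star> v)) = poly ?p s" for s
    proof -
      let ?x = "1 - 3 * nu * s" and ?y = "nu + s"
      have "v + s *s (vec4 0 1 (-1) 1 \<star> v) = vec4 ?x ?y (- ?y) ?y"
        by (simp add: v_def algebra_simps)
      moreover have "(?x - ?y)\<^sup>2 = poly ?B s" "(?x + ?y)\<^sup>2 = poly ?A s" "?y\<^sup>2 = poly ?Y s"
        by (simp_all add: power2_eq_square algebra_simps)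
      ultimately show ?thesis
        by (simp only: frame_form_line Let_def poly_mult poly_diff poly_smult)
    qed
    moreover have "hnorm (hone + s *s vec4 0 1 (-1) 1) = 1 + 3 * s\<^sup>2" for s :: complex
      by simp
    ultimately have D: "D2 (pencil (complex_of_real c)) v (vec4 0 1 (-1) 1 \<star> v) (vec4 0 1 (-1) 1 \<star> v) =
        2 * (coeff ?p 2 + 6 * 3 * complex_of_real c * hnorm v ^ 6)"
      by (intro rotation_D2[OF refl])
    have coeffs: "coeff ?A 0 = ?K (28/9) (28/9) (-8/9) (-8/3)" "coeff ?A 1 = ?K (-8) (-40/3) (16/3) (32/3)" "coeff ?A 2 = ?K 12 12 (-8) (-8)"
      "coeff ?B 0 = ?K (16/9) (4/9) (-8/9) 0" "coeff ?B 1 = ?K (16/3) 8 (-16/3) (-16/3)" "coeff ?B 2 = ?K 16 20 (-8) (-16)"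
      "coeff ?Y 0 = ?K (13/9) (16/9) (-8/9) (-4/3)" "coeff ?Y 1 = ?K (2/3) (4/3) 0 (-4/3)" "coeff ?Y 2 = ?K 1 0 0 0"
      unfolding A B nu by (simp_all add: numeral_2_eq_2 arith) (simp add: qf_def)
    show ?thesis
      unfolding D
      unfolding n6 cK coeff_smult coeff_mult2 coeff_mult3 coeff_diff coeffs kap T
      by (simp add: nu arith)
  qed
  have S: "quat_S \<star> dihedral_point r = dihedral_point r \<star> quat_S"
    by (simp add: dihedral_point_def quat_S_def Let_def)
  have "r \<noteq> 0" using r by auto
  have f: "vec4 0 (tau / 2) (1 / 2) ((1 - tau) / 2) \<star> dihedral_point r = dihedral_point r \<star> dihedral_lift r (0, True)"
    unfolding dihedral_lift_simps[OF r]
    using \<open>r \<noteq> 0\<close> by (simp add: dihedral_point_def Let_def field_simps r r_mult_left[OF r] tau_mult tau_mult_left)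
  have "quat_U \<star> quat_i = vec4 0 (tau / 2) (1 / 2) ((1 - tau) / 2)"
    by (simp add: quat_U_def quat_i_def field_simps)
  then have u: "vec4 0 (tau / 2) (1 / 2) ((1 - tau) / 2) \<in> binary_icosahedral"
    using binary_closed(1)[OF generators_in(3,1)] by simp
  have lift: "dihedral_lift r (0, True) \<in> binary_octahedral"
    by (intro dihedral_lift_binary_octahedral[OF r]) (simp add: dihedral_group_3_carrier)
  show ?thesis
  proof (rule cone_node_dihedral_symmetry[OF _ _ S u lift f])
    show "hnorm (dihedral_point r) \<noteq> 0"
      unfolding hnorm_eq_0_iff by (simp add: dihedral_point_def Let_def vec_eq_iff4)
    show "pencil (complex_of_real c) (cvec (dihedral_point r)) = 0" by (simp only: p vanishes)
    \<comment> \<open>The second factor is the inverse in the field generated by tau and r; the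
      product 1 certifies that the derivative is nonzero without numerical estimates. The same
      device serves for b - e below.\<close>
    have "?K (-6797645578240/6561) (-407363387392/243) (4806659276800/6561) (7777335377920/6561) * ?K (-5381/393216) (-2643/131072) (-29215/3145728) (-22805/1572864) = ?K 1 0 0 0" by (simp add: arith)
    then show "D2 (pencil (complex_of_real c)) (cvec (dihedral_point r)) (vec4 0 1 (-1) 1 \<star> cvec (dihedral_point r))
        (vec4 0 1 (-1) 1 \<star> cvec (dihedral_point r)) \<noteq> 0"
      unfolding p D2n by (rule qf_nonzero)
    have "?K (-9003818024960/19683) (-539576238080/729) (6366658297856/19683) (10301528342528/19683) * ?K (1639/786432) (825/131072) (21557/15728640) (35503/7864320) = ?K 1 0 0 0" by (simp add: arith)
    then have "?K (-9003818024960/19683) (-539576238080/729) (6366658297856/19683) (10301528342528/19683) \<noteq> 0" by (rule qf_nonzero)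
    moreover have "9 * ?K (-29396754759680/177147) (-1761666400256/6561) (20786636128256/177147) (33633534476288/177147) - ?K (-6797645578240/6561) (-407363387392/243) (4806659276800/6561) (7777335377920/6561) = ?K (-9003818024960/19683) (-539576238080/729) (6366658297856/19683) (10301528342528/19683)" by (simp add: arith)
    ultimately show "9 * D2 (pencil (complex_of_real c)) (cvec (dihedral_point r)) (hi \<star> cvec (dihedral_point r)) (hi \<star> cvec (dihedral_point r))
        \<noteq> D2 (pencil (complex_of_real c)) (cvec (dihedral_point r)) (vec4 0 1 (-1) 1 \<star> cvec (dihedral_point r))
        (vec4 0 1 (-1) 1 \<star> cvec (dihedral_point r))"
      unfolding p D2n D2i by (metis diff_self)
  qed
qed

section \<open>From one node to its orbit, and the four cases\<close>

lemma has_node_orbit_pencil: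
  assumes "p \<noteq> 0" "fix_group (vec.span {cvec p}) \<cong> H" "group H" "order H = n" "len * n = 1440"
    and "cone_node (pencil l) (cvec p)"
  shows "has_node_orbit (pencil l) len H n"
proof (rule has_node_orbitI[OF assms(1-5)])
  fix g h assume gh: "g \<in> binary_icosahedral" "h \<in> binary_octahedral"
  then have "cone_node (pencil l) (cact g h (cvec p))"
    using assms(6) by (intro cone_node_transfer pencil_invariant) simp_all
  moreover have "cact g h (cvec p) \<noteq> 0"
    using gh assms(1) by (simp add: cact_eq_0_iff cvec_eq_0_iff)
  ultimately show "is_node (pencil l) (vec.span {cact g h (cvec p)})"
    by (rule cone_node_is_node[OF pencil_homogeneous])
qed

lemma has_node_orbit_dihedral:
  assumes "r * r = 2" "c = - (37 / 486) + 4 / 243 * (r * (2 * tau - 1))"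
  shows "has_node_orbit (pencil (complex_of_real c)) 240 (dihedral_group 3) 6"
proof (rule has_node_orbit_pencil[OF _ fix_group_dihedral[OF assms(1)] _ _ _ cone_node_dihedral[OF assms]])
  show "dihedral_point r \<noteq> 0" by (simp add: dihedral_point_def vec_eq_iff4 Let_def)
  show "group (dihedral_group 3)" by (rule group_dihedral_group) simp
  show "order (dihedral_group 3) = 6" by (simp add: order_def dihedral_group_3_carrier)
qed simp

theorem proposition5p2:
  fixes c1 c2 :: real
  assumes "c1 = - (74 / 972) + 4 / 243 * sqrt 10"
    and "c2 = - (74 / 972) - 4 / 243 * sqrt 10"
  shows "has_node_orbit (pencil 0) 120 (alt_group 4) 12
    \<and> has_node_orbit (pencil (complex_of_real c1)) 240 (dihedral_group 3) 6
    \<and> has_node_orbit (pencil (- (1 / 8))) 360 (integer_mod_group 2 \<times>\<times> integer_mod_group 2) 4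
    \<and> has_node_orbit (pencil (complex_of_real c2)) 240 (dihedral_group 3) 6"
proof (intro conjI)
  have "2 * tau - 1 = sqrt 5" by (simp add: tau_def field_simps)
  then have sqrt10: "sqrt 10 = sqrt 2 * (2 * tau - 1)"
    by (simp flip: real_sqrt_mult)
  show "has_node_orbit (pencil 0) 120 (alt_group 4) 12"
    by (rule has_node_orbit_pencil[OF _ fix_group_tetrahedral alt_group_is_group _ _ cone_node_tetrahedral])
      (simp_all add: vec_eq_iff4 order_def card_alt_group_4)
  show "has_node_orbit (pencil (complex_of_real c1)) 240 (dihedral_group 3) 6"
    by (rule has_node_orbit_dihedral[of "sqrt 2"]) (simp_all add: assms(1) sqrt10)
  show "has_node_orbit (pencil (complex_of_real c2)) 240 (dihedral_group 3) 6"
    by (rule has_node_orbit_dihedral[of "- sqrt 2"]) (simp_all add: assms(2) sqrt10)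
  show "has_node_orbit (pencil (- (1 / 8))) 360 (integer_mod_group 2 \<times>\<times> integer_mod_group 2) 4"
  proof (rule has_node_orbit_pencil[OF _ fix_group_klein _ _ _ cone_node_klein])
    show "klein_point \<noteq> 0" by (simp add: klein_point_def vec_eq_iff4)
    show "group (integer_mod_group 2 \<times>\<times> integer_mod_group 2)"
      by (intro DirProd_group) simp_all
    have "carrier (integer_mod_group 2 \<times>\<times> integer_mod_group 2) = {0..<2} \<times> {0..<2}"
      by (simp add: DirProd_def carrier_integer_mod_group)
    then show "order (integer_mod_group 2 \<times>\<times> integer_mod_group 2) = 4"
      by (simp add: order_def card_cartesian_product)
  qed simp
qed

end
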